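(* Let $\eta>0$. For every $(r,\theta)\in\,]\eta,\infty[\,\times\mathbb{R}$, there exists a unique strong solution $(R^{A^\star}_t,\Theta^{A^\star}_t)_{t\ge 0}$ on $[0,\infty[$ to the system $$\begin{cases}dR^{A^\star}_t=1_{\{R^{A^\star}_t>\eta\}}\,\mu^\star_1(\Theta^{A^\star}_t)\,dt,\\ d\Theta^{A^\star}_t=1_{\{R^{A^\star}_t>\eta\}}\left[\mu^\star_2(R^{A^\star}_t,\Theta^{A^\star}_t)\,dt+\sigma\,dB_t\right],\end{cases}$$ with initial condition $(R^{A^\star}_0,\Theta^{A^\star}_0)=(r,\theta)$. Moreover, the time $\tau^{A^\star}_\eta=\inf\{t:R^{A^\star}_t\le\eta\}$ satisfies $\tau^{A^\star}_\eta\le\sqrt{2}\,(r-\eta)/v$, $\mathbb{P}_{r,\theta}$-a.s. In particular, the feedback strategy $A^\star_t=a^\star(\Theta^{A^\star}_t)$ is an admissible strategy in $\mathcal{A}^\eta$.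
   Context: Fix $v>0$, $\sigma>0$ and a standard real Brownian motion $(B_t)_{t\ge0}$ on a filtered probability space $(\Omega,\mathcal{F},(\mathcal{F}_t)_{t\ge0},\mathbb{P})$; $\mathbb{P}_{r,\theta}$ indicates that the process starts from $(r,\theta)$. For $r>0$ and $\theta\in[-\tfrac{\pi}{4},\tfrac{7\pi}{4}[$ define $$(\mu_1(\theta,1),\mu_2(r,\theta,1))=\begin{cases}(-v\sin\theta,\,-\tfrac{v\cos\theta}{r}),&\theta\in[-\tfrac{\pi}{4},\tfrac{\pi}{2}[,\\(-v,\,0),&\theta\in[\tfrac{\pi}{2},\pi[,\\(v\cos\theta,\,-\tfrac{v\sin\theta}{r}),&\theta\in[\pi,\tfrac{7\pi}{4}[,\end{cases}$$ $$(\mu_1(\theta,-1),\mu_2(r,\theta,-1))=\begin{cases}(-v,\,0),&\theta\in[-\tfrac{\pi}{4},0[\,\cup[\tfrac{3\pi}{2},\tfrac{7\pi}{4}[,\\(-v\cos\theta,\,\tfrac{v\sin\theta}{r}),&\theta\in[0,\tfrac{3\pi}{4}[,\\(v\sin\theta,\,\tfrac{v\cos\theta}{r}),&\theta\in[\tfrac{3\pi}{4},\tfrac{3\pi}{2}[,\end{cases}$$ extended to $\theta\in\mathbb{R}$ by $2\pi$-periodicity. Let $a^\star:\mathbb{R}\to\{+1,-1\}$ be the $2\pi$-periodic function with $a^\star(\theta)=1$ for $\theta\in[\tfrac{\pi}{4},\tfrac{5\pi}{4}[$ and $a^\star(\theta)=-1$ for $\theta\in[-\tfrac{3\pi}{4},\tfrac{\pi}{4}[$,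 and put $\mu^\star_1(\theta)=\mu_1(\theta,a^\star(\theta))$, $\mu^\star_2(r,\theta)=\mu_2(r,\theta,a^\star(\theta))$. **Admissible strategies.** For $(r,\theta)\in\,]\eta,\infty[\times\mathbb{R}$, $\mathcal{A}^\eta=\mathcal{A}^\eta_{r,\theta}$ is the set of jointly measurable $(\mathcal{F}_t)$-adapted processes $A:\mathbb{R}_+\times\Omega\to\{+1,-1\}$ such that (1) the system $dR^A_t=1_{\{R^A_t>\eta\}}\mu_1(\Theta^A_t,A_t)\,dt$, $d\Theta^A_t=1_{\{R^A_t>\eta\}}[\mu_2(R^A_t,\Theta^A_t,A_t)\,dt+\sigma\,dB_t]$, $(R^A_0,\Theta^A_0)=(r,\theta)$, admits a strong solution, and (2) $\mathbb{E}_{r,\theta}(\tau^A_\eta)<\infty$, where $\tau^A_\eta=\inf\{t:R^A_t\le\eta\}$. *)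

theory Defs
  imports "HOL-Probability.Probability" "HOL-Library.Real_Mod"
begin

section \<open>Drift coefficients\<close>

text \<open>The representative of an angle modulo $2\pi$ in the window $[a, a + 2\pi[$; composing a
  function given on that window with \<open>rep a\<close> is its $2\pi$-periodic extension.\<close>

definition rep :: "real \<Rightarrow> real \<Rightarrow> real" where
  "rep a \<theta> = a + ((\<theta> - a) rmod (2 * pi))"

definition mu1 :: "real \<Rightarrow> real \<Rightarrow> int \<Rightarrow> real" where
  "mu1 v \<theta> a = (let x = rep (- pi/4) \<theta> in
     if a = 1 then
       (if x < pi/2 then - v * sin x
        else if x < pi then - v
        else v * cos x)
     else
       (if x < 0 \<or> 3*pi/2 \<le> x then - v
        else if x < 3*pi/4 then - v * cos x
        else v * sin x))"

definition mu2 :: "real \<Rightarrow> real \<Rightarrow> real \<Rightarrow> int \<Rightarrow> real" where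
  "mu2 v r \<theta> a = (let x = rep (- pi/4) \<theta> in
     if a = 1 then
       (if x < pi/2 then - (v * cos x / r)
        else if x < pi then 0
        else - (v * sin x / r))
     else
       (if x < 0 \<or> 3*pi/2 \<le> x then 0
        else if x < 3*pi/4 then v * sin x / r
        else v * cos x / r))"

definition astar :: "real \<Rightarrow> int" where
  "astar \<theta> = (if rep (- 3*pi/4) \<theta> < pi/4 then - 1 else 1)"

definition mu1_star :: "real \<Rightarrow> real \<Rightarrow> real" where
  "mu1_star v \<theta> = mu1 v \<theta> (astar \<theta>)"

definition mu2_star :: "real \<Rightarrow> real \<Rightarrow> real \<Rightarrow> real" where
  "mu2_star v r \<theta> = mu2 v r \<theta> (astar \<theta>)"

section \<open>Brownian motion and the Ito integral\<close>

text \<open>Time is \<open>real\<close>; everything only concerns times in \<open>{0..}\<close>.  (A filtration on \<open>{0..}\<close>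
  extends to \<open>real\<close> by \<open>F t = F 0\<close> for \<open>t < 0\<close>.)  The usual conditions are not imposed.\<close>

locale brownian_motion = prob_space M + filtration "space M" F
  for M :: "'a measure" and F :: "real \<Rightarrow> 'a measure" +
  fixes B :: "real \<Rightarrow> 'a \<Rightarrow> real"
  assumes subalgebra_F: "\<And>t. subalgebra M (F t)"
    and adapted_B: "\<And>t. 0 \<le> t \<Longrightarrow> B t \<in> borel_measurable (F t)"
    and start_B: "AE \<omega> in M. B 0 \<omega> = 0"
    and continuous_B: "\<And>\<omega>. \<omega> \<in> space M \<Longrightarrow> continuous_on {0..} (\<lambda>t. B t \<omega>)"
    and increment_distr: "\<And>s t. 0 \<le> s \<Longrightarrow> s < t \<Longrightarrow>
      distributed M lborel (\<lambda>\<omega>. B t \<omega> - B s \<omega>) (normal_density 0 (sqrt (t - s)))"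
    and increment_indep: "\<And>s t. 0 \<le> s \<Longrightarrow> s < t \<Longrightarrow>
      indep_set (sets (F s)) {(\<lambda>\<omega>. B t \<omega> - B s \<omega>) -` S \<inter> space M | S. S \<in> sets borel}"

text \<open>Simple integrands are $\sum_{i<N} \xi_i 1_{]p_i, p_{i+1}]}$ with bounded
  \<open>F (p i)\<close>-measurable $\xi_i$.\<close>

definition simple_data :: "(real \<Rightarrow> 'a measure) \<Rightarrow> nat \<Rightarrow> (nat \<Rightarrow> real) \<Rightarrow> (nat \<Rightarrow> 'a \<Rightarrow> real) \<Rightarrow> bool" where
  "simple_data F N p \<xi> \<longleftrightarrow> 0 \<le> p 0 \<and> (\<forall>i<N. p i < p (Suc i)) \<and>
     (\<forall>i<N. \<xi> i \<in> borel_measurable (F (p i)) \<and> (\<exists>C. \<forall>\<omega>\<in>space (F (p i)). \<bar>\<xi> i \<omega>\<bar> \<le> C))"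

definition simple_process :: "nat \<Rightarrow> (nat \<Rightarrow> real) \<Rightarrow> (nat \<Rightarrow> 'a \<Rightarrow> real) \<Rightarrow> real \<Rightarrow> 'a \<Rightarrow> real" where
  "simple_process N p \<xi> s \<omega> = (\<Sum>i<N. \<xi> i \<omega> * indicator {p i<..p (Suc i)} s)"

definition simple_integral ::
  "(real \<Rightarrow> 'a \<Rightarrow> real) \<Rightarrow> nat \<Rightarrow> (nat \<Rightarrow> real) \<Rightarrow> (nat \<Rightarrow> 'a \<Rightarrow> real) \<Rightarrow> real \<Rightarrow> 'a \<Rightarrow> real" where
  "simple_integral B N p \<xi> t \<omega> =
     (\<Sum>i<N. \<xi> i \<omega> * (B (min t (p (Suc i))) \<omega> - B (min t (p i)) \<omega>))"

text \<open>\<open>is_ito_integral M F B H I\<close>: the process \<open>I\<close> is a continuous version of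
  $\bigl(\int_0^t H_s\,dB_s\bigr)_{t \ge 0}$, i.e. the $L^2$-limit of the integrals of simple
  integrands converging to \<open>H\<close> in $L^2([0,T] \times \Omega)$ for every \<open>T\<close>.  By the Ito isometry
  \<open>I\<close> does not depend on the approximating sequence, up to indistinguishability.\<close>

definition is_ito_integral ::
  "'a measure \<Rightarrow> (real \<Rightarrow> 'a measure) \<Rightarrow> (real \<Rightarrow> 'a \<Rightarrow> real) \<Rightarrow> (real \<Rightarrow> 'a \<Rightarrow> real) \<Rightarrow>
   (real \<Rightarrow> 'a \<Rightarrow> real) \<Rightarrow> bool" where
  "is_ito_integral M F B H I \<longleftrightarrow>
     (\<lambda>(t, \<omega>). H t \<omega>) \<in> borel_measurable (restrict_space borel {0..} \<Otimes>\<^sub>M M) \<and>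
     (\<forall>t\<ge>0. H t \<in> borel_measurable (F t)) \<and>
     (\<forall>T\<ge>0. (\<integral>\<^sup>+\<omega>. (\<integral>\<^sup>+s\<in>{0..T}. ennreal ((H s \<omega>)\<^sup>2) \<partial>lborel) \<partial>M) < \<infinity>) \<and>
     (\<forall>t\<ge>0. I t \<in> borel_measurable M) \<and>
     (\<forall>\<omega>\<in>space M. continuous_on {0..} (\<lambda>t. I t \<omega>)) \<and>
     (\<exists>N p \<xi>. (\<forall>n. simple_data F (N n) (p n) (\<xi> n)) \<and>
        (\<forall>T\<ge>0. (\<lambda>n. \<integral>\<^sup>+\<omega>. (\<integral>\<^sup>+s\<in>{0..T}.
            ennreal ((simple_process (N n) (p n) (\<xi> n) s \<omega> - H s \<omega>)\<^sup>2) \<partial>lborel) \<partial>M)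
          \<longlonglongrightarrow> 0) \<and>
        (\<forall>t\<ge>0. (\<lambda>n. \<integral>\<^sup>+\<omega>. ennreal ((simple_integral B (N n) (p n) (\<xi> n) t \<omega> - I t \<omega>)\<^sup>2) \<partial>M)
          \<longlonglongrightarrow> 0))"

section \<open>Strong solutions and admissible strategies\<close>

text \<open>\<open>strong_solution M F B \<sigma> \<eta> b1 b2 r \<theta> R \<Theta>\<close>: on the given probability space, with the given
  Brownian motion, \<open>(R, \<Theta>)\<close> is a continuous \<open>F\<close>-adapted solution on $[0,\infty[$ of
  \[ dR_t = 1_{\{R_t > \eta\}}\, b_1(t, \omega, \Theta_t)\,dt, \quad
     d\Theta_t = 1_{\{R_t > \eta\}} [b_2(t, \omega, R_t, \Theta_t)\,dt + \sigma\,dB_t] \]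
  started at \<open>(r, \<theta>)\<close>.  The coefficients may be random, which accommodates controls.  If \<open>F\<close> is the
  (augmented) filtration generated by \<open>B\<close>, the solution is a functional of the Brownian path.\<close>

definition strong_solution ::
  "'a measure \<Rightarrow> (real \<Rightarrow> 'a measure) \<Rightarrow> (real \<Rightarrow> 'a \<Rightarrow> real) \<Rightarrow> real \<Rightarrow> real \<Rightarrow>
   (real \<Rightarrow> 'a \<Rightarrow> real \<Rightarrow> real) \<Rightarrow> (real \<Rightarrow> 'a \<Rightarrow> real \<Rightarrow> real \<Rightarrow> real) \<Rightarrow>
   real \<Rightarrow> real \<Rightarrow> (real \<Rightarrow> 'a \<Rightarrow> real) \<Rightarrow> (real \<Rightarrow> 'a \<Rightarrow> real) \<Rightarrow> bool" where
  "strong_solution M F B \<sigma> \<eta> b1 b2 r \<theta> R \<Theta> \<longleftrightarrow>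
     (\<forall>t\<ge>0. R t \<in> borel_measurable (F t) \<and> \<Theta> t \<in> borel_measurable (F t)) \<and>
     (\<forall>\<omega>\<in>space M. continuous_on {0..} (\<lambda>t. R t \<omega>) \<and> continuous_on {0..} (\<lambda>t. \<Theta> t \<omega>)) \<and>
     (AE \<omega> in M. R 0 \<omega> = r \<and> \<Theta> 0 \<omega> = \<theta>) \<and>
     (AE \<omega> in M. \<forall>t\<ge>0.
        set_integrable lborel {0..t} (\<lambda>s. indicator {\<eta><..} (R s \<omega>) * b1 s \<omega> (\<Theta> s \<omega>)) \<and>
        set_integrable lborel {0..t} (\<lambda>s. indicator {\<eta><..} (R s \<omega>) * b2 s \<omega> (R s \<omega>) (\<Theta> s \<omega>))) \<and>
     (AE \<omega> in M. \<forall>t\<ge>0.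
        R t \<omega> = R 0 \<omega> + (LINT s:{0..t}|lborel. indicator {\<eta><..} (R s \<omega>) * b1 s \<omega> (\<Theta> s \<omega>))) \<and>
     (\<exists>I. is_ito_integral M F B (\<lambda>s \<omega>. indicator {\<eta><..} (R s \<omega>) * \<sigma>) I \<and>
        (AE \<omega> in M. \<forall>t\<ge>0.
           \<Theta> t \<omega> = \<Theta> 0 \<omega>
             + (LINT s:{0..t}|lborel. indicator {\<eta><..} (R s \<omega>) * b2 s \<omega> (R s \<omega>) (\<Theta> s \<omega>))
             + I t \<omega>))"

definition indistinguishable :: "'a measure \<Rightarrow> (real \<Rightarrow> 'a \<Rightarrow> real) \<Rightarrow> (real \<Rightarrow> 'a \<Rightarrow> real) \<Rightarrow> bool" where
  "indistinguishable M X Y \<longleftrightarrow> (AE \<omega> in M. \<forall>t\<ge>0. X t \<omega> = Y t \<omega>)"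

text \<open>The infimum is taken in \<open>ennreal\<close>, so it is \<open>\<infinity>\<close> if the level is never reached.\<close>

definition hitting_time :: "real \<Rightarrow> (real \<Rightarrow> 'a \<Rightarrow> real) \<Rightarrow> 'a \<Rightarrow> ennreal" where
  "hitting_time \<eta> R \<omega> = Inf (ennreal ` {t. 0 \<le> t \<and> R t \<omega> \<le> \<eta>})"

definition admissible ::
  "'a measure \<Rightarrow> (real \<Rightarrow> 'a measure) \<Rightarrow> (real \<Rightarrow> 'a \<Rightarrow> real) \<Rightarrow> real \<Rightarrow> real \<Rightarrow> real \<Rightarrow>
   real \<Rightarrow> real \<Rightarrow> (real \<Rightarrow> 'a \<Rightarrow> int) set" where
  "admissible M F B v \<sigma> \<eta> r \<theta> = {A.
     (\<lambda>(t, \<omega>). A t \<omega>) \<in> restrict_space borel {0..} \<Otimes>\<^sub>M M \<rightarrow>\<^sub>M count_space {1, - 1} \<and>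
     (\<forall>t\<ge>0. A t \<in> F t \<rightarrow>\<^sub>M count_space {1, - 1}) \<and>
     (\<exists>R \<Theta>. strong_solution M F B \<sigma> \<eta>
          (\<lambda>t \<omega> y. mu1 v y (A t \<omega>)) (\<lambda>t \<omega> x y. mu2 v x y (A t \<omega>)) r \<theta> R \<Theta> \<and>
        (\<integral>\<^sup>+\<omega>. hitting_time \<eta> R \<omega> \<partial>M) < \<infinity>)}"

end

theory Submission
  imports Defs
begin

text \<open>
  Under the strategy \<open>astar\<close> the drift is $(-v\,g(\theta),\ v\,h(\theta)/r)$ with $\pi$-periodic rates
  \<open>g = radial_rate\<close> and \<open>h = angular_rate\<close>, which on $[0, \pi]$ are
  \[ g = \cos,\ h = \sin \mbox{ on } [0, \pi/4[, \quad g = \sin,\ h = -\cos \mbox{ on } [\pi/4, \pi/2],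
     \quad g = 1,\ h = 0 \mbox{ on } [\pi/2, \pi]. \]
  Three features make the system solvable pathwise, without a change of measure or a weak solution:
  $g$ is Lipschitz, $g \ge 1/\sqrt 2$, and $h$ jumps only downwards, at $\pi/4 + \pi \bf Z$, so that
  $h(y) - h(x) \le y - x$ for $x \le y$.  Apart from $|h| \le 1$, this one-sided Lipschitz bound
  (\<open>rates_increment\<close>) is what the argument knows of $h$.

  Since $R' \le -v/\sqrt 2$ as long as $R > \eta$, the level $\eta$ is reached by time
  $\sqrt 2 (r - \eta)/v$, whatever the noise does (\<open>radius_reaches_level\<close>).

  The noise is additive: $X = \Theta - \theta - \sigma B$ satisfies, path by path, an ordinary
  differential equation in which the Brownian path is a continuous parameter.  The one-sided
  bound lets the distance of two solutions for the same path grow at most exponentially, which gives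
  uniqueness.  The same estimate tolerates small errors in the arguments of the drift
  (\<open>perturbed_solution_difference\<close>); it therefore shows that the Euler scheme is Cauchy, and its limit
  is adapted because every Euler approximation is.

  The limit could fail to solve the equation only because of time spent on the discontinuities of $h$; for
  a constant driving path starting at a discontinuity it does fail.  Here the noise enters: $X$ is Lipschitz, so over
  a time step $\varepsilon$ it moves by $O(\varepsilon)$, whereas $B$ has an independent increment with
  density of order $\varepsilon^{-1/2}$.  Thus $\sigma B_t + X_t$ hits a given point at a given time with
  probability $O(\varepsilon^{1/2})$ for every $\varepsilon$, that is, with probability zero
  (\<open>lipschitz_perturbation_misses_point\<close>), and almost every path spends no time in the countable
  set of discontinuities.

  It remains to identify the stochastic integral.  The integrand $\sigma 1_{\{R_s > \eta\}}$ is
  $\sigma 1_{\{s < \tau\}}$, and by the isometry every version of its integral is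
  $\sigma (B_{t \wedge \tau} - B_0)$.  This is proved from
  approximation by simple integrands on a uniform grid (\<open>ito_integral_of_stopped_constant\<close> and
  \<open>ito_integral_of_stopped_constant_unique\<close>).  The stopped Euler limit is then a strong solution, and
  every strong solution is one of the stopped paths for which uniqueness was shown.
\<close>

section \<open>The rates of the closed-loop drift\<close>

lemma rep_eqI:
  assumes "\<theta> = x + 2 * pi * of_int k" "a \<le> x" "x < a + 2 * pi"
  shows "rep a \<theta> = x"
proof -
  have "(\<theta> - a) rmod (2 * pi) = x - a"
    by (rule rmod_unique[of _ _ _ k]) (use assms in auto)
  then show ?thesis by (simp add: rep_def)
qed

definition radial_rate :: "real \<Rightarrow> real" where
  "radial_rate \<theta> = - mu1_star 1 \<theta>"

definition angular_rate :: "real \<Rightarrow> real" where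
  "angular_rate \<theta> = mu2_star 1 1 \<theta>"

lemma mu1_star_eq: "mu1_star v \<theta> = - v * radial_rate \<theta>"
  by (simp add: radial_rate_def mu1_star_def mu1_def Let_def)

lemma mu2_star_eq: "mu2_star v r \<theta> = v * angular_rate \<theta> / r"
  by (simp add: angular_rate_def mu2_star_def mu2_def Let_def)

text \<open>Everything about the rates is read off from this normal form.  Shifting the angle by $\pi$ exchanges
the two actions and changes the signs of sine and cosine, which is why one formula covers all
eight pieces of the definition; the two windows used by \<open>mu1\<close> and \<open>astar\<close> differ, hence the case
distinction on the parity of \<open>j\<close>.\<close>

lemma rates_cell:
  fixes j :: int
  assumes x: "0 \<le> x" "x \<le> pi"
  shows "radial_rate (x + pi * of_int j)
           = (if x \<le> pi / 4 then cos x else if x \<le> pi / 2 then sin x else 1)" (is ?radial)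
    and "angular_rate (x + pi * of_int j)
           = (if x < pi / 4 then sin x else if x \<le> pi / 2 then - cos x else 0)" (is ?angular)
proof -
  define \<theta> where "\<theta> = x + pi * of_int j"
  note defs = radial_rate_def angular_rate_def mu1_star_def mu2_star_def mu1_def mu2_def
    astar_def Let_def
  have quarter: "cos (pi / 4) = sin (pi / 4)" by (simp add: cos_45 sin_45)
  have special: "x = pi / 4 \<Longrightarrow> cos x = sin x" "x = pi / 2 \<Longrightarrow> sin x = 1" "x = pi / 2 \<Longrightarrow> cos x = 0"
    by (simp_all only: quarter sin_pi_half cos_pi_half)
  have big: "x * 4 < 7 * pi" "x * 4 < 5 * pi" using x pi_gt_zero by linarith+
  have "radial_rate \<theta> = (if x \<le> pi / 4 then cos x else if x \<le> pi / 2 then sin x else 1) \<and>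
        angular_rate \<theta> = (if x < pi / 4 then sin x else if x \<le> pi / 2 then - cos x else 0)"
  proof (cases "even j")
    case True
    then obtain k where k: "j = 2 * k" by blast
    have r: "rep (- pi / 4) \<theta> = x" "rep (- 3 * pi / 4) \<theta> = x"
      using x big by (auto intro!: rep_eqI[of _ _ k] simp: \<theta>_def k)
    show ?thesis
      using x special unfolding defs r by (cases "x = pi / 2"; cases "x = pi / 4"; cases "x = 0"; cases "x = pi") auto
  next
    case False
    then obtain k where k: "j = 2 * k + 1" by (elim oddE)
    have 1: "rep (- pi / 4) \<theta> = (if x < 3 * pi / 4 then x + pi else x - pi)"
    proof (cases "x < 3 * pi / 4")
      case True
      then show ?thesis using x big
        by (simp, intro rep_eqI[of _ _ k]) (auto simp: \<theta>_def k algebra_simps)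
    next
      case False
      then show ?thesis using x big
        by (simp, intro rep_eqI[of _ _ "k + 1"]) (auto simp: \<theta>_def k algebra_simps)
    qed
    have 2: "rep (- 3 * pi / 4) \<theta> = (if x < pi / 4 then x + pi else x - pi)"
    proof (cases "x < pi / 4")
      case True
      then show ?thesis using x big
        by (simp, intro rep_eqI[of _ _ k]) (auto simp: \<theta>_def k algebra_simps)
    next
      case False
      then show ?thesis using x big
        by (simp, intro rep_eqI[of _ _ "k + 1"]) (auto simp: \<theta>_def k algebra_simps)
    qed
    show ?thesis
      using x special unfolding defs 1 2
      by (cases "x = pi / 2"; cases "x = pi / 4"; cases "x = 0"; cases "x = pi") auto
  qed
  then show ?radial ?angular by (auto simp: \<theta>_def)
qed

lemma rates_reduce:
  obtains x and j :: int where "\<theta> = x + pi * of_int j" "0 \<le> x" "x < pi"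
proof
  show "\<theta> = (\<theta> - pi * \<lfloor>\<theta> / pi\<rfloor>) + pi * of_int \<lfloor>\<theta> / pi\<rfloor>" by simp
  show "0 \<le> \<theta> - pi * \<lfloor>\<theta> / pi\<rfloor>" "\<theta> - pi * \<lfloor>\<theta> / pi\<rfloor> < pi"
    using floor_divide_lower[of pi \<theta>] floor_divide_upper[of pi \<theta>] by (auto simp: algebra_simps)
qed

lemma sin_ge_sqrt_half: "sqrt 2 / 2 \<le> sin x" if "pi / 4 \<le> x" "x \<le> pi / 2"
  using sin_monotone_2pi_le[of "pi/4" x] that by (simp add: sin_45)

lemma cos_ge_sqrt_half: "sqrt 2 / 2 \<le> cos x" if "0 \<le> x" "x \<le> pi / 4"
  using cos_monotone_0_pi_le[of x "pi/4"] that by (simp add: cos_45)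

lemma radial_rate_ge: "sqrt 2 / 2 \<le> radial_rate \<theta>"
  and radial_rate_le: "radial_rate \<theta> \<le> 1"
  and angular_rate_bound: "\<bar>angular_rate \<theta>\<bar> \<le> 1"
proof -
  obtain x and j :: int where x: "\<theta> = x + pi * of_int j" "0 \<le> x" "x < pi" by (rule rates_reduce)
  have "sqrt 2 / 2 \<le> (1::real)" by (simp add: real_le_lsqrt)
  then show "sqrt 2 / 2 \<le> radial_rate \<theta>" "radial_rate \<theta> \<le> 1" "\<bar>angular_rate \<theta>\<bar> \<le> 1"
    using x sin_ge_sqrt_half[of x] cos_ge_sqrt_half[of x] by (auto simp: rates_cell)
qed

lemma abs_sin_diff_le: "\<bar>sin x - sin y\<bar> \<le> \<bar>x - y\<bar>" for x y :: real
proof -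
  have "\<bar>sin x - sin y\<bar> = 2 * \<bar>sin ((x - y) / 2)\<bar> * \<bar>cos ((x + y) / 2)\<bar>"
    by (simp add: sin_diff_sin abs_mult)
  also have "\<dots> \<le> 2 * \<bar>(x - y) / 2\<bar> * 1"
    by (intro mult_mono abs_sin_x_le_abs_x) auto
  finally show ?thesis by simp
qed

lemma abs_cos_diff_le: "\<bar>cos x - cos y\<bar> \<le> \<bar>x - y\<bar>" for x y :: real
  using abs_sin_diff_le[of "pi/2 - x" "pi/2 - y"] by (simp add: sin_diff)

text \<open>A bound on increments is additive, so it suffices to check it within the cells of a grid; this
handles the Lipschitz bound of one rate and the one-sided bound of the other together.\<close>

lemma transitive_relation_from_cells:
  fixes p :: real
  assumes p: "p > 0"
    and cell: "\<And>(j::int) x y. p * of_int j \<le> x \<Longrightarrow> x \<le> y \<Longrightarrow> y \<le> p * of_int (j + 1) \<Longrightarrow> Q x y"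
    and trans: "\<And>x y z. x \<le> y \<Longrightarrow> y \<le> z \<Longrightarrow> Q x y \<Longrightarrow> Q y z \<Longrightarrow> Q x z"
    and "x \<le> y"
  shows "Q x y"
proof -
  have "p * of_int j \<le> x \<Longrightarrow> x \<le> y \<Longrightarrow> y \<le> p * of_int (j + int n) \<Longrightarrow> Q x y" for j n x y
  proof (induction n arbitrary: j x y)
    case 0
    then have "x = y" by simp
    then show ?case
      using 0 p by (intro cell[of j]) (auto simp: algebra_simps)
  next
    case (Suc n)
    show ?case
    proof (cases "y \<le> p * of_int (j + 1)")
      case True
      then show ?thesis using cell Suc by blast
    next
      case y: False
      show ?thesis
      proof (cases "x \<le> p * of_int (j + 1)")
        case True
        have "Q x (p * of_int (j + 1))" using Suc True by (intro cell) auto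
        moreover have "Q (p * of_int (j + 1)) y"
          using Suc y by (intro Suc.IH[of "j + 1"]) (auto simp: algebra_simps)
        ultimately show ?thesis using True y by (intro trans[of x "p * of_int (j + 1)" y]) auto
      next
        case False
        then show ?thesis using Suc by (intro Suc.IH[of "j + 1"]) (auto simp: algebra_simps)
      qed
    qed
  qed
  note * = this
  have "p * \<lfloor>x / p\<rfloor> \<le> x"
    using floor_divide_lower[OF p, of x] by (simp add: algebra_simps)
  moreover have "y \<le> p * of_int (\<lfloor>x / p\<rfloor> + int (nat \<lceil>y / p - x / p + 1\<rceil>))"
  proof -
    have "y / p \<le> of_int (\<lfloor>x / p\<rfloor> + int (nat \<lceil>y / p - x / p + 1\<rceil>))" by linarith
    then show ?thesis using p by (simp add: field_simps)
  qed
  ultimately show ?thesis using * \<open>x \<le> y\<close> by blast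
qed

text \<open>On each half-open cell of length $\pi/4$ the rates are $\pm\sin$, $\pm\cos$ or constant.  The value of
\<open>angular_rate\<close> at the right end of the first cell is that of the next piece,
$-\cos(\pi/4) < \sin(\pi/4)$; it lies below the left limit, which helps the one-sided inequality.\<close>

lemma rates_increment:
  assumes "x \<le> y"
  shows "\<bar>radial_rate y - radial_rate x\<bar> \<le> y - x \<and> angular_rate y - angular_rate x \<le> y - x"
proof (rule transitive_relation_from_cells[of "pi/4" _ x y])
  fix j :: int and x y :: real
  assume xy: "pi / 4 * of_int j \<le> x" "x \<le> y" "y \<le> pi / 4 * of_int (j + 1)"
  define k where "k = j div 4"
  define i where "i = j mod 4"
  have j: "j = 4 * k + i" "i \<in> {0, 1, 2, 3}" unfolding i_def k_def by auto
  define a where "a = x - pi * k"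
  define b where "b = y - pi * k"
  have ab: "x = a + pi * k" "y = b + pi * k" by (auto simp: a_def b_def)
  have le: "pi / 4 * i \<le> a" "a \<le> b" "b \<le> pi / 4 * (i + 1)"
    using xy j(1) by (auto simp: a_def b_def algebra_simps)
  have bd: "0 \<le> a" "a \<le> pi" "0 \<le> b" "b \<le> pi"
    using le j(2) pi_gt_zero by auto
  note val = rates_cell[OF bd(1,2), of k] rates_cell[OF bd(3,4), of k]
  have sc: "\<bar>sin b - sin a\<bar> \<le> b - a" "\<bar>cos b - cos a\<bar> \<le> b - a"
    using abs_sin_diff_le[of b a] abs_cos_diff_le[of b a] le(2) by auto
  have quarter: "sin (pi / 4) = sqrt 2 / 2" "cos (pi / 4) = sqrt 2 / 2" "sqrt 2 > (0::real)"
    by (simp_all add: sin_45 cos_45)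
  consider "i = 0" | "i = 1" | "i = 2" | "i = 3" using j(2) by auto
  then show "\<bar>radial_rate y - radial_rate x\<bar> \<le> y - x \<and> angular_rate y - angular_rate x \<le> y - x"
  proof cases
    case 1
    then have "a \<le> pi / 4" "b \<le> pi / 4" using le by auto
    have "radial_rate y = cos b" "radial_rate x = cos a"
      using \<open>a \<le> pi / 4\<close> \<open>b \<le> pi / 4\<close> by (simp_all add: ab val)
    moreover have "angular_rate y - angular_rate x \<le> b - a"
    proof (cases "a = pi / 4")
      case True
      then have "a = b" using le(2) \<open>b \<le> pi / 4\<close> by simp
      then show ?thesis by (simp add: ab)
    next
      case False
      have "0 \<le> cos b" "0 \<le> sin b"
        using bd \<open>b \<le> pi / 4\<close> pi_gt_zero by (auto intro!: cos_ge_zero sin_ge_zero simp del: pi_gt_zero)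
      then have "angular_rate y \<le> sin b" using \<open>b \<le> pi / 4\<close> by (simp add: ab val)
      moreover have "angular_rate x = sin a" using False \<open>a \<le> pi / 4\<close> by (simp add: ab val)
      ultimately show ?thesis using sc by auto
    qed
    ultimately show ?thesis using sc by (simp add: ab)
  next
    case 2
    then have "pi / 4 \<le> a" "a \<le> pi / 2" "pi / 4 \<le> b" "b \<le> pi / 2" using le by auto
    moreover have "a = pi / 4 \<Longrightarrow> cos a = sin a" "b = pi / 4 \<Longrightarrow> cos b = sin b"
      by (simp_all only: quarter)
    ultimately have "radial_rate y = sin b" "radial_rate x = sin a"
      "angular_rate y = - cos b" "angular_rate x = - cos a"
      by (auto simp: ab val not_less)
    then show ?thesis using sc by (simp add: ab)
  next
    case 3
    then have "pi / 2 \<le> a" "pi / 2 \<le> b" using le by auto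
    moreover from this have "pi / 4 < a" "pi / 4 < b" using pi_gt_zero by linarith+
    moreover have "a = pi / 2 \<Longrightarrow> sin a = 1 \<and> cos a = 0" "b = pi / 2 \<Longrightarrow> sin b = 1 \<and> cos b = 0"
      by (simp_all only: sin_pi_half cos_pi_half simp_thms)
    ultimately have "radial_rate y = 1" "radial_rate x = 1" "angular_rate y = 0" "angular_rate x = 0"
      by (auto simp: ab val)
    then show ?thesis using le(2) by (simp add: ab)
  next
    case 4
    then have "pi * 3 / 4 \<le> a" "pi * 3 / 4 \<le> b" using le by auto
    then have "pi / 2 < a" "pi / 2 < b" using pi_gt_zero by linarith+
    moreover from this have "pi / 4 < a" "pi / 4 < b" using pi_gt_zero by linarith+
    ultimately show ?thesis using le(2) by (simp add: ab val)
  qed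
qed (use assms in auto)

section \<open>A pathwise comparison estimate\<close>

text \<open>The integrand is controlled only where the path exceeds \<open>\<delta>\<close>.  Starting the integration at the last
time at which the path was at or below \<open>\<delta>\<close> makes this sufficient, and it replaces
differentiating the square of a difference.\<close>

lemma integral_bound_above_level:
  fixes w f p :: "real \<Rightarrow> real"
  assumes int: "\<And>t. 0 \<le> t \<Longrightarrow> t \<le> T \<Longrightarrow> (f has_integral w t) {0..t}"
    and "0 \<le> \<delta>" and p: "continuous_on {0..T} p" "\<And>s. s \<in> {0..T} \<Longrightarrow> 0 \<le> p s"
    and le: "\<And>s. 0 \<le> s \<Longrightarrow> s \<le> T \<Longrightarrow> \<delta> < w s \<Longrightarrow> f s \<le> p s"
    and t: "0 \<le> t" "t \<le> T"
  shows "w t \<le> \<delta> + integral {0..t} p"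
proof (cases "w t \<le> \<delta>")
  case True
  have "0 \<le> integral {0..t} p"
    using t p by (intro integral_nonneg integrable_continuous_interval continuous_on_subset[OF p(1)]) auto
  then show ?thesis using True by simp
next
  case False
  have w_eq: "w s = integral {0..s} f" if "s \<in> {0..T}" for s
    using int[of s] that by (simp add: integral_unique)
  have f_int: "f integrable_on {0..T}" using int[of T] t by auto
  have "continuous_on {0..T} (\<lambda>s. integral {0..s} f)"
    by (rule indefinite_integral_continuous_1[OF f_int])
  then have w_cont: "continuous_on {0..T} w"
    by (subst continuous_on_cong[OF refl w_eq])
  have w0: "w 0 = 0" using w_eq[of 0] t by simp
  define S where "S = {s \<in> {0..t}. w s \<le> \<delta>}"
  have "closed S" unfolding S_def
    using t by (intro continuous_on_closed_Collect_le continuous_on_subset[OF w_cont]) auto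
  then have S: "compact S" "S \<noteq> {}"
    using w0 t \<open>0 \<le> \<delta>\<close> unfolding S_def
    by (auto simp: compact_eq_bounded_closed intro: bounded_subset[of "{0..t}"])
  obtain s0 where s0: "s0 \<in> S" "\<And>s. s \<in> S \<Longrightarrow> s \<le> s0"
    using compact_attains_sup[OF S] by blast
  have s0_le: "0 \<le> s0" "s0 \<le> t" "w s0 \<le> \<delta>" using s0(1) by (auto simp: S_def)
  have above: "\<delta> < w s" if "s0 < s" "s \<le> t" for s
    using s0(2)[of s] that s0_le by (force simp: S_def)
  have f_int2: "f integrable_on {0..t}" using int t by auto
  have comb: "integral {0..s0} f + integral {s0..t} f = integral {0..t} f"
    by (rule Henstock_Kurzweil_Integration.integral_combine) (use s0_le f_int2 in auto)
  have p_int: "p integrable_on {a..b}" if "0 \<le> a" "b \<le> t" for a b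
    using that t by (intro integrable_continuous_interval continuous_on_subset[OF p(1)]) auto
  have "(f has_integral integral {s0..t} f) {s0..t}"
    using f_int2 s0_le by (intro integrable_integral integrable_on_subinterval[OF f_int2]) auto
  then have "((\<lambda>s. if s = s0 then p s else f s) has_integral integral {s0..t} f) {s0..t}"
    by (rule has_integral_spike_finite[of "{s0}", rotated 2]) auto
  then have "integral {s0..t} f \<le> integral {s0..t} p"
    using p_int[of s0 t] s0_le t
    by (elim has_integral_le[OF _ integrable_integral]) (auto intro!: le above)
  also have "\<dots> \<le> integral {0..t} p"
    using s0_le p t by (intro integral_subset_le p_int) auto
  finally show ?thesis
    using w_eq[of t] w_eq[of s0] t s0_le comb by auto
qed

text \<open>Maximise $\varphi(t) e^{-2Ct}$: at a point where it attains its maximum $m$, the integral inequality gives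
$m \le a + m/2$.\<close>

lemma gronwall_bound:
  fixes \<phi> :: "real \<Rightarrow> real"
  assumes "continuous_on {0..T} \<phi>" "0 < C" "0 \<le> a"
    and le: "\<And>t. 0 \<le> t \<Longrightarrow> t \<le> T \<Longrightarrow> \<phi> t \<le> a + C * integral {0..t} \<phi>"
    and t: "0 \<le> t" "t \<le> T"
  shows "\<phi> t \<le> 2 * a * exp (2 * C * t)"
proof -
  have "continuous_on {0..T} (\<lambda>s. \<phi> s * exp (- (2 * C * s)))"
    using assms by (intro continuous_intros) auto
  then obtain u where u: "u \<in> {0..T}"
      "\<And>s. s \<in> {0..T} \<Longrightarrow> \<phi> s * exp (- (2 * C * s)) \<le> \<phi> u * exp (- (2 * C * u))"
    using continuous_attains_sup[of "{0..T}" "\<lambda>s. \<phi> s * exp (- (2 * C * s))"] t by auto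
  define m where "m = \<phi> u * exp (- (2 * C * u))"
  have \<phi>_le: "\<phi> s \<le> m * exp (2 * C * s)" if "s \<in> {0..T}" for s
  proof -
    have "\<phi> s * exp (- (2 * C * s)) * exp (2 * C * s) \<le> m * exp (2 * C * s)"
      using u(2)[OF that] by (intro mult_right_mono) (auto simp: m_def)
    then show ?thesis by (simp add: mult.assoc flip: exp_add)
  qed
  have "((\<lambda>s. m * exp (2 * C * s)) has_integral
      m * exp (2 * C * u) / (2 * C) - m * exp (2 * C * 0) / (2 * C)) {0..u}"
    using u(1) \<open>0 < C\<close>
    by (intro fundamental_theorem_of_calculus)
      (auto intro!: derivative_eq_intros simp flip: has_real_derivative_iff_has_vector_derivative)
  moreover have "\<phi> integrable_on {0..u}"
    using u by (intro integrable_continuous_interval continuous_on_subset[OF assms(1)]) auto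
  ultimately have "integral {0..u} \<phi> \<le> m * exp (2 * C * u) / (2 * C) - m * exp (2 * C * 0) / (2 * C)"
    using \<phi>_le u(1) by (elim has_integral_le[OF integrable_integral]) auto
  then have "C * integral {0..u} \<phi> \<le> C * (m * exp (2 * C * u) / (2 * C) - m / (2 * C))"
    using \<open>0 < C\<close> by (intro mult_left_mono) auto
  also have "\<dots> = m * exp (2 * C * u) / 2 - m / 2"
    using \<open>0 < C\<close> by (simp add: field_simps)
  finally have "\<phi> u \<le> a + m * exp (2 * C * u) / 2 - m / 2"
    using le[of u] u(1) by auto
  moreover have "\<phi> u = m * exp (2 * C * u)"
    unfolding m_def by (simp add: mult.assoc flip: exp_add)
  ultimately have "m * (1 + exp (2 * C * u)) \<le> 2 * a" by (simp add: algebra_simps)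
  moreover have "m \<le> 0 \<or> m * 1 \<le> m * (1 + exp (2 * C * u))"
    by (cases "m \<le> 0") (auto simp: mult_left_mono)
  ultimately have "m \<le> 2 * a" using \<open>0 \<le> a\<close> by auto
  then have "m * exp (2 * C * t) \<le> 2 * a * exp (2 * C * t)" by (intro mult_right_mono) auto
  then show ?thesis using \<phi>_le[of t] t by (intro order_trans[OF _ \<open>m * exp (2 * C * t) \<le> _\<close>]) auto
qed

text \<open>The drift is $(-v\,g(\theta),\ v\,h(\theta)/r)$, and \<open>\<eta>\<close> is the radius at which the motion
stops.\<close>

locale one_sided_drift =
  fixes v \<eta> :: real and g h :: "real \<Rightarrow> real"
  assumes v_pos: "0 < v" and \<eta>_pos: "0 < \<eta>"
    and g_lipschitz: "\<And>x y. \<bar>g x - g y\<bar> \<le> \<bar>x - y\<bar>"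
    and g_ge: "\<And>x. sqrt 2 / 2 \<le> g x" and g_le: "\<And>x. g x \<le> 1"
    and h_bound: "\<And>x. \<bar>h x\<bar> \<le> 1"
    and h_one_sided: "\<And>x y. x \<le> y \<Longrightarrow> h y - h x \<le> y - x"
begin

text \<open>The driving path is \<open>c\<close>, the angle is \<open>c + X\<close>, and the drift is evaluated at arguments \<open>\<rho>\<close> and \<open>y\<close> that
may be off by \<open>\<delta>\<close>.  Genuine solutions have \<open>\<delta> = 0\<close>; an Euler polygon has as arguments its values
at the preceding grid point.  The radius in the denominator is replaced by \<open>\<eta>\<close> when it is smaller,
so that unstopped paths make sense for all times.\<close>

definition perturbed_solution ::
  "real \<Rightarrow> (real \<Rightarrow> real) \<Rightarrow> real \<Rightarrow> real \<Rightarrow> (real \<Rightarrow> real) \<Rightarrow> (real \<Rightarrow> real) \<Rightarrow>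
   (real \<Rightarrow> real) \<Rightarrow> (real \<Rightarrow> real) \<Rightarrow> bool" where
  "perturbed_solution r c T \<delta> R X \<rho> y \<longleftrightarrow> (\<forall>t\<in>{0..T}.
     ((\<lambda>s. - v * g (y s)) has_integral (R t - r)) {0..t} \<and>
     ((\<lambda>s. v * h (y s) / max (\<rho> s) \<eta>) has_integral X t) {0..t} \<and>
     \<bar>\<rho> t - R t\<bar> \<le> \<delta> \<and> \<bar>y t - (c t + X t)\<bar> \<le> \<delta>)"

definition lip_const :: real where "lip_const = v + v / \<eta> + v / \<eta>\<^sup>2"

lemma lip_const_pos: "0 < lip_const"
  using v_pos \<eta>_pos by (simp add: lip_const_def add_pos_pos)

text \<open>Only the upper angle minus the lower one is bounded: a jump of \<open>h\<close> between the two decreases the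
left-hand side.\<close>

lemma drift_difference_le:
  assumes "y' \<le> y"
  shows "v * h y / max \<rho> \<eta> - v * h y' / max \<rho>' \<eta> \<le> v / \<eta> * (y - y') + v / \<eta>\<^sup>2 * \<bar>\<rho> - \<rho>'\<bar>"
proof -
  define m m' where "m = max \<rho> \<eta>" and "m' = max \<rho>' \<eta>"
  have m: "\<eta> \<le> m" "\<eta> \<le> m'" "\<bar>m - m'\<bar> \<le> \<bar>\<rho> - \<rho>'\<bar>" by (auto simp: m_def m'_def)
  have pos: "0 < m" "0 < m'" using m \<eta>_pos by auto
  have "v * h y / m - v * h y' / m' = v / m * (h y - h y') + h y' * (v * (m' - m) / (m * m'))"
    using pos by (simp add: field_simps)
  also have "v / m * (h y - h y') \<le> v / m * (y - y')"
    using h_one_sided[OF assms] v_pos pos by (intro mult_left_mono) auto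
  also have "\<dots> \<le> v / \<eta> * (y - y')"
    using m v_pos \<eta>_pos assms by (intro mult_right_mono divide_left_mono) auto
  also have "h y' * (v * (m' - m) / (m * m')) \<le> \<bar>h y' * (v * (m' - m) / (m * m'))\<bar>"
    by (rule abs_ge_self)
  also have "\<dots> = \<bar>h y'\<bar> * (v * \<bar>m' - m\<bar> / (m * m'))"
    using pos v_pos by (simp add: abs_mult)
  also have "\<dots> \<le> 1 * (v * \<bar>\<rho> - \<rho>'\<bar> / (\<eta> * \<eta>))"
    using h_bound[of y'] v_pos pos m \<eta>_pos
    by (intro mult_mono frac_le) auto
  finally show ?thesis by (simp add: m_def m'_def power2_eq_square)
qed

text \<open>If the angles differ by more than $2\delta$, then the perturbed arguments are ordered in the same
way as the angles, so the one-sided bound applies to the drifts as evaluated; smaller differences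
are absorbed by \<open>integral_bound_above_level\<close>.  Both signs of the angular difference are treated
alike, and Gronwall's inequality concludes.\<close>

lemma perturbed_solution_difference:
  assumes sol: "perturbed_solution r c T \<delta> R X \<rho> y" "perturbed_solution r c T \<delta> R' X' \<rho>' y'"
    and "0 \<le> \<delta>" and t: "0 \<le> t" "t \<le> T"
  shows "\<bar>R t - R' t\<bar> + \<bar>X t - X' t\<bar> \<le> 12 * \<delta> * exp (2 * lip_const * T)"
proof -
  define u w where "u t = R t - R' t" and "w t = X t - X' t" for t
  \<comment> \<open>adding \<open>4 * \<delta>\<close> lets \<open>\<phi>\<close> dominate every error term that occurs below\<close>
  define \<phi> where "\<phi> t = \<bar>u t\<bar> + \<bar>w t\<bar> + 4 * \<delta>" for t
  define f1 where "f1 s = - v * g (y s) - (- v * g (y' s))" for s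
  define f2 where "f2 s = v * h (y s) / max (\<rho> s) \<eta> - v * h (y' s) / max (\<rho>' s) \<eta>" for s
  have u: "(f1 has_integral u t) {0..t}" and w: "(f2 has_integral w t) {0..t}"
    if "0 \<le> t" "t \<le> T" for t
    using has_integral_diff[of "\<lambda>s. - v * g (y s)" "R t - r" "{0..t}" "\<lambda>s. - v * g (y' s)" "R' t - r"]
      has_integral_diff[of "\<lambda>s. v * h (y s) / max (\<rho> s) \<eta>" "X t" "{0..t}"
        "\<lambda>s. v * h (y' s) / max (\<rho>' s) \<eta>" "X' t"] sol that
    unfolding perturbed_solution_def f1_def f2_def u_def w_def by auto
  have close: "\<bar>y s - (c s + X s)\<bar> \<le> \<delta>" "\<bar>y' s - (c s + X' s)\<bar> \<le> \<delta>"
     "\<bar>\<rho> s - R s\<bar> \<le> \<delta>" "\<bar>\<rho>' s - R' s\<bar> \<le> \<delta>" if "0 \<le> s" "s \<le> T" for s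
    using sol that unfolding perturbed_solution_def by auto
  have y_diff: "\<bar>(y s - y' s) - w s\<bar> \<le> 2 * \<delta>" and \<rho>_diff: "\<bar>\<rho> s - \<rho>' s\<bar> \<le> \<bar>u s\<bar> + 2 * \<delta>"
    if "0 \<le> s" "s \<le> T" for s
    using close[OF that] unfolding u_def w_def by linarith+
  have cont: "continuous_on {0..T} k" if "\<And>t. 0 \<le> t \<Longrightarrow> t \<le> T \<Longrightarrow> (f has_integral k t) {0..t}"
    for f k :: "real \<Rightarrow> real"
  proof -
    have "continuous_on {0..T} (\<lambda>t. integral {0..t} f)"
      using that[of T] t by (intro indefinite_integral_continuous_1) auto
    moreover have "k s = integral {0..s} f" if "s \<in> {0..T}" for s
      using \<open>\<And>t. 0 \<le> t \<Longrightarrow> t \<le> T \<Longrightarrow> (f has_integral k t) {0..t}\<close>[of s] that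
      by (simp add: integral_unique)
    ultimately show ?thesis by (subst continuous_on_cong[OF refl])
  qed
  have \<phi>_cont: "continuous_on {0..T} \<phi>"
    unfolding \<phi>_def using cont[OF u] cont[OF w] by (intro continuous_intros)
  have \<phi>_ge: "0 \<le> \<phi> s" for s using \<open>0 \<le> \<delta>\<close> by (auto simp: \<phi>_def)
  define C where "C = v / \<eta> + v / \<eta>\<^sup>2"
  have C: "0 \<le> C" using v_pos \<eta>_pos by (auto simp: C_def)
  have half: "k t \<le> 2 * \<delta> + C * integral {0..t} \<phi>"
    if "\<And>t. 0 \<le> t \<Longrightarrow> t \<le> T \<Longrightarrow> (f has_integral k t) {0..t}"
      "\<And>s. 0 \<le> s \<Longrightarrow> s \<le> T \<Longrightarrow> 2 * \<delta> < k s \<Longrightarrow> f s \<le> v / \<eta> * (k s + 2 * \<delta>) + v / \<eta>\<^sup>2 * (\<bar>u s\<bar> + 2 * \<delta>)"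
      "\<And>s. \<bar>k s\<bar> = \<bar>w s\<bar>" "0 \<le> t" "t \<le> T" for f k t
  proof -
    have "k t \<le> 2 * \<delta> + integral {0..t} (\<lambda>s. C * \<phi> s)"
    proof (rule integral_bound_above_level[OF that(1)])
      fix s assume s: "0 \<le> s" "s \<le> T" "2 * \<delta> < k s"
      have "k s + 2 * \<delta> \<le> \<phi> s" using that(3)[of s] \<open>0 \<le> \<delta>\<close> by (auto simp: \<phi>_def)
      moreover have "\<bar>u s\<bar> + 2 * \<delta> \<le> \<phi> s" using \<open>0 \<le> \<delta>\<close> by (auto simp: \<phi>_def)
      ultimately have "v / \<eta> * (k s + 2 * \<delta>) + v / \<eta>\<^sup>2 * (\<bar>u s\<bar> + 2 * \<delta>) \<le> v / \<eta> * \<phi> s + v / \<eta>\<^sup>2 * \<phi> s"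
        using v_pos \<eta>_pos by (intro add_mono mult_left_mono) auto
      with that(2)[OF s] show "f s \<le> C * \<phi> s" by (simp add: C_def algebra_simps)
    qed (use \<open>0 \<le> \<delta>\<close> \<phi>_cont \<phi>_ge C that(4,5) in \<open>auto intro!: continuous_intros\<close>)
    then show ?thesis by simp
  qed
  have half_u: "k t \<le> 0 + v * integral {0..t} \<phi>"
    if "\<And>t. 0 \<le> t \<Longrightarrow> t \<le> T \<Longrightarrow> (f has_integral k t) {0..t}"
      "\<And>s. 0 \<le> s \<Longrightarrow> s \<le> T \<Longrightarrow> f s \<le> v * \<phi> s" "0 \<le> t" "t \<le> T" for f k t
  proof -
    have "k t \<le> 0 + integral {0..t} (\<lambda>s. v * \<phi> s)"
      by (rule integral_bound_above_level[OF that(1)])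
        (use that(2-) \<phi>_cont \<phi>_ge v_pos in \<open>auto intro!: continuous_intros\<close>)
    then show ?thesis by simp
  qed
  have f1: "\<bar>f1 s\<bar> \<le> v * \<phi> s" if "0 \<le> s" "s \<le> T" for s
  proof -
    have "\<bar>f1 s\<bar> = v * \<bar>g (y s) - g (y' s)\<bar>"
      using v_pos by (simp add: f1_def abs_mult abs_minus_commute flip: right_diff_distrib)
    also have "\<dots> \<le> v * \<phi> s"
      using v_pos g_lipschitz[of "y s" "y' s"] y_diff[OF that] \<open>0 \<le> \<delta>\<close>
      by (intro mult_left_mono) (auto simp: \<phi>_def)
    finally show ?thesis .
  qed
  have f2: "f2 s \<le> v / \<eta> * (w s + 2 * \<delta>) + v / \<eta>\<^sup>2 * (\<bar>u s\<bar> + 2 * \<delta>)"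
    if "0 \<le> s" "s \<le> T" "2 * \<delta> < w s" for s
  proof -
    have "f2 s \<le> v / \<eta> * (y s - y' s) + v / \<eta>\<^sup>2 * \<bar>\<rho> s - \<rho>' s\<bar>"
      unfolding f2_def using y_diff[of s] that by (intro drift_difference_le) auto
    also have "\<dots> \<le> v / \<eta> * (w s + 2 * \<delta>) + v / \<eta>\<^sup>2 * (\<bar>u s\<bar> + 2 * \<delta>)"
      using y_diff[of s] \<rho>_diff[of s] that v_pos \<eta>_pos by (intro add_mono mult_left_mono) auto
    finally show ?thesis .
  qed
  have f2': "- f2 s \<le> v / \<eta> * (- w s + 2 * \<delta>) + v / \<eta>\<^sup>2 * (\<bar>u s\<bar> + 2 * \<delta>)"
    if "0 \<le> s" "s \<le> T" "2 * \<delta> < - w s" for s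
  proof -
    have "- f2 s \<le> v / \<eta> * (y' s - y s) + v / \<eta>\<^sup>2 * \<bar>\<rho>' s - \<rho> s\<bar>"
      using drift_difference_le[of "y s" "y' s" "\<rho>' s" "\<rho> s"] y_diff[of s] that
      unfolding f2_def by auto
    also have "\<dots> \<le> v / \<eta> * (- w s + 2 * \<delta>) + v / \<eta>\<^sup>2 * (\<bar>u s\<bar> + 2 * \<delta>)"
      using y_diff[of s] \<rho>_diff[of s] that v_pos \<eta>_pos by (intro add_mono mult_left_mono) auto
    finally show ?thesis .
  qed
  have "\<phi> t \<le> 6 * \<delta> + lip_const * integral {0..t} \<phi>" if "0 \<le> t" "t \<le> T" for t
  proof -
    have "\<bar>w t\<bar> \<le> 2 * \<delta> + C * integral {0..t} \<phi>"
      using half[of f2 w t] half[of "\<lambda>s. - f2 s" "\<lambda>s. - w s" t] w f2 f2' that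
      by (auto simp: has_integral_neg_iff)
    moreover have "\<bar>u t\<bar> \<le> v * integral {0..t} \<phi>"
      using half_u[of f1 u t] half_u[of "\<lambda>s. - f1 s" "\<lambda>s. - u s" t] u f1 that
      by (auto simp: has_integral_neg_iff abs_le_iff)
    ultimately show ?thesis
      by (simp add: \<phi>_def[of t] lip_const_def C_def algebra_simps)
  qed
  from gronwall_bound[OF \<phi>_cont lip_const_pos _ this t] \<open>0 \<le> \<delta>\<close>
  have "\<phi> t \<le> 2 * (6 * \<delta>) * exp (2 * lip_const * t)" by simp
  also have "\<dots> \<le> 2 * (6 * \<delta>) * exp (2 * lip_const * T)"
    using \<open>0 \<le> \<delta>\<close> t lip_const_pos by (intro mult_left_mono) auto
  finally show ?thesis using \<open>0 \<le> \<delta>\<close> by (simp add: \<phi>_def u_def w_def)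
qed

end

section \<open>The Euler scheme and its limit\<close>

lemma has_integral_between:
  fixes f k :: "real \<Rightarrow> real"
  assumes int: "\<And>t. 0 \<le> t \<Longrightarrow> (f has_integral k t) {0..t}" and st: "0 \<le> s" "s \<le> t"
  shows "(f has_integral (k t - k s)) {s..t}"
proof -
  have f: "f integrable_on {0..t}" using int[of t] st by auto
  then have "f integrable_on {s..t}" by (rule integrable_on_subinterval) (use st in auto)
  moreover have "integral {0..s} f + integral {s..t} f = integral {0..t} f"
    by (rule Henstock_Kurzweil_Integration.integral_combine) (use st f in auto)
  moreover have "integral {0..s} f = k s" "integral {0..t} f = k t"
    using int st by (auto intro: integral_unique)
  ultimately show ?thesis by (simp add: has_integral_iff)
qed

lemma has_integral_const_bounds:
  fixes f :: "real \<Rightarrow> real"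
  assumes "(f has_integral i) {s..t}" "s \<le> t"
  shows "(\<And>u. u \<in> {s..t} \<Longrightarrow> a \<le> f u) \<Longrightarrow> a * (t - s) \<le> i"
    and "(\<And>u. u \<in> {s..t} \<Longrightarrow> f u \<le> b) \<Longrightarrow> i \<le> b * (t - s)"
proof -
  show "a * (t - s) \<le> i" if "\<And>u. u \<in> {s..t} \<Longrightarrow> a \<le> f u"
    using has_integral_le[OF has_integral_const_real[of a s t] assms(1) that] assms(2)
    by (simp add: mult.commute)
  show "i \<le> b * (t - s)" if "\<And>u. u \<in> {s..t} \<Longrightarrow> f u \<le> b"
    using has_integral_le[OF assms(1) has_integral_const_real[of b s t] that] assms(2)
    by (simp add: mult.commute)
qed

lemma has_integral_stopped:
  fixes f f' :: "real \<Rightarrow> real"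
  assumes f: "(f has_integral i) {0..min t \<tau>}" and t: "0 \<le> t" "0 \<le> \<tau>"
    and before: "\<And>s. 0 \<le> s \<Longrightarrow> s < \<tau> \<Longrightarrow> f' s = f s" and after: "\<And>s. \<tau> \<le> s \<Longrightarrow> f' s = 0"
  shows "(f' has_integral i) {0..t}"
proof -
  have "(f' has_integral i) {0..min t \<tau>}"
    by (rule has_integral_spike_finite[of "{\<tau>}", OF _ _ f]) (auto intro: before)
  moreover have "(f' has_integral 0) {min t \<tau>..t}"
  proof (cases "t \<le> \<tau>")
    case True
    then show ?thesis by (simp add: has_integral_refl)
  next
    case False
    then show ?thesis by (intro has_integral_is_0) (auto intro: after)
  qed
  ultimately have "(f' has_integral (i + 0)) {0..t}"
    using t by (intro has_integral_combine[where a = 0 and c = "min t \<tau>" and b = t]) auto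
  then show ?thesis by simp
qed

lemma has_integral_bounded_limit:
  fixes f :: "nat \<Rightarrow> real \<Rightarrow> real"
  assumes int: "\<And>n. (f n has_integral I n) {a..b}" and bound: "\<And>n s. \<bar>f n s\<bar> \<le> C"
    and N: "negligible N" and lim: "\<And>s. s \<in> {a..b} - N \<Longrightarrow> (\<lambda>n. f n s) \<longlonglongrightarrow> F s"
    and I: "I \<longlonglongrightarrow> L"
  shows "(F has_integral L) {a..b}"
proof -
  define f' where "f' n s = (if s \<in> N then 0 else f n s)" for n s
  define F' where "F' s = (if s \<in> N then 0 else F s)" for s
  have "(f' n has_integral I n) {a..b}" for n
    by (rule has_integral_spike[OF N _ int]) (simp add: f'_def)
  then have "(F' has_integral L) {a..b}"
  proof (rule has_integral_dominated_convergence[where h = "\<lambda>_. C"])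
    show "\<And>n. \<forall>x\<in>{a..b}. norm (f' n x) \<le> C"
      using bound order_trans[OF abs_ge_zero bound] by (auto simp: f'_def)
    show "\<forall>x\<in>{a..b}. (\<lambda>n. f' n x) \<longlonglongrightarrow> F' x"
      using lim by (auto simp: f'_def F'_def)
  qed (use I in auto)
  then show ?thesis by (rule has_integral_spike[OF N, rotated 1]) (simp add: F'_def)
qed

lemma continuous_on_increment_bound:
  fixes f :: "real \<Rightarrow> real"
  assumes le: "\<And>s t. 0 \<le> s \<Longrightarrow> s \<le> t \<Longrightarrow> \<bar>f t - f s\<bar> \<le> K * (t - s)" and "0 \<le> K"
  shows "continuous_on {0..} f"
proof (rule lipschitz_on_continuous_on[OF lipschitz_onI])
  fix s t :: real assume "s \<in> {0..}" "t \<in> {0..}"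
  then show "dist (f s) (f t) \<le> K * dist s t"
    using le[of s t] le[of t s] by (cases "s \<le> t") (auto simp: dist_real_def abs_minus_commute[of "f s"])
qed fact

lemma has_integral_piecewise_linear:
  fixes x a :: "nat \<Rightarrow> real"
  assumes d: "0 < d" and step: "\<And>k. x (Suc k) = x k + d * a k" and t: "0 \<le> t"
  shows "((\<lambda>s. a (nat \<lfloor>s / d\<rfloor>)) has_integral
     x (nat \<lfloor>t / d\<rfloor>) + (t - d * nat \<lfloor>t / d\<rfloor>) * a (nat \<lfloor>t / d\<rfloor>) - x 0) {0..t}"
proof -
  let ?f = "\<lambda>s. a (nat \<lfloor>s / d\<rfloor>)"
  have cell: "(?f has_integral (t - d * k) * a k) {d * k..t}"
    if "d * k \<le> t" "t \<le> d * (k + 1)" for t and k :: nat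
  proof -
    have "((\<lambda>_. a k) has_integral (t - d * k) * a k) {d * k..t}"
      using has_integral_const_real[of "a k" "d * k" t] that by simp
    then show ?thesis
    proof (rule has_integral_spike_finite[of "{t}", rotated 2])
      fix s assume "s \<in> {d * real k..t} - {t}"
      then have "real k \<le> s / d" "s / d < k + 1" using d that by (auto simp: field_simps)
      then have "\<lfloor>s / d\<rfloor> = int k" by linarith
      then show "?f s = a k" by simp
    qed simp
  qed
  have node: "(?f has_integral (x k - x 0)) {0..d * k}" for k :: nat
  proof (induction k)
    case (Suc k)
    have "(?f has_integral ((x k - x 0) + (d * (k + 1) - d * k) * a k)) {0..d * (k + 1)}"
      using d by (intro has_integral_combine[OF _ _ Suc cell]) (auto simp: algebra_simps)
    then show ?case by (simp add: step algebra_simps)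
  qed (simp add: has_integral_refl)
  define k where "k = nat \<lfloor>t / d\<rfloor>"
  have "0 \<le> t / d" using d t by simp
  then have "real k \<le> t / d" "t / d < k + 1" unfolding k_def by linarith+
  then have k: "d * k \<le> t" "t \<le> d * (k + 1)" using d by (auto simp: field_simps)
  have "(?f has_integral ((x k - x 0) + (t - d * k) * a k)) {0..t}"
    using d k by (intro has_integral_combine[OF _ _ node cell]) auto
  then show ?thesis by (simp add: k_def algebra_simps)
qed

lemma grid_below:
  fixes t d :: real
  assumes "0 < d" "0 \<le> t"
  shows "0 \<le> d * nat \<lfloor>t / d\<rfloor>" "d * nat \<lfloor>t / d\<rfloor> \<le> t" "t - d * nat \<lfloor>t / d\<rfloor> \<le> d"
proof -
  define k where "k = nat \<lfloor>t / d\<rfloor>"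
  have "real k \<le> t / d" "t / d < real k + 1" using assms by (auto simp: k_def)
  then show "d * nat \<lfloor>t / d\<rfloor> \<le> t" "t - d * nat \<lfloor>t / d\<rfloor> \<le> d" "0 \<le> d * nat \<lfloor>t / d\<rfloor>"
    unfolding k_def[symmetric] using assms by (auto simp: field_simps)
qed

abbreviation mesh :: "nat \<Rightarrow> real" where
  "mesh n \<equiv> inverse (real (Suc n))"

context one_sided_drift
begin

lemma h_minus_id_mono: "mono (\<lambda>x. x - h x)"
  using h_one_sided by (intro monoI) force

lemma h_measurable [measurable]: "h \<in> borel_measurable borel"
proof -
  have "(\<lambda>x. x - (x - h x)) \<in> borel_measurable borel"
    by (intro borel_measurable_diff borel_measurable_mono h_minus_id_mono) auto
  then show ?thesis by simp
qed

text \<open>A monotone function has countably many discontinuities, and $x - h(x)$ is monotone.\<close>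

lemma h_discontinuities_countable: "countable {x. \<not> isCont h x}"
proof -
  have "isCont h x" if "isCont (\<lambda>x. x - h x) x" for x
  proof -
    have "isCont (\<lambda>x. x - (x - h x)) x" by (rule continuous_diff[OF continuous_ident that])
    then show ?thesis by simp
  qed
  then have "{x. \<not> isCont h x} \<subseteq> {x. \<not> isCont (\<lambda>x. x - h x) x}" by blast
  then show ?thesis
    by (rule countable_subset[OF _ mono_ctble_discont[OF h_minus_id_mono]])
qed

lemma g_isCont: "isCont g x"
proof -
  have "1-lipschitz_on UNIV g" by (rule lipschitz_onI) (use g_lipschitz in \<open>auto simp: dist_real_def\<close>)
  then show ?thesis
    using lipschitz_on_continuous_on continuous_on_eq_continuous_at[OF open_UNIV] by blast
qed

lemma g_measurable [measurable]: "g \<in> borel_measurable borel"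
  by (rule borel_measurable_continuous_onI) (simp add: continuous_at_imp_continuous_on g_isCont)

lemma radial_drift_bound: "\<bar>- v * g y\<bar> \<le> v" "- v * g y \<le> - (v * sqrt 2 / 2)"
proof -
  have "0 \<le> g y" using g_ge[of y] by (rule order_trans[rotated]) simp
  then show "\<bar>- v * g y\<bar> \<le> v" using v_pos g_le[of y] by (simp add: abs_mult mult_left_le)
  show "- v * g y \<le> - (v * sqrt 2 / 2)"
    using mult_left_mono[OF g_ge[of y], of v] v_pos by simp
qed

lemma angular_drift_bound: "\<bar>v * h y / max \<rho> \<eta>\<bar> \<le> v / \<eta>"
proof -
  have "\<bar>v * h y / max \<rho> \<eta>\<bar> = v * \<bar>h y\<bar> / max \<rho> \<eta>"
    using v_pos \<eta>_pos by (simp add: abs_mult)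
  also have "\<dots> \<le> v * 1 / \<eta>"
    using h_bound[of y] v_pos \<eta>_pos by (intro frac_le mult_left_mono) auto
  finally show ?thesis by simp
qed

text \<open>The second component is the angle minus the driving path \<open>c\<close>; only the values of \<open>c\<close> on the grid
enter, which makes the scheme adapted when \<open>c\<close> is a path of an adapted process.\<close>

primrec euler :: "real \<Rightarrow> (real \<Rightarrow> real) \<Rightarrow> real \<Rightarrow> nat \<Rightarrow> real \<times> real" where
  "euler r c d 0 = (r, 0)"
| "euler r c d (Suc k) =
     (fst (euler r c d k) + d * (- v * g (c (d * k) + snd (euler r c d k))),
      snd (euler r c d k) + d * (v * h (c (d * k) + snd (euler r c d k)) / max (fst (euler r c d k)) \<eta>))"

definition node_radius :: "real \<Rightarrow> (real \<Rightarrow> real) \<Rightarrow> real \<Rightarrow> real \<Rightarrow> real" where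
  "node_radius r c d t = fst (euler r c d (nat \<lfloor>t / d\<rfloor>))"

definition node_angle :: "real \<Rightarrow> (real \<Rightarrow> real) \<Rightarrow> real \<Rightarrow> real \<Rightarrow> real" where
  "node_angle r c d t = c (d * nat \<lfloor>t / d\<rfloor>) + snd (euler r c d (nat \<lfloor>t / d\<rfloor>))"

definition euler_radius :: "real \<Rightarrow> (real \<Rightarrow> real) \<Rightarrow> real \<Rightarrow> real \<Rightarrow> real" where
  "euler_radius r c d t = node_radius r c d t
     + (t - d * nat \<lfloor>t / d\<rfloor>) * (- v * g (node_angle r c d t))"

definition euler_drift :: "real \<Rightarrow> (real \<Rightarrow> real) \<Rightarrow> real \<Rightarrow> real \<Rightarrow> real" where
  "euler_drift r c d t = snd (euler r c d (nat \<lfloor>t / d\<rfloor>))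
     + (t - d * nat \<lfloor>t / d\<rfloor>) * (v * h (node_angle r c d t) / max (node_radius r c d t) \<eta>)"

lemma euler_has_integral:
  assumes "0 < d" "0 \<le> t"
  shows "((\<lambda>s. - v * g (node_angle r c d s)) has_integral (euler_radius r c d t - r)) {0..t}"
    and "((\<lambda>s. v * h (node_angle r c d s) / max (node_radius r c d s) \<eta>)
           has_integral euler_drift r c d t) {0..t}"
  using has_integral_piecewise_linear[OF assms(1) _ assms(2), of "\<lambda>k. fst (euler r c d k)"
      "\<lambda>k. - v * g (c (d * k) + snd (euler r c d k))"]
    has_integral_piecewise_linear[OF assms(1) _ assms(2), of "\<lambda>k. snd (euler r c d k)"
      "\<lambda>k. v * h (c (d * k) + snd (euler r c d k)) / max (fst (euler r c d k)) \<eta>"]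
  unfolding euler_radius_def euler_drift_def node_radius_def node_angle_def by simp_all

lemma euler_perturbed_solution:
  assumes d: "0 < d" and osc: "\<And>s s'. s \<in> {0..T} \<Longrightarrow> s' \<in> {0..T} \<Longrightarrow> \<bar>s - s'\<bar> \<le> d \<Longrightarrow> \<bar>c s - c s'\<bar> \<le> \<epsilon>"
    and \<delta>: "\<epsilon> + d * v / \<eta> \<le> \<delta>" "d * v \<le> \<delta>"
  shows "perturbed_solution r c T \<delta> (euler_radius r c d) (euler_drift r c d)
     (node_radius r c d) (node_angle r c d)"
  unfolding perturbed_solution_def
proof (intro ballI conjI)
  fix t assume t: "t \<in> {0..T}"
  note grid = grid_below[OF d, of t]
  show "((\<lambda>s. - v * g (node_angle r c d s)) has_integral (euler_radius r c d t - r)) {0..t}"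
    "((\<lambda>s. v * h (node_angle r c d s) / max (node_radius r c d s) \<eta>)
           has_integral euler_drift r c d t) {0..t}"
    using euler_has_integral[OF d, of t] t by auto
  have "\<bar>node_radius r c d t - euler_radius r c d t\<bar>
      = (t - d * nat \<lfloor>t / d\<rfloor>) * \<bar>- v * g (node_angle r c d t)\<bar>"
    using grid t unfolding euler_radius_def by (simp add: abs_mult)
  also have "\<dots> \<le> d * v"
    using grid t d radial_drift_bound by (intro mult_mono) auto
  finally show "\<bar>node_radius r c d t - euler_radius r c d t\<bar> \<le> \<delta>" using \<delta> by simp
  have cancel: "(a + x) - (b + (x + m)) = a - b - m" for a b x m :: real by simp
  have "\<bar>node_angle r c d t - (c t + euler_drift r c d t)\<bar>
      = \<bar>(c (d * nat \<lfloor>t / d\<rfloor>) - c t)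
          - (t - d * nat \<lfloor>t / d\<rfloor>) * (v * h (node_angle r c d t) / max (node_radius r c d t) \<eta>)\<bar>"
    unfolding euler_drift_def node_angle_def by (simp only: cancel)
  also have "\<dots> \<le> \<bar>c (d * nat \<lfloor>t / d\<rfloor>) - c t\<bar>
          + (t - d * nat \<lfloor>t / d\<rfloor>) * \<bar>v * h (node_angle r c d t) / max (node_radius r c d t) \<eta>\<bar>"
    using grid t by (intro order_trans[OF abs_triangle_ineq4]) (simp add: abs_mult)
  also have "\<dots> \<le> \<epsilon> + d * (v / \<eta>)"
    using grid t d angular_drift_bound by (intro add_mono osc mult_mono) auto
  finally show "\<bar>node_angle r c d t - (c t + euler_drift r c d t)\<bar> \<le> \<delta>" using \<delta> by simp
qed

abbreviation euler_solves :: "real \<Rightarrow> (real \<Rightarrow> real) \<Rightarrow> real \<Rightarrow> real \<Rightarrow> nat \<Rightarrow> bool" where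
  "euler_solves r c T \<delta> n \<equiv> perturbed_solution r c T \<delta> (euler_radius r c (mesh n))
     (euler_drift r c (mesh n)) (node_radius r c (mesh n)) (node_angle r c (mesh n))"

text \<open>The error of evaluating the drift at the preceding grid point is governed by the mesh and by the modulus of
continuity of the driving path.\<close>

lemma euler_eventually_perturbed_solution:
  assumes c: "continuous_on {0..} c" and \<delta>: "0 < \<delta>"
  obtains n0 where "\<And>n. n0 \<le> n \<Longrightarrow> euler_solves r c T \<delta> n"
proof -
  have "uniformly_continuous_on {0..T} c"
    by (rule compact_uniformly_continuous[OF continuous_on_subset[OF c]]) auto
  then have "\<exists>e>0. \<forall>s\<in>{0..T}. \<forall>s'\<in>{0..T}. \<bar>s' - s\<bar> < e \<longrightarrow> \<bar>c s' - c s\<bar> < \<delta> / 2"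
    unfolding uniformly_continuous_on_def dist_real_def by (rule allE[of _ "\<delta> / 2"]) (use \<delta> in simp)
  then obtain e where e: "0 < e"
    "\<And>s s'. s \<in> {0..T} \<Longrightarrow> s' \<in> {0..T} \<Longrightarrow> \<bar>s' - s\<bar> < e \<Longrightarrow> \<bar>c s' - c s\<bar> < \<delta> / 2"
    by blast
  \<comment> \<open>half of \<open>\<delta>\<close> is spent on the oscillation of \<open>c\<close>, the other half on the drift over one step\<close>
  define e' where "e' = min e (min (\<delta> / v) (\<delta> * \<eta> / (2 * v)))"
  have "0 < e'" using e \<delta> v_pos \<eta>_pos by (auto simp: e'_def)
  then obtain n0 where n0: "mesh n0 < e'" using reals_Archimedean by blast
  show ?thesis
  proof (rule that[of n0], rule euler_perturbed_solution[where \<epsilon> = "\<delta> / 2"])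
    fix n assume "n0 \<le> n"
    then have "mesh n \<le> mesh n0" by (intro le_imp_inverse_le) auto
    from le_less_trans[OF this n0] have n: "mesh n < e'" .
    then have "mesh n \<le> \<delta> / v" "mesh n \<le> \<delta> * \<eta> / (2 * v)"
      unfolding e'_def by auto
    moreover have "i * v \<le> \<delta> \<and> \<delta> / 2 + i * v / \<eta> \<le> \<delta>" if "i \<le> \<delta> / v" "i \<le> \<delta> * \<eta> / (2 * v)" for i
      using that v_pos \<eta>_pos by (auto simp: field_simps)
    ultimately show "mesh n * v \<le> \<delta>" "\<delta> / 2 + mesh n * v / \<eta> \<le> \<delta>"
      by blast+
    show "\<bar>c s - c s'\<bar> \<le> \<delta> / 2" if "s \<in> {0..T}" "s' \<in> {0..T}" "\<bar>s - s'\<bar> \<le> mesh n" for s s'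
      using e(2)[of s' s] that n by (auto simp: e'_def)
  qed simp
qed

definition limit_radius :: "real \<Rightarrow> (real \<Rightarrow> real) \<Rightarrow> real \<Rightarrow> real" where
  "limit_radius r c t = lim (\<lambda>n. euler_radius r c (mesh n) t)"

definition limit_drift :: "real \<Rightarrow> (real \<Rightarrow> real) \<Rightarrow> real \<Rightarrow> real" where
  "limit_drift r c t = lim (\<lambda>n. euler_drift r c (mesh n) t)"

lemma euler_tendsto:
  assumes c: "continuous_on {0..} c" and t: "0 \<le> t"
  shows "(\<lambda>n. euler_radius r c (mesh n) t) \<longlonglongrightarrow> limit_radius r c t"
    and "(\<lambda>n. euler_drift r c (mesh n) t) \<longlonglongrightarrow> limit_drift r c t"
proof -
  have cauchy: "Cauchy a"
    if a: "\<And>m n. \<bar>a m - a n\<bar> \<le> \<bar>euler_radius r c (mesh m) t - euler_radius r c (mesh n) t\<bar>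
      + \<bar>euler_drift r c (mesh m) t - euler_drift r c (mesh n) t\<bar>" for a :: "nat \<Rightarrow> real"
    unfolding Cauchy_def dist_real_def
  proof (intro allI impI)
    fix e :: real assume "0 < e"
    \<comment> \<open>half of what the comparison estimate turns into \<open>e\<close>\<close>
    define \<delta> where "\<delta> = e / (2 * (12 * exp (2 * lip_const * t)))"
    have \<delta>: "0 < \<delta>" "12 * \<delta> * exp (2 * lip_const * t) < e" using \<open>0 < e\<close> by (simp_all add: \<delta>_def)
    obtain n0 where n0: "\<And>n. n0 \<le> n \<Longrightarrow> euler_solves r c t \<delta> n"
      using euler_eventually_perturbed_solution[OF c \<delta>(1)] by blast
    show "\<exists>M. \<forall>m\<ge>M. \<forall>n\<ge>M. \<bar>a m - a n\<bar> < e"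
    proof (intro exI[of _ n0] allI impI)
      fix m n assume "n0 \<le> m" "n0 \<le> n"
      from perturbed_solution_difference[OF n0[OF this(1)] n0[OF this(2)], of t] \<delta> t a[of m n]
      show "\<bar>a m - a n\<bar> < e" by linarith
    qed
  qed
  show "(\<lambda>n. euler_radius r c (mesh n) t) \<longlonglongrightarrow> limit_radius r c t"
    unfolding limit_radius_def convergent_LIMSEQ_iff[symmetric] Cauchy_convergent_iff[symmetric]
    by (rule cauchy) simp
  show "(\<lambda>n. euler_drift r c (mesh n) t) \<longlonglongrightarrow> limit_drift r c t"
    unfolding limit_drift_def convergent_LIMSEQ_iff[symmetric] Cauchy_convergent_iff[symmetric]
    by (rule cauchy) simp
qed

lemma euler_nodes_tendsto:
  assumes c: "continuous_on {0..} c" and t: "0 \<le> t"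
  shows "(\<lambda>n. node_radius r c (mesh n) t) \<longlonglongrightarrow> limit_radius r c t"
    and "(\<lambda>n. node_angle r c (mesh n) t) \<longlonglongrightarrow> c t + limit_drift r c t"
proof -
  have near: "\<forall>\<^sub>F n in sequentially.
      \<bar>node_radius r c (mesh n) t - euler_radius r c (mesh n) t\<bar> < e \<and>
      \<bar>node_angle r c (mesh n) t - (c t + euler_drift r c (mesh n) t)\<bar> < e"
    if "0 < e" for e
  proof -
    have "0 < e / 2" using that by simp
    then obtain n0 where n0: "\<And>n. n0 \<le> n \<Longrightarrow> euler_solves r c t (e / 2) n"
      using euler_eventually_perturbed_solution[OF c] by blast
    show ?thesis
      unfolding eventually_sequentially
    proof (intro exI[of _ n0] allI impI)
      fix n assume "n0 \<le> n"
      from n0[OF this] t that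
      show "\<bar>node_radius r c (mesh n) t - euler_radius r c (mesh n) t\<bar> < e \<and>
        \<bar>node_angle r c (mesh n) t - (c t + euler_drift r c (mesh n) t)\<bar> < e"
        unfolding perturbed_solution_def by (auto dest!: bspec[of _ _ t])
    qed
  qed
  have "(\<lambda>n. node_radius r c (mesh n) t - euler_radius r c (mesh n) t) \<longlonglongrightarrow> 0"
    by (rule tendstoI, rule eventually_mono[OF near]) (auto simp: dist_real_def)
  from tendsto_add[OF this euler_tendsto(1)[OF c t, of r]]
  show "(\<lambda>n. node_radius r c (mesh n) t) \<longlonglongrightarrow> limit_radius r c t" by simp
  have "(\<lambda>n. node_angle r c (mesh n) t - (c t + euler_drift r c (mesh n) t)) \<longlonglongrightarrow> 0"
    by (rule tendstoI, rule eventually_mono[OF near]) (auto simp: dist_real_def)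
  from tendsto_add[OF this tendsto_add[OF tendsto_const[of "c t"] euler_tendsto(2)[OF c t, of r]]]
  show "(\<lambda>n. node_angle r c (mesh n) t) \<longlonglongrightarrow> c t + limit_drift r c t" by simp
qed

lemma limit_radius_has_integral:
  assumes c: "continuous_on {0..} c" and t: "0 \<le> t"
  shows "((\<lambda>s. - v * g (c s + limit_drift r c s)) has_integral (limit_radius r c t - r)) {0..t}"
proof (rule has_integral_bounded_limit[OF euler_has_integral(1)[OF _ t]])
  show "(\<lambda>n. - v * g (node_angle r c (mesh n) s)) \<longlonglongrightarrow> - v * g (c s + limit_drift r c s)"
    if "s \<in> {0..t} - {}" for s
    using that by (intro tendsto_intros isCont_tendsto_compose[OF g_isCont] euler_nodes_tendsto[OF c]) auto
  show "\<bar>- v * g (node_angle r c (mesh n) s)\<bar> \<le> v" for n s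
    by (rule radial_drift_bound)
qed (use euler_tendsto[OF c t] in \<open>auto intro!: tendsto_intros\<close>)

text \<open>The drift converges along the Euler scheme wherever the limiting angle is a continuity point of
\<open>h\<close>; dominated convergence does the rest.\<close>

lemma limit_drift_has_integral:
  assumes c: "continuous_on {0..} c" and t: "0 \<le> t"
    and N: "negligible {s \<in> {0..t}. \<not> isCont h (c s + limit_drift r c s)}" (is "negligible ?N")
  shows "((\<lambda>s. v * h (c s + limit_drift r c s) / max (limit_radius r c s) \<eta>)
     has_integral limit_drift r c t) {0..t}"
proof (rule has_integral_bounded_limit[OF euler_has_integral(2)[OF _ t] _ N])
  show "(\<lambda>n. v * h (node_angle r c (mesh n) s) / max (node_radius r c (mesh n) s) \<eta>)
      \<longlonglongrightarrow> v * h (c s + limit_drift r c s) / max (limit_radius r c s) \<eta>"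
    if "s \<in> {0..t} - ?N" for s
  proof -
    have "isCont h (c s + limit_drift r c s)" using that by blast
    then show ?thesis
      using that \<eta>_pos by (intro tendsto_intros isCont_tendsto_compose[of _ h] euler_nodes_tendsto[OF c]) auto
  qed
  show "\<bar>v * h (node_angle r c (mesh n) s) / max (node_radius r c (mesh n) s) \<eta>\<bar> \<le> v / \<eta>" for n s
    by (rule angular_drift_bound)
qed (use euler_tendsto[OF c t] in auto)

lemma limit_drift_lipschitz:
  assumes c: "continuous_on {0..} c" and st: "0 \<le> s" "s \<le> t"
  shows "\<bar>limit_drift r c t - limit_drift r c s\<bar> \<le> v / \<eta> * (t - s)"
proof (rule tendsto_upperbound)
  show "(\<lambda>n. \<bar>euler_drift r c (mesh n) t - euler_drift r c (mesh n) s\<bar>)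
      \<longlonglongrightarrow> \<bar>limit_drift r c t - limit_drift r c s\<bar>"
    using st by (intro tendsto_intros euler_tendsto[OF c]) auto
  have "\<bar>euler_drift r c d t - euler_drift r c d s\<bar> \<le> v / \<eta> * (t - s)" if "0 < d" for d
  proof -
    have int: "((\<lambda>s. v * h (node_angle r c d s) / max (node_radius r c d s) \<eta>)
        has_integral (euler_drift r c d t - euler_drift r c d s)) {s..t}"
      by (rule has_integral_between[OF euler_has_integral(2)[OF that] st])
    have "- (v / \<eta>) \<le> v * h y / max \<rho> \<eta>" "v * h y / max \<rho> \<eta> \<le> v / \<eta>" for y \<rho>
      using abs_le_D1[OF angular_drift_bound[of y \<rho>]] abs_le_D2[OF angular_drift_bound[of y \<rho>]]
      by linarith+
    from has_integral_const_bounds(1)[OF int st(2) this(1)] has_integral_const_bounds(2)[OF int st(2) this(2)]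
    show ?thesis by (auto simp: abs_le_iff)
  qed
  then show "\<forall>\<^sub>F n in sequentially.
      \<bar>euler_drift r c (mesh n) t - euler_drift r c (mesh n) s\<bar> \<le> v / \<eta> * (t - s)"
    by (intro always_eventually) auto
qed auto

lemma limit_radius_decreases:
  assumes c: "continuous_on {0..} c" and st: "0 \<le> s" "s \<le> t"
  shows "limit_radius r c t + v * sqrt 2 / 2 * (t - s) \<le> limit_radius r c s"
    and "limit_radius r c s - v * (t - s) \<le> limit_radius r c t"
proof -
  have int: "((\<lambda>s. - v * g (c s + limit_drift r c s)) has_integral
      (limit_radius r c t - r - (limit_radius r c s - r))) {s..t}"
    by (rule has_integral_between[OF limit_radius_has_integral[OF c] st])
  show "limit_radius r c t + v * sqrt 2 / 2 * (t - s) \<le> limit_radius r c s"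
    using has_integral_const_bounds(2)[OF int st(2) radial_drift_bound(2)] by simp
  have "- v \<le> - v * g y" for y using radial_drift_bound(1)[of y] by (auto simp: abs_le_iff)
  from has_integral_const_bounds(1)[OF int st(2) this]
  show "limit_radius r c s - v * (t - s) \<le> limit_radius r c t" by simp
qed

lemma limit_at_0: "limit_radius r c 0 = r" "limit_drift r c 0 = 0"
  by (simp_all add: limit_radius_def limit_drift_def euler_radius_def euler_drift_def node_radius_def)

lemma euler_measurable:
  fixes d :: real and n :: nat and c :: "'a \<Rightarrow> real \<Rightarrow> real"
  assumes c: "\<And>k::nat. k \<le> n \<Longrightarrow> (\<lambda>\<omega>. c \<omega> (d * k)) \<in> borel_measurable N"
  shows "(\<lambda>\<omega>. fst (euler r (c \<omega>) d n)) \<in> borel_measurable N \<and>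
         (\<lambda>\<omega>. snd (euler r (c \<omega>) d n)) \<in> borel_measurable N"
  using c
proof (induction n)
  case (Suc n)
  have [measurable]: "(\<lambda>\<omega>. c \<omega> (d * n)) \<in> borel_measurable N" using Suc.prems[of n] by simp
  have [measurable]: "(\<lambda>\<omega>. fst (euler r (c \<omega>) d n)) \<in> borel_measurable N"
    "(\<lambda>\<omega>. snd (euler r (c \<omega>) d n)) \<in> borel_measurable N"
    using Suc by auto
  show ?case by simp
qed simp

lemma limit_measurable:
  assumes c: "\<And>s. 0 \<le> s \<Longrightarrow> s \<le> t \<Longrightarrow> (\<lambda>\<omega>. c \<omega> s) \<in> borel_measurable N"
    and cont: "\<And>\<omega>. \<omega> \<in> space N \<Longrightarrow> continuous_on {0..} (c \<omega>)" and t: "0 \<le> t"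
  shows "(\<lambda>\<omega>. limit_radius r (c \<omega>) t) \<in> borel_measurable N"
    and "(\<lambda>\<omega>. limit_drift r (c \<omega>) t) \<in> borel_measurable N"
proof -
  have "(\<lambda>\<omega>. euler_radius r (c \<omega>) d t) \<in> borel_measurable N \<and>
        (\<lambda>\<omega>. euler_drift r (c \<omega>) d t) \<in> borel_measurable N" if d: "0 < d" for d
  proof -
    note grid = grid_below[OF d t]
    have [measurable]: "(\<lambda>\<omega>. c \<omega> (d * real (nat \<lfloor>t / d\<rfloor>))) \<in> borel_measurable N"
      using grid by (intro c) auto
    have "(\<lambda>\<omega>. c \<omega> (d * k)) \<in> borel_measurable N" if "k \<le> nat \<lfloor>t / d\<rfloor>" for k :: nat
    proof (rule c)
      have "d * k \<le> d * nat \<lfloor>t / d\<rfloor>" using that d by (intro mult_left_mono) auto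
      then show "d * k \<le> t" using grid(2) by linarith
    qed (use d in auto)
    from euler_measurable[where c = c and d = d and n = "nat \<lfloor>t / d\<rfloor>" and N = N and r = r, OF this]
    have [measurable]: "(\<lambda>\<omega>. fst (euler r (c \<omega>) d (nat \<lfloor>t / d\<rfloor>))) \<in> borel_measurable N"
      "(\<lambda>\<omega>. snd (euler r (c \<omega>) d (nat \<lfloor>t / d\<rfloor>))) \<in> borel_measurable N" by auto
    show ?thesis
      unfolding euler_radius_def euler_drift_def node_radius_def node_angle_def by simp
  qed
  then have meas: "(\<lambda>\<omega>. euler_radius r (c \<omega>) (mesh n) t) \<in> borel_measurable N"
     "(\<lambda>\<omega>. euler_drift r (c \<omega>) (mesh n) t) \<in> borel_measurable N" for n by auto
  show "(\<lambda>\<omega>. limit_radius r (c \<omega>) t) \<in> borel_measurable N"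
    by (rule borel_measurable_LIMSEQ_real[OF euler_tendsto(1)[OF cont t] meas(1)])
  show "(\<lambda>\<omega>. limit_drift r (c \<omega>) t) \<in> borel_measurable N"
    by (rule borel_measurable_LIMSEQ_real[OF euler_tendsto(2)[OF cont t] meas(2)])
qed

end

section \<open>Paths stopped at the target radius\<close>

context one_sided_drift
begin

text \<open>A path of a strong solution, written without stochastic integral: before \<open>\<tau>\<close> it follows the ordinary
differential equation driven by \<open>c\<close>, from \<open>\<tau>\<close> on it is frozen.  The time \<open>\<tau>\<close> is determined by \<open>\<rho>\<close>.\<close>

definition stopped_path ::
  "real \<Rightarrow> (real \<Rightarrow> real) \<Rightarrow> real \<Rightarrow> (real \<Rightarrow> real) \<Rightarrow> (real \<Rightarrow> real) \<Rightarrow> bool" where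
  "stopped_path r c \<tau> \<rho> y \<longleftrightarrow> 0 \<le> \<tau> \<and> (\<forall>s\<ge>0. \<eta> < \<rho> s \<longleftrightarrow> s < \<tau>) \<and>
     (\<exists>X. perturbed_solution r c \<tau> 0 \<rho> X \<rho> y) \<and>
     (\<forall>t\<ge>\<tau>. \<rho> t = \<eta> \<and> y t = y \<tau>)"

text \<open>The two paths agree up to the smaller of the two times by the comparison estimate with
\<open>\<delta> = 0\<close>.  Hence the times agree, for otherwise one path would be at the level \<open>\<eta>\<close> and the
other, at the same place, above it.\<close>

lemma stopped_path_unique:
  assumes "stopped_path r c \<tau> \<rho> y" "stopped_path r c \<tau>' \<rho>' y'" "0 \<le> t"
  shows "\<rho> t = \<rho>' t \<and> y t = y' t"
proof -
  obtain X where \<tau>: "0 \<le> \<tau>" "\<And>s. 0 \<le> s \<Longrightarrow> \<eta> < \<rho> s \<longleftrightarrow> s < \<tau>" "\<And>t. \<tau> \<le> t \<Longrightarrow> \<rho> t = \<eta> \<and> y t = y \<tau>"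
    and X: "perturbed_solution r c \<tau> 0 \<rho> X \<rho> y"
    using assms(1) unfolding stopped_path_def by blast
  obtain X' where \<tau>': "0 \<le> \<tau>'" "\<And>s. 0 \<le> s \<Longrightarrow> \<eta> < \<rho>' s \<longleftrightarrow> s < \<tau>'" "\<And>t. \<tau>' \<le> t \<Longrightarrow> \<rho>' t = \<eta> \<and> y' t = y' \<tau>'"
    and X': "perturbed_solution r c \<tau>' 0 \<rho>' X' \<rho>' y'"
    using assms(2) unfolding stopped_path_def by blast
  have eq: "\<rho> s = \<rho>' s \<and> y s = y' s" if s: "0 \<le> s" "s \<le> \<tau>" "s \<le> \<tau>'" for s
  proof -
    have "perturbed_solution r c s 0 \<rho> X \<rho> y" "perturbed_solution r c s 0 \<rho>' X' \<rho>' y'"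
      using X X' s unfolding perturbed_solution_def by simp_all
    from perturbed_solution_difference[OF this, of s] s
    have "\<bar>\<rho> s - \<rho>' s\<bar> + \<bar>X s - X' s\<bar> \<le> 0" by simp
    moreover have "\<bar>y s - (c s + X s)\<bar> \<le> 0" "\<bar>y' s - (c s + X' s)\<bar> \<le> 0"
      using X X' s unfolding perturbed_solution_def by simp_all
    ultimately show ?thesis by linarith
  qed
  have "\<tau> = \<tau>'"
  proof (rule linorder_cases[of \<tau> \<tau>'])
    assume "\<tau> < \<tau>'"
    then show ?thesis using eq[of \<tau>] \<tau>(1) \<tau>(3)[of \<tau>] \<tau>'(2)[of \<tau>] by simp
  next
    assume "\<tau>' < \<tau>"
    then show ?thesis using eq[of \<tau>'] \<tau>'(1) \<tau>'(3)[of \<tau>'] \<tau>(2)[of \<tau>'] by simp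
  qed
  then show ?thesis
    using eq[of t] eq[of \<tau>] \<tau>(1) \<tau>(3)[of t] \<tau>'(3)[of t] \<open>0 \<le> t\<close> by (cases "t \<le> \<tau>") simp_all
qed

lemma descent_until_bound: "v * sqrt 2 / 2 * (sqrt 2 * (r - \<eta>) / v) = r - \<eta>"
proof -
  have "v * sqrt 2 / 2 * (sqrt 2 * (r - \<eta>) / v) = (sqrt 2 * sqrt 2) * (r - \<eta>) / 2"
    using v_pos by (simp add: field_simps)
  then show ?thesis by simp
qed

text \<open>While above the level, the radius decreases at rate at least $v/\sqrt 2$, since \<open>g\<close> is at least
$\sqrt 2/2$.  The first hitting time exists by compactness; afterwards the drift is switched off.\<close>

lemma radius_reaches_level:
  assumes cont: "continuous_on {0..} \<rho>" and r: "\<eta> < r"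
    and int: "\<And>t. 0 \<le> t \<Longrightarrow> ((\<lambda>s. indicator {\<eta><..} (\<rho> s) * (- v * g (y s))) has_integral (\<rho> t - r)) {0..t}"
  obtains \<tau> where "0 \<le> \<tau>" "\<tau> \<le> sqrt 2 * (r - \<eta>) / v" "\<And>s. 0 \<le> s \<Longrightarrow> \<eta> < \<rho> s \<longleftrightarrow> s < \<tau>"
    "\<And>s. \<tau> \<le> s \<Longrightarrow> \<rho> s = \<eta>"
proof -
  define T where "T = sqrt 2 * (r - \<eta>) / v"
  have T: "0 \<le> T" using r v_pos by (simp add: T_def)
  let ?f = "\<lambda>s. indicator {\<eta><..} (\<rho> s) * (- v * g (y s))"
  have between: "(?f has_integral (\<rho> t - \<rho> s)) {s..t}" if "0 \<le> s" "s \<le> t" for s t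
    using has_integral_between[OF int that] by simp
  have g_pos: "0 \<le> g x" for x using g_ge[of x] by (rule order_trans[rotated]) simp
  have f_le: "?f s \<le> 0" for s using g_pos v_pos by (simp add: indicator_def)
  have decr: "\<rho> t \<le> \<rho> s" if "0 \<le> s" "s \<le> t" for s t
    using has_integral_const_bounds(2)[OF between[OF that] that(2) f_le] by simp
  have "\<rho> T \<le> \<eta>"
  proof (rule ccontr)
    assume "\<not> \<rho> T \<le> \<eta>"
    then have "\<eta> < \<rho> s" if "s \<in> {0..T}" for s using decr[of s T] that by auto
    then have "?f s \<le> - (v * sqrt 2 / 2)" if "s \<in> {0..T}" for s
      using that radial_drift_bound(2)[of "y s"] by simp
    from has_integral_const_bounds(2)[OF int[OF T] T this]
    have "\<rho> T - r \<le> - (v * sqrt 2 / 2 * T)" by simp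
    then show False using \<open>\<not> \<rho> T \<le> \<eta>\<close> descent_until_bound[of r] by (simp add: T_def)
  qed
  define S where "S = {s \<in> {0..T}. \<rho> s \<le> \<eta>}"
  have "closed S" unfolding S_def
    by (intro continuous_on_closed_Collect_le continuous_on_subset[OF cont]) auto
  then have S: "compact S" "S \<noteq> {}"
    using \<open>\<rho> T \<le> \<eta>\<close> T unfolding S_def
    by (auto simp: compact_eq_bounded_closed intro: bounded_subset[of "{0..T}"])
  obtain \<tau> where \<tau>: "\<tau> \<in> S" "\<And>s. s \<in> S \<Longrightarrow> \<tau> \<le> s" using compact_attains_inf[OF S] by blast
  have \<tau>_bounds: "0 \<le> \<tau>" "\<tau> \<le> T" "\<rho> \<tau> \<le> \<eta>" using \<tau>(1) by (auto simp: S_def)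
  have before: "\<eta> < \<rho> s" if "0 \<le> s" "s < \<tau>" for s
    using \<tau>(2)[of s] that \<tau>_bounds by (force simp: S_def)
  have "\<rho> 0 = r" using int[of 0] by (simp add: has_integral_refl has_integral_iff)
  then obtain x where x: "0 \<le> x" "x \<le> \<tau>" "\<rho> x = \<eta>"
    using IVT2'[of \<rho> \<tau> \<eta> 0] \<tau>_bounds r continuous_on_subset[OF cont, of "{0..\<tau>}"] by auto
  then have "x = \<tau>" using before[of x] by fastforce
  then have at: "\<rho> \<tau> = \<eta>" using x by simp
  have after: "\<rho> s = \<eta>" if "\<tau> \<le> s" for s
  proof -
    have "(?f has_integral 0) {\<tau>..s}"
      using decr[OF \<tau>_bounds(1)] at by (intro has_integral_is_0) (auto simp: indicator_def not_less)
    from has_integral_unique[OF this between[OF \<tau>_bounds(1) that]] at show ?thesis by simp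
  qed
  have "\<eta> < \<rho> s \<longleftrightarrow> s < \<tau>" if "0 \<le> s" for s using before[of s] after[of s] that by fastforce
  then show ?thesis using that[of \<tau>] \<tau>_bounds after by (auto simp: T_def)
qed

lemma stopped_drift_set_integrable:
  fixes \<rho> y :: "real \<Rightarrow> real" and t :: real
  assumes \<rho>: "continuous_on {0..} \<rho>" and y: "continuous_on {0..} y"
  shows "set_integrable lborel {0..t} (\<lambda>s. indicator {\<eta><..} (\<rho> s) * (- v * g (y s)))"
    and "set_integrable lborel {0..t} (\<lambda>s. indicator {\<eta><..} (\<rho> s) * (v * h (y s) / \<rho> s))"
proof -
  have cont: "continuous_on UNIV (\<lambda>s::real. f (max 0 s))" if "continuous_on {0..} f" for f :: "real \<Rightarrow> real"
    by (rule continuous_on_compose2[OF that continuous_on_max[OF continuous_on_const continuous_on_id]]) auto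
  have [measurable]: "(\<lambda>s. \<rho> (max 0 s)) \<in> borel_measurable lborel" "(\<lambda>s. y (max 0 s)) \<in> borel_measurable lborel"
    using borel_measurable_continuous_onI[OF cont[OF \<rho>]] borel_measurable_continuous_onI[OF cont[OF y]]
    by simp_all
  have main: "set_integrable lborel {0..t} f"
    if "(\<lambda>s. f (max 0 s)) \<in> borel_measurable lborel" "\<And>s. \<bar>f s\<bar> \<le> C" for f :: "real \<Rightarrow> real" and C
    unfolding set_integrable_def
  proof (rule Bochner_Integration.integrable_bound)
    have "integrable lborel (indicator {0..t} :: real \<Rightarrow> real)"
      by (rule integrable_real_indicator) (auto simp: emeasure_lborel_Icc_eq)
    then show "integrable lborel (\<lambda>s. indicator {0..t} s * C)" by (rule integrable_mult_left)
    have "(\<lambda>s. indicator {0..t} s *\<^sub>R f s) = (\<lambda>s. indicator {0..t} s * f (max 0 s))"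
      by (auto simp: indicator_def max_def)
    then show "(\<lambda>s. indicator {0..t} s *\<^sub>R f s) \<in> borel_measurable lborel" using that(1) by simp
    show "AE s in lborel. norm (indicator {0..t} s *\<^sub>R f s) \<le> norm (indicator {0..t} s * C)"
    proof (rule AE_I2)
      fix s
      have "\<bar>f s\<bar> \<le> \<bar>C\<bar>" using that(2)[of s] by linarith
      then show "norm (indicator {0..t} s *\<^sub>R f s) \<le> norm (indicator {0..t} s * C)"
        by (simp add: indicator_def)
    qed
  qed
  show "set_integrable lborel {0..t} (\<lambda>s. indicator {\<eta><..} (\<rho> s) * (- v * g (y s)))"
  proof (rule main)
    show "\<bar>indicator {\<eta><..} (\<rho> s) * (- v * g (y s))\<bar> \<le> v" for s
      using radial_drift_bound(1)[of "y s"] v_pos by (auto simp: indicator_def)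
  qed measurable
  show "set_integrable lborel {0..t} (\<lambda>s. indicator {\<eta><..} (\<rho> s) * (v * h (y s) / \<rho> s))"
  proof (rule main)
    show "\<bar>indicator {\<eta><..} (\<rho> s) * (v * h (y s) / \<rho> s)\<bar> \<le> v / \<eta>" for s
      using angular_drift_bound[of "y s" "\<rho> s"] v_pos \<eta>_pos by (auto simp: indicator_def max_absorb1)
  qed measurable
qed

lemma stopped_drift_LINT:
  fixes \<rho> y :: "real \<Rightarrow> real" and t :: real
  assumes "continuous_on {0..} \<rho>" "continuous_on {0..} y"
  shows "((\<lambda>s. indicator {\<eta><..} (\<rho> s) * (- v * g (y s))) has_integral
      (LINT s:{0..t}|lborel. indicator {\<eta><..} (\<rho> s) * (- v * g (y s)))) {0..t}"
    and "((\<lambda>s. indicator {\<eta><..} (\<rho> s) * (v * h (y s) / \<rho> s)) has_integral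
      (LINT s:{0..t}|lborel. indicator {\<eta><..} (\<rho> s) * (v * h (y s) / \<rho> s))) {0..t}"
  using stopped_drift_set_integrable[OF assms, of t]
  by (auto simp: has_integral_iff dest: set_borel_integral_eq_integral)

lemma limit_continuous:
  assumes c: "continuous_on {0..} c"
  shows "continuous_on {0..} (limit_radius r c)" "continuous_on {0..} (limit_drift r c)"
proof -
  show "continuous_on {0..} (limit_radius r c)"
  proof (rule continuous_on_increment_bound)
    fix s t :: real assume "0 \<le> s" "s \<le> t"
    moreover from this have "0 \<le> v * sqrt 2 / 2 * (t - s)" using v_pos by simp
    ultimately show "\<bar>limit_radius r c t - limit_radius r c s\<bar> \<le> v * (t - s)"
      using limit_radius_decreases[OF c, of s t r] by linarith
  qed (use v_pos in simp)
  show "continuous_on {0..} (limit_drift r c)"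
    by (rule continuous_on_increment_bound[OF limit_drift_lipschitz[OF c]]) (use v_pos \<eta>_pos in auto)
qed

lemma limit_radius_hits:
  assumes c: "continuous_on {0..} c" and r: "\<eta> < r"
  obtains \<tau> where "0 \<le> \<tau>" "limit_radius r c \<tau> = \<eta>" "\<And>s. 0 \<le> s \<Longrightarrow> \<eta> < limit_radius r c s \<longleftrightarrow> s < \<tau>"
proof -
  let ?\<rho> = "limit_radius r c"
  note cont = limit_continuous(1)[OF c, of r]
  define T where "T = sqrt 2 * (r - \<eta>) / v"
  have T: "0 \<le> T" using r v_pos by (simp add: T_def)
  have "?\<rho> T + v * sqrt 2 / 2 * (T - 0) \<le> ?\<rho> 0" by (rule limit_radius_decreases(1)[OF c]) (use T in auto)
  moreover have "v * sqrt 2 / 2 * (T - 0) = r - \<eta>" using descent_until_bound[of r] by (simp add: T_def)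
  ultimately have "?\<rho> T \<le> \<eta>" using limit_at_0(1)[of r c] by linarith
  then obtain \<tau> where \<tau>: "0 \<le> \<tau>" "?\<rho> \<tau> = \<eta>"
    using IVT2'[of ?\<rho> T \<eta> 0] T r limit_at_0[of r c] continuous_on_subset[OF cont, of "{0..T}"] by auto
  have strict: "?\<rho> b < ?\<rho> a" if "0 \<le> a" "a < b" for a b
  proof -
    have "0 < v * sqrt 2 / 2 * (b - a)" using v_pos that by simp
    then show ?thesis using limit_radius_decreases(1)[OF c that(1) less_imp_le[OF that(2)], of r] by linarith
  qed
  have "\<eta> < ?\<rho> s \<longleftrightarrow> s < \<tau>" if "0 \<le> s" for s
    using strict[of s \<tau>] strict[of \<tau> s] \<tau> that by (cases s \<tau> rule: linorder_cases) auto
  then show ?thesis using that[of \<tau>] \<tau> by blast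
qed

end

section \<open>Brownian motion with a Lipschitz drift avoids countable sets\<close>

text \<open>The process is the limit of its values at the last grid point before \<open>t\<close>.  The maximum with \<open>0\<close> extends
a process on the half-line to all times.\<close>

lemma continuous_process_jointly_measurable:
  fixes X :: "real \<Rightarrow> 'a \<Rightarrow> real"
  assumes X: "\<And>t. 0 \<le> t \<Longrightarrow> X t \<in> borel_measurable N"
    and cont: "\<And>\<omega>. \<omega> \<in> space N \<Longrightarrow> continuous_on {0..} (\<lambda>t. X t \<omega>)"
  shows "(\<lambda>(t, \<omega>). X (max 0 t) \<omega>) \<in> borel_measurable (borel \<Otimes>\<^sub>M N)"
proof (rule borel_measurable_LIMSEQ_real)
  define grid where "grid n t = nat \<lfloor>max 0 t / mesh n\<rfloor>" for n and t :: real
  fix n :: nat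
  have [measurable]: "grid n \<in> borel \<rightarrow>\<^sub>M count_space UNIV" unfolding grid_def by measurable
  have [measurable]: "X (mesh n * real i) \<in> borel_measurable N" for i by (rule X) simp
  show "(\<lambda>(t, \<omega>). X (mesh n * real (grid n t)) \<omega>) \<in> borel_measurable (borel \<Otimes>\<^sub>M N)"
    unfolding case_prod_beta by (rule measurable_compose_countable[where g = "\<lambda>x. grid n (fst x)"]) measurable
next
  fix x assume "x \<in> space ((borel :: real measure) \<Otimes>\<^sub>M N)"
  then obtain t :: real and \<omega> where x: "x = (t, \<omega>)" "\<omega> \<in> space N" by (auto simp: space_pair_measure)
  let ?q = "\<lambda>n. mesh n * real (nat \<lfloor>max 0 t / mesh n\<rfloor>)"
  have bounds: "0 \<le> ?q n" "?q n \<le> max 0 t" "max 0 t - ?q n \<le> mesh n" for n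
    using grid_below[of "mesh n" "max 0 t"] by auto
  have "(\<lambda>n. max 0 t - mesh n) \<longlonglongrightarrow> max 0 t - 0"
    by (intro tendsto_intros LIMSEQ_inverse_real_of_nat)
  then have "?q \<longlonglongrightarrow> max 0 t"
    using bounds by (intro real_tendsto_sandwich[of "\<lambda>n. max 0 t - mesh n" ?q _ "\<lambda>_. max 0 t"])
      (auto intro!: always_eventually simp: algebra_simps)
  then have "(\<lambda>n. X (?q n) \<omega>) \<longlonglongrightarrow> X (max 0 t) \<omega>"
    by (intro continuous_on_tendsto_compose[OF cont[OF x(2)]]) (use bounds in auto)
  then show "(\<lambda>n. case x of (t, \<omega>) \<Rightarrow> X (mesh n * real (nat \<lfloor>max 0 t / mesh n\<rfloor>)) \<omega>)
      \<longlonglongrightarrow> (case x of (t, \<omega>) \<Rightarrow> X (max 0 t) \<omega>)"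
    by (simp add: x)
qed

context brownian_motion
begin

lemma space_F_eq: "space (F t) = space M"
  using subalgebra_F[of t] by (simp add: subalgebra_def)

lemma measurable_F_M: "f \<in> F t \<rightarrow>\<^sub>M N \<Longrightarrow> f \<in> M \<rightarrow>\<^sub>M N"
  by (rule measurable_from_subalg[OF subalgebra_F])

lemma measurable_F_mono: "f \<in> F s \<rightarrow>\<^sub>M N \<Longrightarrow> s \<le> t \<Longrightarrow> f \<in> F t \<rightarrow>\<^sub>M N"
  using sets_F_mono[of s t] by (auto simp: measurable_def space_F_eq)

lemma B_measurable: "0 \<le> t \<Longrightarrow> B t \<in> borel_measurable M"
  using measurable_F_M[OF adapted_B] .

lemma indep_var_increment:
  fixes Y :: "'a \<Rightarrow> real"
  assumes "0 \<le> s" "s < t" "Y \<in> borel_measurable (F s)"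
  shows "indep_var borel Y borel (\<lambda>\<omega>. B t \<omega> - B s \<omega>)"
proof -
  have pre: "sigma_sets (space M) {f -` A \<inter> space M |A. A \<in> sets borel} = {f -` A \<inter> space M |A. A \<in> sets borel}"
    for f :: "'a \<Rightarrow> real"
    using sets_vimage_algebra[of "space M" f borel] sets_vimage_algebra2[of f "space M" borel] by simp
  have "{Y -` A \<inter> space M |A. A \<in> sets borel} \<subseteq> sets (F s)"
    using measurable_sets[OF assms(3)] by (auto simp: space_F_eq)
  then have "indep_set {Y -` A \<inter> space M |A. A \<in> sets borel}
      {(\<lambda>\<omega>. B t \<omega> - B s \<omega>) -` S \<inter> space M | S. S \<in> sets borel}"
    using increment_indep[OF assms(1,2)] unfolding indep_sets2_eq by blast
  then show ?thesis
    unfolding indep_var_eq pre using assms B_measurable[of t] B_measurable[of s]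
    by (auto intro: measurable_F_M)
qed

text \<open>Conditionally on the past, the increment is normal with density at most
$(2\pi(t-s))^{-1/2}$, and \<open>Y\<close> only shifts the interval.\<close>

lemma increment_in_interval_prob:
  assumes "0 \<le> s" "s < t" and Y: "Y \<in> borel_measurable (F s)" and "0 \<le> a"
  shows "measure M {\<omega> \<in> space M. \<bar>B t \<omega> - B s \<omega> - Y \<omega>\<bar> \<le> a} \<le> 2 * a / sqrt (2 * pi * (t - s))"
proof -
  let ?Z = "\<lambda>\<omega>. B t \<omega> - B s \<omega>"
  let ?K = "2 * a / sqrt (2 * pi * (t - s))"
  have [measurable]: "Y \<in> borel_measurable M" "?Z \<in> borel_measurable M"
    using B_measurable assms by (auto intro: measurable_F_M)
  have density_le: "normal_density 0 (sqrt (t - s)) x \<le> 1 / sqrt (2 * pi * (t - s))" for x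
    using assms(1,2) by (simp add: normal_density_def field_simps)
  have K: "0 \<le> ?K" using assms by simp
  define S where "S = {p :: real \<times> real. \<bar>snd p - fst p\<bar> \<le> a}"
  have S: "S \<in> sets (borel \<Otimes>\<^sub>M borel)"
  proof -
    have "closed S" unfolding S_def by (intro closed_Collect_le continuous_intros)
    then show ?thesis unfolding borel_prod by (rule borel_closed)
  qed
  have slice: "emeasure (distr M borel ?Z) (Pair y -` S) \<le> ennreal ?K" for y
  proof -
    have "emeasure (distr M borel ?Z) (Pair y -` S) = emeasure M (?Z -` {y - a..y + a} \<inter> space M)"
      by (subst emeasure_distr) (auto simp: S_def abs_le_iff intro!: arg_cong[where f = "emeasure M"]
        sets_Pair1[OF S, unfolded S_def])
    also have "\<dots> = (\<integral>\<^sup>+x. ennreal (normal_density 0 (sqrt (t - s)) x) * indicator {y - a..y + a} x \<partial>lborel)"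
      by (rule distributed_emeasure[OF increment_distr[OF assms(1,2)]]) simp
    also have "\<dots> \<le> (\<integral>\<^sup>+x. ennreal (1 / sqrt (2 * pi * (t - s))) * indicator {y - a..y + a} x \<partial>lborel)"
      using density_le by (intro nn_integral_mono mult_right_mono ennreal_leI) auto
    also have "\<dots> = ennreal ?K"
      using assms by (simp add: nn_integral_cmult_indicator flip: ennreal_mult)
    finally show ?thesis .
  qed
  interpret Z: prob_space "distr M borel ?Z" by (rule prob_space_distr) simp
  interpret Y: prob_space "distr M borel Y" by (rule prob_space_distr) simp
  have "emeasure M {\<omega> \<in> space M. \<bar>B t \<omega> - B s \<omega> - Y \<omega>\<bar> \<le> a}
      = emeasure (distr M (borel \<Otimes>\<^sub>M borel) (\<lambda>\<omega>. (Y \<omega>, ?Z \<omega>))) S"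
  proof (subst emeasure_distr[OF _ S])
    show "emeasure M {\<omega> \<in> space M. \<bar>B t \<omega> - B s \<omega> - Y \<omega>\<bar> \<le> a}
        = emeasure M ((\<lambda>\<omega>. (Y \<omega>, ?Z \<omega>)) -` S \<inter> space M)"
      by (rule arg_cong[where f = "emeasure M"]) (auto simp: S_def)
  qed simp
  also have "distr M (borel \<Otimes>\<^sub>M borel) (\<lambda>\<omega>. (Y \<omega>, ?Z \<omega>)) = distr M borel Y \<Otimes>\<^sub>M distr M borel ?Z"
    using indep_var_increment[OF assms(1-3)] unfolding indep_var_distribution_eq by simp
  also have "emeasure \<dots> S = (\<integral>\<^sup>+y. emeasure (distr M borel ?Z) (Pair y -` S) \<partial>distr M borel Y)"
    using S by (intro Z.emeasure_pair_measure_alt) (simp cong: sets_pair_measure_cong)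
  also have "\<dots> \<le> (\<integral>\<^sup>+y. ennreal ?K \<partial>distr M borel Y)"
    by (intro nn_integral_mono slice)
  also have "\<dots> = ennreal ?K" using Y.emeasure_space_1 by simp
  finally show ?thesis
    using K unfolding emeasure_eq_measure by simp
qed

text \<open>Freeze \<open>X\<close> at time $t - \varepsilon$: the event forces the increment of \<open>B\<close> over $[t-\varepsilon, t]$ into an
interval of half-length $K\varepsilon/\sigma$ whose centre is known at time $t - \varepsilon$.  Its probability
is at most a constant times $\varepsilon^{1/2}$, for every small $\varepsilon$.\<close>

lemma lipschitz_perturbation_misses_point:
  assumes "0 < \<sigma>" "0 < t" "0 \<le> K"
    and X: "\<And>s. 0 \<le> s \<Longrightarrow> s \<le> t \<Longrightarrow> X s \<in> borel_measurable (F s)"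
    and lip: "\<And>\<omega> s. \<omega> \<in> space M \<Longrightarrow> 0 \<le> s \<Longrightarrow> s \<le> t \<Longrightarrow> \<bar>X t \<omega> - X s \<omega>\<bar> \<le> K * (t - s)"
  shows "AE \<omega> in M. \<sigma> * B t \<omega> + X t \<omega> \<noteq> d"
proof -
  have [measurable]: "B t \<in> borel_measurable M" "X t \<in> borel_measurable M"
    using X[of t] B_measurable \<open>0 < t\<close> by (auto intro: measurable_F_M)
  let ?A = "{\<omega> \<in> space M. \<sigma> * B t \<omega> + X t \<omega> = d}"
  have bound: "measure M ?A \<le> 2 * K / (\<sigma> * sqrt (2 * pi)) * sqrt \<epsilon>" if \<epsilon>: "0 < \<epsilon>" "\<epsilon> \<le> t" for \<epsilon>
  proof -
    define s where "s = t - \<epsilon>"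
    have s: "0 \<le> s" "s < t" "t - s = \<epsilon>" using \<epsilon> by (auto simp: s_def)
    \<comment> \<open>the increment of \<open>B\<close> that would lead to \<open>d\<close> if \<open>X\<close> stayed at its value at time \<open>s\<close>\<close>
    define Y where "Y \<omega> = (d - X s \<omega>) / \<sigma> - B s \<omega>" for \<omega>
    have Y: "Y \<in> borel_measurable (F s)"
    proof -
      have [measurable]: "X s \<in> borel_measurable (F s)" "B s \<in> borel_measurable (F s)"
        using X[of s] adapted_B[of s] s by auto
      show ?thesis unfolding Y_def by measurable
    qed
    then have [measurable]: "Y \<in> borel_measurable M" by (rule measurable_F_M)
    have [measurable]: "B s \<in> borel_measurable M" using B_measurable s by simp
    have "?A \<subseteq> {\<omega> \<in> space M. \<bar>B t \<omega> - B s \<omega> - Y \<omega>\<bar> \<le> K * \<epsilon> / \<sigma>}"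
    proof safe
      fix \<omega> assume \<omega>: "\<omega> \<in> space M" and d: "d = \<sigma> * B t \<omega> + X t \<omega>"
      have "B t \<omega> - B s \<omega> - Y \<omega> = - (X t \<omega> - X s \<omega>) / \<sigma>"
        unfolding Y_def d using \<open>0 < \<sigma>\<close> by (simp add: field_simps)
      then have "\<bar>B t \<omega> - B s \<omega> - Y \<omega>\<bar> = \<bar>X t \<omega> - X s \<omega>\<bar> / \<sigma>"
        using \<open>0 < \<sigma>\<close> by (simp add: abs_minus_commute)
      also have "\<dots> \<le> K * \<epsilon> / \<sigma>"
        using lip[OF \<omega>, of s] s \<open>0 < \<sigma>\<close> by (intro divide_right_mono) auto
      finally show "\<bar>B t \<omega> - B s \<omega> - Y \<omega>\<bar> \<le> K * \<epsilon> / \<sigma>" .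
    qed
    then have "measure M ?A \<le> measure M {\<omega> \<in> space M. \<bar>B t \<omega> - B s \<omega> - Y \<omega>\<bar> \<le> K * \<epsilon> / \<sigma>}"
      by (intro finite_measure_mono) measurable
    also have "\<dots> \<le> 2 * (K * \<epsilon> / \<sigma>) / sqrt (2 * pi * (t - s))"
      using s \<epsilon> \<open>0 < \<sigma>\<close> \<open>0 \<le> K\<close> by (intro increment_in_interval_prob Y) auto
    also have "\<dots> = 2 * K / (\<sigma> * sqrt (2 * pi)) * (\<epsilon> / sqrt \<epsilon>)"
      using s by (simp add: real_sqrt_mult)
    also have "\<epsilon> / sqrt \<epsilon> = sqrt \<epsilon>" using \<epsilon> by (simp add: real_div_sqrt)
    finally show ?thesis .
  qed
  have "(\<lambda>n. 2 * K / (\<sigma> * sqrt (2 * pi)) * sqrt (t * mesh n))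
      \<longlonglongrightarrow> 2 * K / (\<sigma> * sqrt (2 * pi)) * sqrt (t * 0)"
    by (intro tendsto_intros LIMSEQ_inverse_real_of_nat)
  moreover have "measure M ?A \<le> 2 * K / (\<sigma> * sqrt (2 * pi)) * sqrt (t * mesh n)" for n
  proof (rule bound)
    show "0 < t * mesh n" using \<open>0 < t\<close> by simp
    show "t * mesh n \<le> t" using \<open>0 < t\<close> by (intro mult_left_le) (auto simp: inverse_le_1_iff)
  qed
  ultimately have "measure M ?A \<le> 2 * K / (\<sigma> * sqrt (2 * pi)) * sqrt (t * 0)"
    by (intro tendsto_lowerbound[OF _ always_eventually]) auto
  then have "measure M ?A = 0" using measure_nonneg[of M ?A] by (simp del: measure_nonneg)
  then have "emeasure M ?A = 0" unfolding emeasure_eq_measure by simp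
  then show ?thesis by (subst AE_iff_measurable[OF _ refl]) auto
qed

text \<open>Fubini: at each positive time the set is missed almost surely, so almost surely it is missed at
almost every time.\<close>

lemma lipschitz_perturbation_avoids_countable_set:
  assumes "0 < \<sigma>" "0 \<le> K" and D: "countable D"
    and X: "\<And>t. 0 \<le> t \<Longrightarrow> X t \<in> borel_measurable (F t)"
    and lip: "\<And>\<omega> s t. \<omega> \<in> space M \<Longrightarrow> 0 \<le> s \<Longrightarrow> s \<le> t \<Longrightarrow> \<bar>X t \<omega> - X s \<omega>\<bar> \<le> K * (t - s)"
  shows "AE \<omega> in M. negligible {s \<in> {0..}. \<sigma> * B s \<omega> + X s \<omega> \<in> D}"
proof -
  define Z where "Z t \<omega> = \<sigma> * B t \<omega> + X t \<omega>" for t \<omega>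
  have X_cont: "continuous_on {0..} (\<lambda>t. X t \<omega>)" if "\<omega> \<in> space M" for \<omega>
    by (rule continuous_on_increment_bound[OF lip[OF that] \<open>0 \<le> K\<close>])
  have "(\<lambda>(t, \<omega>). Z (max 0 t) \<omega>) \<in> borel_measurable (borel \<Otimes>\<^sub>M M)"
  proof (rule continuous_process_jointly_measurable)
    fix t :: real assume "0 \<le> t"
    have [measurable]: "X t \<in> borel_measurable M" "B t \<in> borel_measurable M"
      using measurable_F_M[OF X[OF \<open>0 \<le> t\<close>]] B_measurable[OF \<open>0 \<le> t\<close>] .
    show "Z t \<in> borel_measurable M" unfolding Z_def by measurable
  next
    show "continuous_on {0..} (\<lambda>t. Z t \<omega>)" if "\<omega> \<in> space M" for \<omega>
      unfolding Z_def by (intro continuous_intros continuous_B X_cont that)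
  qed
  from measurable_compose[OF measurable_ident_sets[OF sets_pair_measure_cong[OF sets_lborel refl]] this]
  have Z_meas [measurable]: "(\<lambda>p. Z (max 0 (fst p)) (snd p)) \<in> borel_measurable (lborel \<Otimes>\<^sub>M M)"
    unfolding case_prod_beta .
  have [measurable]: "D \<in> sets borel" by (rule sets.countable[OF _ D]) simp
  interpret P: pair_sigma_finite lborel M ..
  have "AE \<omega> in M. 0 < t \<longrightarrow> Z (max 0 t) \<omega> \<notin> D" for t
  proof (cases "0 < t")
    case True
    have "AE \<omega> in M. \<forall>d\<in>D. Z t \<omega> \<noteq> d"
      unfolding AE_ball_countable[OF D] Z_def using True
      by (intro ballI lipschitz_perturbation_misses_point[OF assms(1) _ assms(2) X lip]) auto
    then show ?thesis using True by eventually_elim auto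
  qed simp
  then have "AE t in lborel. AE \<omega> in M. 0 < t \<longrightarrow> Z (max 0 t) \<omega> \<notin> D" by simp
  then have "AE \<omega> in M. AE t in lborel. 0 < t \<longrightarrow> Z (max 0 t) \<omega> \<notin> D"
    by (subst (asm) P.AE_commute) measurable
  then show ?thesis
  proof eventually_elim
    case (elim \<omega>)
    then obtain N where N: "N \<in> null_sets lborel" "{t \<in> space lborel. \<not> (0 < t \<longrightarrow> Z (max 0 t) \<omega> \<notin> D)} \<subseteq> N"
      unfolding eventually_ae_filter by blast
    have "negligible N"
      using N(1) by (simp add: negligible_iff_null_sets null_sets_completionI)
    then have "negligible (insert 0 N)" by simp
    moreover have "{s \<in> {0..}. \<sigma> * B s \<omega> + X s \<omega> \<in> D} \<subseteq> insert 0 N"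
    proof
      fix s assume s: "s \<in> {s \<in> {0..}. \<sigma> * B s \<omega> + X s \<omega> \<in> D}"
      show "s \<in> insert 0 N"
      proof (cases "s = 0")
        case False
        then show ?thesis using s by (intro insertI2 subsetD[OF N(2)]) (auto simp: Z_def)
      qed simp
    qed
    ultimately show ?case by (rule negligible_subset)
  qed
qed

end

section \<open>The isometry for simple integrands\<close>

lemma integrable_bounded_mult:
  fixes Y Z :: "'a \<Rightarrow> real"
  assumes "integrable M Z" "Y \<in> borel_measurable M" "\<And>\<omega>. \<omega> \<in> space M \<Longrightarrow> \<bar>Y \<omega>\<bar> \<le> C"
  shows "integrable M (\<lambda>\<omega>. Y \<omega> * Z \<omega>)"
proof (rule Bochner_Integration.integrable_bound)
  show "integrable M (\<lambda>\<omega>. C * Z \<omega>)" using assms by simp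
  show "(\<lambda>\<omega>. Y \<omega> * Z \<omega>) \<in> borel_measurable M" using assms by measurable
  show "AE \<omega> in M. norm (Y \<omega> * Z \<omega>) \<le> norm (C * Z \<omega>)"
  proof (rule AE_I2)
    fix \<omega> assume "\<omega> \<in> space M"
    then have "\<bar>Y \<omega>\<bar> \<le> \<bar>C\<bar>" using assms(3) by fastforce
    then show "norm (Y \<omega> * Z \<omega>) \<le> norm (C * Z \<omega>)" by (simp add: abs_mult mult_right_mono)
  qed
qed

lemma square_diff_le: "(a - b)\<^sup>2 \<le> 2 * (a - c)\<^sup>2 + 2 * (c - b)\<^sup>2" for a b c :: real
proof -
  have "2 * (a - c)\<^sup>2 + 2 * (c - b)\<^sup>2 - (a - b)\<^sup>2 = ((a - c) - (c - b))\<^sup>2"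
    by (simp add: power2_eq_square algebra_simps)
  then show ?thesis using zero_le_power2[of "(a - c) - (c - b)"] by linarith
qed

context brownian_motion
begin

lemma increment_moments:
  assumes "0 \<le> s" "s < t"
  shows "integrable M (\<lambda>\<omega>. B t \<omega> - B s \<omega>)" "expectation (\<lambda>\<omega>. B t \<omega> - B s \<omega>) = 0"
    and "integrable M (\<lambda>\<omega>. (B t \<omega> - B s \<omega>)\<^sup>2)" "expectation (\<lambda>\<omega>. (B t \<omega> - B s \<omega>)\<^sup>2) = t - s"
proof -
  let ?Z = "\<lambda>\<omega>. B t \<omega> - B s \<omega>"
  note D = increment_distr[OF assms]
  have \<sigma>: "0 < sqrt (t - s)" using assms by simp
  show "integrable M ?Z"
    using distributed_integrable[OF D, of "\<lambda>x. x"] integrable_normal_moment_nz_1[OF \<sigma>, of 0] by simp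
  show 0: "expectation ?Z = 0"
    using normal_distributed_expectation[OF \<sigma> D] .
  show "integrable M (\<lambda>\<omega>. (?Z \<omega>)\<^sup>2)"
    using distributed_integrable[OF D, of "\<lambda>x. x\<^sup>2"] integrable_normal_moment[OF \<sigma>, of 0 2] by simp
  show "expectation (\<lambda>\<omega>. (?Z \<omega>)\<^sup>2) = t - s"
    using normal_distributed_variance[OF \<sigma> D] 0 assms by simp
qed

text \<open>For a single step this is the isometry; the second moment of the increment factors out by
independence of the past.\<close>

lemma past_times_increment:
  assumes st: "0 \<le> s" "s \<le> t" and Y: "Y \<in> borel_measurable (F s)" "integrable M Y"
  shows "integrable M (\<lambda>\<omega>. Y \<omega> * (B t \<omega> - B s \<omega>))" (is ?int1)
    and "expectation (\<lambda>\<omega>. Y \<omega> * (B t \<omega> - B s \<omega>)) = 0" (is ?mean1)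
    and "integrable M (\<lambda>\<omega>. Y \<omega> * (B t \<omega> - B s \<omega>)\<^sup>2)" (is ?int2)
    and "expectation (\<lambda>\<omega>. Y \<omega> * (B t \<omega> - B s \<omega>)\<^sup>2) = expectation Y * (t - s)" (is ?mean2)
proof -
  let ?Z = "\<lambda>\<omega>. B t \<omega> - B s \<omega>"
  have "?int1 \<and> ?mean1 \<and> ?int2 \<and> ?mean2"
  proof (cases "s = t")
    case False
    then have "s < t" using st by simp
    note mom = increment_moments[OF st(1) \<open>s < t\<close>]
    have ind: "indep_var borel Y borel ?Z" by (rule indep_var_increment[OF st(1) \<open>s < t\<close> Y(1)])
    have ind2: "indep_var borel Y borel (\<lambda>\<omega>. (?Z \<omega>)\<^sup>2)"
      using indep_var_compose[OF ind, of "\<lambda>x. x" borel "\<lambda>x. x\<^sup>2" borel] by (simp add: comp_def)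
    show ?thesis
      using indep_var_integrable[OF ind Y(2) mom(1)] indep_var_lebesgue_integral[OF ind Y(2) mom(1)]
        indep_var_integrable[OF ind2 Y(2) mom(3)] indep_var_lebesgue_integral[OF ind2 Y(2) mom(3)] mom
      by simp
  qed simp
  then show ?int1 ?mean1 ?int2 ?mean2 by blast+
qed

lemma B_measurable_F: "0 \<le> s \<Longrightarrow> s \<le> t \<Longrightarrow> B s \<in> borel_measurable (F t)"
  using adapted_B measurable_F_mono by blast

text \<open>Split both increments at the start of the later interval and at the earlier of the two ends.  Among the resulting
products only the square over the common part of the intervals has nonzero mean.\<close>

lemma increment_covariance_ordered:
  assumes ab: "0 \<le> a" "a \<le> b" "a' \<le> b'" and "a \<le> a'"
    and \<xi>: "\<xi> \<in> borel_measurable (F a)" "\<And>\<omega>. \<omega> \<in> space M \<Longrightarrow> \<bar>\<xi> \<omega>\<bar> \<le> C"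
    and \<xi>': "\<xi>' \<in> borel_measurable (F a')" "\<And>\<omega>. \<omega> \<in> space M \<Longrightarrow> \<bar>\<xi>' \<omega>\<bar> \<le> C'"
  shows "has_bochner_integral M (\<lambda>\<omega>. (\<xi> \<omega> * (B b \<omega> - B a \<omega>)) * (\<xi>' \<omega> * (B b' \<omega> - B a' \<omega>)))
    (expectation (\<lambda>\<omega>. \<xi> \<omega> * \<xi>' \<omega>) * max 0 (min b b' - a'))"
proof -
  have \<zeta>F: "(\<lambda>\<omega>. \<xi> \<omega> * \<xi>' \<omega>) \<in> borel_measurable (F t)" if "a' \<le> t" for t
  proof -
    have "a \<le> t" using that \<open>a \<le> a'\<close> by simp
    show ?thesis
      by (rule borel_measurable_times[OF measurable_F_mono[OF \<xi>(1) \<open>a \<le> t\<close>] measurable_F_mono[OF \<xi>'(1) that]])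
  qed
  have \<zeta>C: "\<bar>\<xi> \<omega> * \<xi>' \<omega>\<bar> \<le> C * C'" if "\<omega> \<in> space M" for \<omega>
  proof -
    have "0 \<le> C" using order_trans[OF abs_ge_zero \<xi>(2)[OF that]] .
    then show ?thesis
      unfolding abs_mult using \<xi>(2)[OF that] \<xi>'(2)[OF that] by (intro mult_mono abs_ge_zero)
  qed
  have \<zeta>M: "(\<lambda>\<omega>. \<xi> \<omega> * \<xi>' \<omega>) \<in> borel_measurable M" by (rule measurable_F_M[OF \<zeta>F[OF order_refl]])
  have \<zeta>I: "integrable M (\<lambda>\<omega>. \<xi> \<omega> * \<xi>' \<omega>)"
    by (rule finite_measure.integrable_const_bound[where B = "C * C'"])
      (use \<zeta>M \<zeta>C in \<open>auto intro!: AE_I2 finite_measure_axioms\<close>)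
  have inc: "integrable M (\<lambda>\<omega>. (\<xi> \<omega> * \<xi>' \<omega>) * (B u \<omega> - B s \<omega>))" if "0 \<le> s" "s \<le> u" for s u
  proof -
    have Z: "integrable M (\<lambda>\<omega>. B u \<omega> - B s \<omega>)"
    proof (cases "s = u")
      case False
      then show ?thesis using that by (intro increment_moments) auto
    qed simp
    show ?thesis by (rule integrable_bounded_mult[OF Z \<zeta>M \<zeta>C])
  qed
  have orth: "has_bochner_integral M (\<lambda>\<omega>. ((\<xi> \<omega> * \<xi>' \<omega>) * (B u \<omega> - B s \<omega>)) * (B z \<omega> - B w \<omega>)) 0"
    if "0 \<le> s" "s \<le> u" "u \<le> w" "w \<le> z" "a' \<le> w" for s u w z
  proof -
    have "(\<lambda>\<omega>. (\<xi> \<omega> * \<xi>' \<omega>) * (B u \<omega> - B s \<omega>)) \<in> borel_measurable (F w)"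
      by (rule borel_measurable_times[OF \<zeta>F borel_measurable_diff[OF B_measurable_F B_measurable_F]])
        (use that in auto)
    moreover have "0 \<le> w" using that by simp
    ultimately have "integrable M (\<lambda>\<omega>. ((\<xi> \<omega> * \<xi>' \<omega>) * (B u \<omega> - B s \<omega>)) * (B z \<omega> - B w \<omega>))"
      "expectation (\<lambda>\<omega>. ((\<xi> \<omega> * \<xi>' \<omega>) * (B u \<omega> - B s \<omega>)) * (B z \<omega> - B w \<omega>)) = 0"
      using past_times_increment(1,2)[OF _ \<open>w \<le> z\<close> _ inc[OF that(1,2)]] by blast+
    then show ?thesis
      unfolding has_bochner_integral_iff by simp
  qed
  show ?thesis
  proof (cases "b \<le> a'")
    case True
    have "has_bochner_integral M (\<lambda>\<omega>. ((\<xi> \<omega> * \<xi>' \<omega>) * (B b \<omega> - B a \<omega>)) * (B b' \<omega> - B a' \<omega>)) 0"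
      using True ab by (intro orth) auto
    moreover have "max 0 (min b b' - a') = 0" using True by auto
    ultimately show ?thesis by (simp add: mult_ac)
  next
    case False
    define m n where "m = min b b'" and "n = max b b'"
    have mn: "a' \<le> m" "m \<le> n" "0 \<le> a'" using False ab \<open>a \<le> a'\<close> by (auto simp: m_def n_def)
    have sq: "has_bochner_integral M (\<lambda>\<omega>. (\<xi> \<omega> * \<xi>' \<omega>) * (B m \<omega> - B a' \<omega>)\<^sup>2)
        (expectation (\<lambda>\<omega>. \<xi> \<omega> * \<xi>' \<omega>) * (m - a'))"
      using past_times_increment(3,4)[OF mn(3,1) \<zeta>F[OF order_refl] \<zeta>I] by (simp add: has_bochner_integral_iff)
    have "has_bochner_integral M (\<lambda>\<omega>.
        ((\<xi> \<omega> * \<xi>' \<omega>) * (B a' \<omega> - B a \<omega>)) * (B b' \<omega> - B a' \<omega>)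
        + ((\<xi> \<omega> * \<xi>' \<omega>) * (B m \<omega> - B a' \<omega>)\<^sup>2
          + ((\<xi> \<omega> * \<xi>' \<omega>) * (B m \<omega> - B a' \<omega>)) * (B n \<omega> - B m \<omega>)))
        (0 + (expectation (\<lambda>\<omega>. \<xi> \<omega> * \<xi>' \<omega>) * (m - a') + 0))"
      by (rule has_bochner_integral_add[OF orth has_bochner_integral_add[OF sq orth]])
        (use mn ab \<open>a \<le> a'\<close> in \<open>auto simp: n_def m_def\<close>)
    moreover have "(\<xi> \<omega> * (B b \<omega> - B a \<omega>)) * (\<xi>' \<omega> * (B b' \<omega> - B a' \<omega>)) =
        ((\<xi> \<omega> * \<xi>' \<omega>) * (B a' \<omega> - B a \<omega>)) * (B b' \<omega> - B a' \<omega>)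
        + ((\<xi> \<omega> * \<xi>' \<omega>) * (B m \<omega> - B a' \<omega>)\<^sup>2
          + ((\<xi> \<omega> * \<xi>' \<omega>) * (B m \<omega> - B a' \<omega>)) * (B n \<omega> - B m \<omega>))" for \<omega>
    proof -
      have "(m = b \<and> n = b') \<or> (m = b' \<and> n = b)" by (auto simp: m_def n_def)
      then show ?thesis by (elim disjE conjE) (simp_all add: power2_eq_square algebra_simps)
    qed
    moreover have "max 0 (min b b' - a') = m - a'" using mn by (simp add: m_def)
    ultimately show ?thesis by simp
  qed
qed

lemma increment_covariance:
  assumes ab: "0 \<le> a" "a \<le> b" "0 \<le> a'" "a' \<le> b'"
    and \<xi>: "\<xi> \<in> borel_measurable (F a)" "\<And>\<omega>. \<omega> \<in> space M \<Longrightarrow> \<bar>\<xi> \<omega>\<bar> \<le> C"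
    and \<xi>': "\<xi>' \<in> borel_measurable (F a')" "\<And>\<omega>. \<omega> \<in> space M \<Longrightarrow> \<bar>\<xi>' \<omega>\<bar> \<le> C'"
  shows "has_bochner_integral M (\<lambda>\<omega>. (\<xi> \<omega> * (B b \<omega> - B a \<omega>)) * (\<xi>' \<omega> * (B b' \<omega> - B a' \<omega>)))
    (expectation (\<lambda>\<omega>. \<xi> \<omega> * \<xi>' \<omega>) * max 0 (min b b' - max a a'))"
proof (cases "a \<le> a'")
  case True
  then show ?thesis using increment_covariance_ordered[OF ab(1,2,4) True \<xi> \<xi>'] by (simp add: max_absorb2)
next
  case False
  then have "a' \<le> a" by simp
  from increment_covariance_ordered[OF ab(3,4,2) this \<xi>' \<xi>] show ?thesis
    using False by (simp add: mult.commute min.commute max_absorb1)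
qed

text \<open>The steps may overlap arbitrarily, so the difference of two simple integrals over different
partitions is covered without a common refinement.  Both sides equal the double sum of the
expectations of \<open>\<zeta> k * \<zeta> l\<close> weighted by the lengths \<open>L k l\<close> of the common intervals.\<close>

lemma ito_isometry_family:
  fixes K :: "'k set" and a b :: "'k \<Rightarrow> real" and \<xi> :: "'k \<Rightarrow> 'a \<Rightarrow> real"
  assumes K: "finite K" and ab: "\<And>k. k \<in> K \<Longrightarrow> 0 \<le> a k" "\<And>k. k \<in> K \<Longrightarrow> a k \<le> b k"
    and \<xi>: "\<And>k. k \<in> K \<Longrightarrow> \<xi> k \<in> borel_measurable (F (a k))"
      "\<And>k. k \<in> K \<Longrightarrow> \<exists>C. \<forall>\<omega>\<in>space M. \<bar>\<xi> k \<omega>\<bar> \<le> C"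
    and t: "0 \<le> t"
  shows "(\<integral>\<^sup>+\<omega>. ennreal ((\<Sum>k\<in>K. \<xi> k \<omega> * (B (min t (b k)) \<omega> - B (min t (a k)) \<omega>))\<^sup>2) \<partial>M) =
    (\<integral>\<^sup>+\<omega>. (\<integral>\<^sup>+s\<in>{0..t}. ennreal ((\<Sum>k\<in>K. \<xi> k \<omega> * indicator {a k<..b k} s)\<^sup>2) \<partial>lborel) \<partial>M)"
proof -
  define \<alpha> \<beta> where "\<alpha> k = min t (a k)" and "\<beta> k = min t (b k)" for k
  \<comment> \<open>a step starting after \<open>t\<close> contributes nothing, but its coefficient need not be known at time \<open>t\<close>\<close>
  define \<zeta> where "\<zeta> k = (if a k \<le> t then \<xi> k else (\<lambda>_. 0))" for k
  define L where "L k l = max 0 (min (\<beta> k) (\<beta> l) - max (\<alpha> k) (\<alpha> l))" for k l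
  define E where "E k l = expectation (\<lambda>\<omega>. \<zeta> k \<omega> * \<zeta> l \<omega>)" for k l
  have \<alpha>\<beta>: "0 \<le> \<alpha> k" "\<alpha> k \<le> \<beta> k" if "k \<in> K" for k
    using ab[OF that] t by (auto simp: \<alpha>_def \<beta>_def)
  have \<zeta>F: "\<zeta> k \<in> borel_measurable (F (\<alpha> k))" if "k \<in> K" for k
    using \<xi>(1)[OF that] by (auto simp: \<zeta>_def \<alpha>_def min_def)
  have "\<exists>C. \<forall>k\<in>K. \<forall>\<omega>\<in>space M. \<bar>\<zeta> k \<omega>\<bar> \<le> C k"
  proof -
    have "\<exists>C. \<forall>\<omega>\<in>space M. \<bar>\<zeta> k \<omega>\<bar> \<le> C" if "k \<in> K" for k
      using \<xi>(2)[OF that] by (auto simp: \<zeta>_def)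
    then show ?thesis by metis
  qed
  then obtain C where C: "\<And>k \<omega>. k \<in> K \<Longrightarrow> \<omega> \<in> space M \<Longrightarrow> \<bar>\<zeta> k \<omega>\<bar> \<le> C k" by blast
  have S_eq: "(\<Sum>k\<in>K. \<xi> k \<omega> * (B (min t (b k)) \<omega> - B (min t (a k)) \<omega>))
      = (\<Sum>k\<in>K. \<zeta> k \<omega> * (B (\<beta> k) \<omega> - B (\<alpha> k) \<omega>))" for \<omega>
    using ab by (intro sum.cong) (force simp: \<zeta>_def \<alpha>_def \<beta>_def min_def)+
  have bochner_S: "has_bochner_integral M (\<lambda>\<omega>. (\<Sum>k\<in>K. \<zeta> k \<omega> * (B (\<beta> k) \<omega> - B (\<alpha> k) \<omega>))\<^sup>2)
      (\<Sum>k\<in>K. \<Sum>l\<in>K. E k l * L k l)"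
    unfolding power2_eq_square sum_product
  proof (rule has_bochner_integral_sum, rule has_bochner_integral_sum)
    fix k l assume "k \<in> K" "l \<in> K"
    then show "has_bochner_integral M
        (\<lambda>\<omega>. \<zeta> k \<omega> * (B (\<beta> k) \<omega> - B (\<alpha> k) \<omega>) * (\<zeta> l \<omega> * (B (\<beta> l) \<omega> - B (\<alpha> l) \<omega>))) (E k l * L k l)"
      unfolding E_def L_def by (rule_tac increment_covariance[OF \<alpha>\<beta> \<alpha>\<beta> \<zeta>F C \<zeta>F C])
  qed
  have left: "(\<integral>\<^sup>+\<omega>. ennreal ((\<Sum>k\<in>K. \<xi> k \<omega> * (B (min t (b k)) \<omega> - B (min t (a k)) \<omega>))\<^sup>2) \<partial>M)
      = ennreal (\<Sum>k\<in>K. \<Sum>l\<in>K. E k l * L k l)"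
    unfolding S_eq using bochner_S by (subst nn_integral_eq_integral) (auto simp: has_bochner_integral_iff)
  have inner: "(\<integral>\<^sup>+s\<in>{0..t}. ennreal ((\<Sum>k\<in>K. \<xi> k \<omega> * indicator {a k<..b k} s)\<^sup>2) \<partial>lborel)
      = ennreal (\<Sum>k\<in>K. \<Sum>l\<in>K. \<zeta> k \<omega> * \<zeta> l \<omega> * L k l)"
    "0 \<le> (\<Sum>k\<in>K. \<Sum>l\<in>K. \<zeta> k \<omega> * \<zeta> l \<omega> * L k l)" for \<omega>
  proof -
    have "ennreal ((\<Sum>k\<in>K. \<xi> k \<omega> * indicator {a k<..b k} s)\<^sup>2) * indicator {0..t} s
        = ennreal ((\<Sum>k\<in>K. \<zeta> k \<omega> * indicator {\<alpha> k<..\<beta> k} s)\<^sup>2)" for s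
    proof (cases "s \<in> {0..t}")
      case True
      then have "(\<Sum>k\<in>K. \<xi> k \<omega> * indicator {a k<..b k} s) = (\<Sum>k\<in>K. \<zeta> k \<omega> * indicator {\<alpha> k<..\<beta> k} s)"
        by (intro sum.cong) (auto simp: \<zeta>_def \<alpha>_def \<beta>_def min_def indicator_def)
      then show ?thesis using True by simp
    next
      case False
      then have "\<zeta> k \<omega> * indicator {\<alpha> k<..\<beta> k} s = 0" if "k \<in> K" for k
        using \<alpha>\<beta>[OF that] by (auto simp: \<beta>_def indicator_def)
      then have "(\<Sum>k\<in>K. \<zeta> k \<omega> * indicator {\<alpha> k<..\<beta> k} s) = 0" by (intro sum.neutral) blast
      then show ?thesis using False by simp
    qed
    then have eq: "(\<integral>\<^sup>+s\<in>{0..t}. ennreal ((\<Sum>k\<in>K. \<xi> k \<omega> * indicator {a k<..b k} s)\<^sup>2) \<partial>lborel)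
        = (\<integral>\<^sup>+s. ennreal ((\<Sum>k\<in>K. \<zeta> k \<omega> * indicator {\<alpha> k<..\<beta> k} s)\<^sup>2) \<partial>lborel)" by simp
    have pair: "has_bochner_integral lborel
        (\<lambda>s. (\<zeta> k \<omega> * indicator {\<alpha> k<..\<beta> k} s) * (\<zeta> l \<omega> * indicator {\<alpha> l<..\<beta> l} s)) (\<zeta> k \<omega> * \<zeta> l \<omega> * L k l)"
      for k l
    proof -
      have "has_bochner_integral lborel (\<lambda>s. indicator {max (\<alpha> k) (\<alpha> l)<..min (\<beta> k) (\<beta> l)} s :: real) (L k l)"
      proof (cases "max (\<alpha> k) (\<alpha> l) \<le> min (\<beta> k) (\<beta> l)")
        case True
        then show ?thesis
          using has_bochner_integral_real_indicator[of "{max (\<alpha> k) (\<alpha> l)<..min (\<beta> k) (\<beta> l)}" lborel]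
          unfolding L_def by (simp add: max_absorb2)
      next
        case False
        then have empty: "{max (\<alpha> k) (\<alpha> l)<..min (\<beta> k) (\<beta> l)} = {}"
          by (intro greaterThanAtMost_empty) linarith
        have "L k l = 0" using False unfolding L_def by linarith
        then show ?thesis unfolding empty by (simp add: has_bochner_integral_zero)
      qed
      from has_bochner_integral_mult_right[OF this, of "\<zeta> k \<omega> * \<zeta> l \<omega>"]
      show ?thesis
        by (rule has_bochner_integral_cong[THEN iffD1, OF refl _ refl, rotated 1])
          (auto simp: indicator_def)
    qed
    have boch: "has_bochner_integral lborel (\<lambda>s. (\<Sum>k\<in>K. \<zeta> k \<omega> * indicator {\<alpha> k<..\<beta> k} s)\<^sup>2)
        (\<Sum>k\<in>K. \<Sum>l\<in>K. \<zeta> k \<omega> * \<zeta> l \<omega> * L k l)"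
      unfolding power2_eq_square sum_product
      by (rule has_bochner_integral_sum, rule has_bochner_integral_sum, rule pair)
    show "(\<integral>\<^sup>+s\<in>{0..t}. ennreal ((\<Sum>k\<in>K. \<xi> k \<omega> * indicator {a k<..b k} s)\<^sup>2) \<partial>lborel)
      = ennreal (\<Sum>k\<in>K. \<Sum>l\<in>K. \<zeta> k \<omega> * \<zeta> l \<omega> * L k l)"
      unfolding eq using boch by (subst nn_integral_eq_integral) (auto simp: has_bochner_integral_iff)
    show "0 \<le> (\<Sum>k\<in>K. \<Sum>l\<in>K. \<zeta> k \<omega> * \<zeta> l \<omega> * L k l)"
      unfolding has_bochner_integral_integral_eq[OF boch, symmetric]
      by (rule Bochner_Integration.integral_nonneg) simp
  qed
  have "has_bochner_integral M (\<lambda>\<omega>. \<zeta> k \<omega> * \<zeta> l \<omega> * L k l) (E k l * L k l)" if "k \<in> K" "l \<in> K" for k l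
  proof -
    have "\<zeta> k \<in> borel_measurable M" "\<zeta> l \<in> borel_measurable M"
      using \<zeta>F that by (auto intro: measurable_F_M)
    then have "integrable M (\<lambda>\<omega>. \<zeta> k \<omega> * (\<zeta> l \<omega> * 1))"
      using C that by (intro integrable_bounded_mult[where C = "C k"] integrable_bounded_mult[where C = "C l"]) auto
    then show ?thesis by (simp add: has_bochner_integral_iff E_def)
  qed
  then have bochner_sum: "has_bochner_integral M (\<lambda>\<omega>. \<Sum>k\<in>K. \<Sum>l\<in>K. \<zeta> k \<omega> * \<zeta> l \<omega> * L k l)
      (\<Sum>k\<in>K. \<Sum>l\<in>K. E k l * L k l)"
    by (rule_tac has_bochner_integral_sum, rule_tac has_bochner_integral_sum)
  have "(\<integral>\<^sup>+\<omega>. (\<integral>\<^sup>+s\<in>{0..t}. ennreal ((\<Sum>k\<in>K. \<xi> k \<omega> * indicator {a k<..b k} s)\<^sup>2) \<partial>lborel) \<partial>M)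
      = ennreal (\<Sum>k\<in>K. \<Sum>l\<in>K. E k l * L k l)"
    unfolding inner(1) using bochner_sum inner(2)
    by (subst nn_integral_eq_integral) (auto simp: has_bochner_integral_iff)
  then show ?thesis using left by simp
qed

text \<open>The squared norm in $L^2(\Omega)$, possibly infinite.\<close>

definition l2_omega :: "('a \<Rightarrow> real) \<Rightarrow> ennreal" where
  "l2_omega X = (\<integral>\<^sup>+\<omega>. ennreal ((X \<omega>)\<^sup>2) \<partial>M)"

text \<open>The squared norm in $L^2([0, t] \times \Omega)$, possibly infinite.\<close>

definition l2_time :: "real \<Rightarrow> (real \<Rightarrow> 'a \<Rightarrow> real) \<Rightarrow> ennreal" where
  "l2_time t H = (\<integral>\<^sup>+\<omega>. (\<integral>\<^sup>+s\<in>{0..t}. ennreal ((H s \<omega>)\<^sup>2) \<partial>lborel) \<partial>M)"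

text \<open>Joint measurability in the order of integration of \<open>l2_time\<close>.\<close>

definition time_measurable :: "(real \<Rightarrow> 'a \<Rightarrow> real) \<Rightarrow> bool" where
  "time_measurable H \<longleftrightarrow> (\<lambda>(\<omega>, s). H (max 0 s) \<omega>) \<in> borel_measurable (M \<Otimes>\<^sub>M lborel)"

lemma simple_data_le: "simple_data F N p \<xi> \<Longrightarrow> i < N \<Longrightarrow> 0 \<le> p i \<and> p i < p (Suc i)"
proof (induction i)
  case 0
  then show ?case by (auto simp: simple_data_def)
next
  case (Suc i)
  then have "0 \<le> p i" "p i < p (Suc i)" by auto
  moreover have "p (Suc i) < p (Suc (Suc i))" using Suc.prems by (auto simp: simple_data_def)
  ultimately show ?case by auto
qed

lemma simple_data_measurable: "simple_data F N p \<xi> \<Longrightarrow> i < N \<Longrightarrow> \<xi> i \<in> borel_measurable M"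
  unfolding simple_data_def by (blast intro: measurable_F_M)

lemma simple_integral_measurable:
  assumes "simple_data F N p \<xi>" "0 \<le> t"
  shows "simple_integral B N p \<xi> t \<in> borel_measurable M"
proof -
  have "(\<lambda>\<omega>. \<xi> i \<omega> * (B (min t (p (Suc i))) \<omega> - B (min t (p i)) \<omega>)) \<in> borel_measurable M" if "i < N" for i
  proof -
    note simple_data_le[OF assms(1) that]
    then show ?thesis
      by (intro borel_measurable_times borel_measurable_diff simple_data_measurable[OF assms(1) that] B_measurable)
        (use assms(2) in auto)
  qed
  then show ?thesis unfolding simple_integral_def[abs_def] by (intro borel_measurable_sum) simp
qed

lemma simple_process_time_measurable:
  assumes "simple_data F N p \<xi>"
  shows "time_measurable (simple_process N p \<xi>)"
proof -
  have "(\<lambda>x. \<xi> i (fst x) * indicator {p i<..p (Suc i)} (max 0 (snd x))) \<in> borel_measurable (M \<Otimes>\<^sub>M lborel)"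
    if "i < N" for i
  proof -
    have [measurable]: "\<xi> i \<in> borel_measurable M" by (rule simple_data_measurable[OF assms that])
    show ?thesis by measurable
  qed
  then show ?thesis
    unfolding time_measurable_def simple_process_def case_prod_beta by (intro borel_measurable_sum) simp
qed

lemma time_measurable_inner:
  assumes "time_measurable H"
  shows "(\<lambda>\<omega>. \<integral>\<^sup>+s\<in>{0..t}. ennreal ((H s \<omega>)\<^sup>2) \<partial>lborel) \<in> borel_measurable M"
    and "\<omega> \<in> space M \<Longrightarrow> (\<lambda>s. ennreal ((H s \<omega>)\<^sup>2) * indicator {0..t} s) \<in> borel_measurable lborel"
proof -
  have [measurable]: "(\<lambda>(\<omega>, s). H (max 0 s) \<omega>) \<in> borel_measurable (M \<Otimes>\<^sub>M lborel)"
    using assms by (simp add: time_measurable_def)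
  have eq: "ennreal ((H s \<omega>)\<^sup>2) * indicator {0..t} s = ennreal ((H (max 0 s) \<omega>)\<^sup>2) * indicator {0..t} s" for s \<omega>
    by (auto simp: indicator_def max_def)
  show "(\<lambda>\<omega>. \<integral>\<^sup>+s\<in>{0..t}. ennreal ((H s \<omega>)\<^sup>2) \<partial>lborel) \<in> borel_measurable M"
    unfolding eq by measurable
  show "(\<lambda>s. ennreal ((H s \<omega>)\<^sup>2) * indicator {0..t} s) \<in> borel_measurable lborel" if "\<omega> \<in> space M"
    unfolding eq using that by measurable
qed

lemma time_measurable_diff:
  assumes "time_measurable H" "time_measurable G"
  shows "time_measurable (\<lambda>s \<omega>. H s \<omega> - G s \<omega>)"
  using borel_measurable_diff[OF assms[unfolded time_measurable_def case_prod_beta]]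
  unfolding time_measurable_def case_prod_beta .

lemma l2_time_triangle:
  assumes "time_measurable H" "time_measurable H'" "time_measurable G" "time_measurable G'"
    and GG': "AE \<omega> in M. \<forall>s\<in>{0..t}. G s \<omega> = G' s \<omega>"
  shows "l2_time t (\<lambda>s \<omega>. H s \<omega> - H' s \<omega>)
    \<le> 2 * l2_time t (\<lambda>s \<omega>. H s \<omega> - G s \<omega>) + 2 * l2_time t (\<lambda>s \<omega>. H' s \<omega> - G' s \<omega>)"
proof -
  note m1 = time_measurable_diff[OF assms(1,3)] and m2 = time_measurable_diff[OF assms(2,4)]
  let ?a = "\<lambda>\<omega> s. ennreal ((H s \<omega> - G s \<omega>)\<^sup>2) * indicator {0..t} s"
  let ?b = "\<lambda>\<omega> s. ennreal ((H' s \<omega> - G' s \<omega>)\<^sup>2) * indicator {0..t} s"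
  have "(\<integral>\<^sup>+s\<in>{0..t}. ennreal ((H s \<omega> - H' s \<omega>)\<^sup>2) \<partial>lborel)
      \<le> 2 * (\<integral>\<^sup>+s. ?a \<omega> s \<partial>lborel) + 2 * (\<integral>\<^sup>+s. ?b \<omega> s \<partial>lborel)"
    if G: "\<forall>s\<in>{0..t}. G s \<omega> = G' s \<omega>" and \<omega>: "\<omega> \<in> space M" for \<omega>
  proof -
    have "ennreal ((H s \<omega> - H' s \<omega>)\<^sup>2) * indicator {0..t} s \<le> 2 * ?a \<omega> s + 2 * ?b \<omega> s" for s
    proof (cases "s \<in> {0..t}")
      case True
      have "(H s \<omega> - H' s \<omega>)\<^sup>2 \<le> 2 * (H s \<omega> - G s \<omega>)\<^sup>2 + 2 * (H' s \<omega> - G' s \<omega>)\<^sup>2"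
        using square_diff_le[of "H s \<omega>" "H' s \<omega>" "G s \<omega>"] G True by (simp add: power2_commute)
      then have "ennreal ((H s \<omega> - H' s \<omega>)\<^sup>2) \<le> ennreal (2 * (H s \<omega> - G s \<omega>)\<^sup>2 + 2 * (H' s \<omega> - G' s \<omega>)\<^sup>2)"
        by (rule ennreal_leI)
      also have "\<dots> = 2 * ennreal ((H s \<omega> - G s \<omega>)\<^sup>2) + 2 * ennreal ((H' s \<omega> - G' s \<omega>)\<^sup>2)"
        by (simp add: ennreal_plus ennreal_mult)
      finally show ?thesis using True by simp
    qed simp
    then have "(\<integral>\<^sup>+s\<in>{0..t}. ennreal ((H s \<omega> - H' s \<omega>)\<^sup>2) \<partial>lborel) \<le> (\<integral>\<^sup>+s. 2 * ?a \<omega> s + 2 * ?b \<omega> s \<partial>lborel)"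
      by (intro nn_integral_mono)
    also have "\<dots> = 2 * (\<integral>\<^sup>+s. ?a \<omega> s \<partial>lborel) + 2 * (\<integral>\<^sup>+s. ?b \<omega> s \<partial>lborel)"
      using time_measurable_inner(2)[OF m1 \<omega>, of t] time_measurable_inner(2)[OF m2 \<omega>, of t]
      by (simp add: nn_integral_add nn_integral_cmult)
    finally show ?thesis .
  qed
  then have "l2_time t (\<lambda>s \<omega>. H s \<omega> - H' s \<omega>)
      \<le> (\<integral>\<^sup>+\<omega>. 2 * (\<integral>\<^sup>+s. ?a \<omega> s \<partial>lborel) + 2 * (\<integral>\<^sup>+s. ?b \<omega> s \<partial>lborel) \<partial>M)"
    unfolding l2_time_def using GG' by (intro nn_integral_mono_AE) auto
  also have "\<dots> = 2 * l2_time t (\<lambda>s \<omega>. H s \<omega> - G s \<omega>) + 2 * l2_time t (\<lambda>s \<omega>. H' s \<omega> - G' s \<omega>)"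
    unfolding l2_time_def using time_measurable_inner(1)[OF m1, of t] time_measurable_inner(1)[OF m2, of t]
    by (simp add: nn_integral_add nn_integral_cmult)
  finally show ?thesis .
qed

lemma l2_omega_triangle:
  assumes [measurable]: "X \<in> borel_measurable M" "Y \<in> borel_measurable M" "Z \<in> borel_measurable M"
  shows "l2_omega (\<lambda>\<omega>. X \<omega> - Y \<omega>) \<le> 2 * l2_omega (\<lambda>\<omega>. X \<omega> - Z \<omega>) + 2 * l2_omega (\<lambda>\<omega>. Z \<omega> - Y \<omega>)"
proof -
  have "ennreal ((X \<omega> - Y \<omega>)\<^sup>2) \<le> 2 * ennreal ((X \<omega> - Z \<omega>)\<^sup>2) + 2 * ennreal ((Z \<omega> - Y \<omega>)\<^sup>2)" for \<omega>
    using ennreal_leI[OF square_diff_le[of "X \<omega>" "Y \<omega>" "Z \<omega>"]] by (simp add: ennreal_plus ennreal_mult)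
  then have "l2_omega (\<lambda>\<omega>. X \<omega> - Y \<omega>)
      \<le> (\<integral>\<^sup>+\<omega>. 2 * ennreal ((X \<omega> - Z \<omega>)\<^sup>2) + 2 * ennreal ((Z \<omega> - Y \<omega>)\<^sup>2) \<partial>M)"
    unfolding l2_omega_def by (intro nn_integral_mono)
  also have "\<dots> = 2 * l2_omega (\<lambda>\<omega>. X \<omega> - Z \<omega>) + 2 * l2_omega (\<lambda>\<omega>. Z \<omega> - Y \<omega>)"
    unfolding l2_omega_def by (simp add: nn_integral_add nn_integral_cmult)
  finally show ?thesis .
qed

lemma ito_isometry_difference:
  assumes \<phi>: "simple_data F N p \<xi>" and \<psi>: "simple_data F N' p' \<xi>'" and t: "0 \<le> t"
  shows "l2_omega (\<lambda>\<omega>. simple_integral B N p \<xi> t \<omega> - simple_integral B N' p' \<xi>' t \<omega>)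
    = l2_time t (\<lambda>s \<omega>. simple_process N p \<xi> s \<omega> - simple_process N' p' \<xi>' s \<omega>)"
proof -
  \<comment> \<open>the steps of both integrands form one family, those of the second with opposite sign\<close>
  let ?K = "{..<N} <+> {..<N'}"
  define a where "a = case_sum p p'"
  define b where "b = case_sum (\<lambda>i. p (Suc i)) (\<lambda>i. p' (Suc i))"
  define \<zeta> where "\<zeta> = case_sum \<xi> (\<lambda>i \<omega>. - \<xi>' i \<omega>)"
  have mem: "P k" if "k \<in> ?K" "\<And>i. i < N \<Longrightarrow> P (Inl i)" "\<And>i. i < N' \<Longrightarrow> P (Inr i)" for P and k
    using that by auto
  have data: "0 \<le> a k \<and> a k \<le> b k \<and> \<zeta> k \<in> borel_measurable (F (a k)) \<and> (\<exists>C. \<forall>\<omega>\<in>space M. \<bar>\<zeta> k \<omega>\<bar> \<le> C)"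
    (is "?P k") if "k \<in> ?K" for k
  proof (rule mem[OF that])
    show "?P (Inl i)" if "i < N" for i
      using simple_data_le[OF \<phi> that] \<phi> that by (auto simp: a_def b_def \<zeta>_def simple_data_def space_F_eq)
    show "?P (Inr i)" if "i < N'" for i
      using simple_data_le[OF \<psi> that] \<psi> that by (auto simp: a_def b_def \<zeta>_def simple_data_def space_F_eq)
  qed
  have 1: "(\<Sum>k\<in>?K. \<zeta> k \<omega> * (B (min t (b k)) \<omega> - B (min t (a k)) \<omega>))
      = simple_integral B N p \<xi> t \<omega> - simple_integral B N' p' \<xi>' t \<omega>" for \<omega>
    by (simp add: sum.Plus a_def b_def \<zeta>_def simple_integral_def sum_negf)
  have 2: "(\<Sum>k\<in>?K. \<zeta> k \<omega> * indicator {a k<..b k} s)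
      = simple_process N p \<xi> s \<omega> - simple_process N' p' \<xi>' s \<omega>" for s \<omega>
    by (subst sum.Plus) (simp_all add: a_def b_def \<zeta>_def simple_process_def sum_negf)
  show ?thesis
    using ito_isometry_family[of ?K a b \<zeta> t] data t unfolding l2_omega_def l2_time_def 1 2 by simp
qed

text \<open>By the isometry, two sequences of simple integrands with the same $L^2$ limit have integrals with
the same $L^2$ limit.  This lets an arbitrary approximating sequence be replaced by the grid below.\<close>

lemma simple_integrals_share_limit:
  assumes \<phi>: "\<And>n. simple_data F (N n) (p n) (\<xi> n)" and \<psi>: "\<And>n. simple_data F (N' n) (p' n) (\<xi>' n)"
    and H: "time_measurable H" and t: "0 \<le> t" and I: "I \<in> borel_measurable M"
    and \<phi>H: "(\<lambda>n. l2_time t (\<lambda>s \<omega>. simple_process (N n) (p n) (\<xi> n) s \<omega> - H s \<omega>)) \<longlonglongrightarrow> 0"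
    and \<psi>H: "(\<lambda>n. l2_time t (\<lambda>s \<omega>. simple_process (N' n) (p' n) (\<xi>' n) s \<omega> - H s \<omega>)) \<longlonglongrightarrow> 0"
    and \<phi>I: "(\<lambda>n. l2_omega (\<lambda>\<omega>. simple_integral B (N n) (p n) (\<xi> n) t \<omega> - I \<omega>)) \<longlonglongrightarrow> 0"
  shows "(\<lambda>n. l2_omega (\<lambda>\<omega>. simple_integral B (N' n) (p' n) (\<xi>' n) t \<omega> - I \<omega>)) \<longlonglongrightarrow> 0"
proof (rule tendsto_sandwich[where f = "\<lambda>_. 0"])
  let ?f = "\<lambda>n. 2 * (2 * l2_time t (\<lambda>s \<omega>. simple_process (N' n) (p' n) (\<xi>' n) s \<omega> - H s \<omega>)
      + 2 * l2_time t (\<lambda>s \<omega>. simple_process (N n) (p n) (\<xi> n) s \<omega> - H s \<omega>))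
      + 2 * l2_omega (\<lambda>\<omega>. simple_integral B (N n) (p n) (\<xi> n) t \<omega> - I \<omega>)"
  have "l2_omega (\<lambda>\<omega>. simple_integral B (N' n) (p' n) (\<xi>' n) t \<omega> - I \<omega>) \<le> ?f n" for n
  proof -
    have "l2_omega (\<lambda>\<omega>. simple_integral B (N' n) (p' n) (\<xi>' n) t \<omega> - I \<omega>)
      \<le> 2 * l2_omega (\<lambda>\<omega>. simple_integral B (N' n) (p' n) (\<xi>' n) t \<omega> - simple_integral B (N n) (p n) (\<xi> n) t \<omega>)
        + 2 * l2_omega (\<lambda>\<omega>. simple_integral B (N n) (p n) (\<xi> n) t \<omega> - I \<omega>)"
      by (intro l2_omega_triangle simple_integral_measurable[OF \<phi> t] simple_integral_measurable[OF \<psi> t] I)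
    also have "\<dots> \<le> ?f n"
      unfolding ito_isometry_difference[OF \<psi> \<phi> t]
      by (intro add_mono mult_left_mono l2_time_triangle simple_process_time_measurable[OF \<phi>]
          simple_process_time_measurable[OF \<psi>] H) auto
    finally show ?thesis .
  qed
  then show "\<forall>\<^sub>F n in sequentially. l2_omega (\<lambda>\<omega>. simple_integral B (N' n) (p' n) (\<xi>' n) t \<omega> - I \<omega>) \<le> ?f n"
    by simp
  have "?f \<longlonglongrightarrow> 2 * (2 * 0 + 2 * 0) + 2 * 0"
    by (intro tendsto_add ennreal_tendsto_cmult \<phi>H \<psi>H \<phi>I) auto
  then show "?f \<longlonglongrightarrow> 0" by simp
qed auto

end

section \<open>The stochastic integral of a stopped constant\<close>

lemma continuous_process_measurable_nonneg:
  fixes X :: "real \<Rightarrow> 'a \<Rightarrow> real"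
  assumes X: "\<And>t. 0 \<le> t \<Longrightarrow> X t \<in> borel_measurable N"
    and cont: "\<And>\<omega>. \<omega> \<in> space N \<Longrightarrow> continuous_on {0..} (\<lambda>t. X t \<omega>)"
  shows "(\<lambda>(t, \<omega>). X t \<omega>) \<in> borel_measurable (restrict_space borel {0..} \<Otimes>\<^sub>M N)"
proof -
  have 1: "fst \<in> restrict_space borel {0..} \<Otimes>\<^sub>M N \<rightarrow>\<^sub>M (borel :: real measure)"
    using measurable_fst by (rule measurable_compose) (rule measurable_restrict_space1, simp)
  have "(\<lambda>x. (fst x, snd x)) \<in> restrict_space (borel :: real measure) {0..} \<Otimes>\<^sub>M N \<rightarrow>\<^sub>M borel \<Otimes>\<^sub>M N"
    by (rule measurable_Pair[OF 1 measurable_snd])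
  from measurable_compose[OF this continuous_process_jointly_measurable[OF X cont]]
  have "(\<lambda>x. X (max 0 (fst x)) (snd x)) \<in> borel_measurable (restrict_space borel {0..} \<Otimes>\<^sub>M N)" by simp
  then show ?thesis
    by (rule measurable_cong[THEN iffD1, rotated]) (auto simp: space_pair_measure space_restrict_space)
qed

context brownian_motion
begin

lemma time_measurableI:
  assumes "(\<lambda>(t, \<omega>). H t \<omega>) \<in> borel_measurable (restrict_space borel {0..} \<Otimes>\<^sub>M M)"
  shows "time_measurable H"
proof -
  have 1: "(\<lambda>x. max 0 (snd x)) \<in> M \<Otimes>\<^sub>M lborel \<rightarrow>\<^sub>M restrict_space (borel :: real measure) {0..}"
    by (rule measurable_restrict_space2) auto
  have "(\<lambda>x. (max 0 (snd x), fst x)) \<in> M \<Otimes>\<^sub>M lborel \<rightarrow>\<^sub>M restrict_space (borel :: real measure) {0..} \<Otimes>\<^sub>M M"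
    by (rule measurable_Pair[OF 1 measurable_fst])
  from measurable_compose[OF this assms] show ?thesis
    by (simp add: time_measurable_def case_prod_beta)
qed

text \<open>Fatou's lemma along an almost surely convergent sequence.  The limit \<open>J\<close> may be non-measurable: it
will be built from a random time chosen pathwise.\<close>

lemma l2_omega_fatou:
  assumes Y: "Y \<in> borel_measurable M" and X: "\<And>n. X n \<in> borel_measurable M"
    and lim: "AE \<omega> in M. (\<lambda>n. X n \<omega>) \<longlonglongrightarrow> J \<omega>"
    and bound: "\<And>n. n0 \<le> n \<Longrightarrow> l2_omega (\<lambda>\<omega>. X n \<omega> - Y \<omega>) \<le> c n" and c: "c \<longlonglongrightarrow> C"
  shows "l2_omega (\<lambda>\<omega>. J \<omega> - Y \<omega>) \<le> C" and "C = 0 \<Longrightarrow> AE \<omega> in M. J \<omega> = Y \<omega>"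
proof -
  let ?f = "\<lambda>n \<omega>. ennreal ((X n \<omega> - Y \<omega>)\<^sup>2)"
  have f: "?f n \<in> borel_measurable M" for n
  proof -
    have [measurable]: "X n \<in> borel_measurable M" "Y \<in> borel_measurable M" by fact+
    show ?thesis by measurable
  qed
  have lim_f: "AE \<omega> in M. liminf (\<lambda>n. ?f n \<omega>) = ennreal ((J \<omega> - Y \<omega>)\<^sup>2)"
    using lim
  proof eventually_elim
    case (elim \<omega>)
    then have "(\<lambda>n. ?f n \<omega>) \<longlonglongrightarrow> ennreal ((J \<omega> - Y \<omega>)\<^sup>2)" by (intro tendsto_intros)
    then show ?case by (simp add: lim_imp_Liminf)
  qed
  have "(\<integral>\<^sup>+\<omega>. liminf (\<lambda>n. ?f n \<omega>) \<partial>M) \<le> liminf (\<lambda>n. l2_omega (\<lambda>\<omega>. X n \<omega> - Y \<omega>))"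
    unfolding l2_omega_def by (rule nn_integral_liminf[OF f])
  also have "\<dots> \<le> liminf c"
    using bound by (intro Liminf_mono) (auto simp: eventually_sequentially)
  also have "\<dots> = C" using c by (simp add: lim_imp_Liminf)
  finally have le: "(\<integral>\<^sup>+\<omega>. liminf (\<lambda>n. ?f n \<omega>) \<partial>M) \<le> C" .
  also have "(\<integral>\<^sup>+\<omega>. liminf (\<lambda>n. ?f n \<omega>) \<partial>M) = l2_omega (\<lambda>\<omega>. J \<omega> - Y \<omega>)"
    unfolding l2_omega_def using lim_f by (rule nn_integral_cong_AE)
  finally show "l2_omega (\<lambda>\<omega>. J \<omega> - Y \<omega>) \<le> C" .
  show "AE \<omega> in M. J \<omega> = Y \<omega>" if "C = 0"
  proof -
    have "(\<integral>\<^sup>+\<omega>. liminf (\<lambda>n. ?f n \<omega>) \<partial>M) = 0" using le that by simp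
    then have "AE \<omega> in M. liminf (\<lambda>n. ?f n \<omega>) = 0"
      by (subst (asm) nn_integral_0_iff_AE) (auto intro: borel_measurable_liminf f)
    with lim_f show ?thesis
    proof eventually_elim
      case (elim \<omega>)
      then have "ennreal ((J \<omega> - Y \<omega>)\<^sup>2) = 0" by simp
      then show ?case by (simp add: ennreal_eq_0_iff)
    qed
  qed
qed

end

definition grid_point :: "nat \<Rightarrow> nat \<Rightarrow> real" where
  "grid_point n i = real i / real (Suc n)"

abbreviation grid_size :: "nat \<Rightarrow> nat" where
  "grid_size n \<equiv> Suc n * Suc n"

text \<open>The indicator of $\{R > \eta\}$ is sampled at the left end of each grid cell.  The grid of mesh
$1/(n+1)$ covers $[0, n+1]$, so that every bounded time interval is covered eventually.\<close>

definition grid_coeff :: "(real \<Rightarrow> 'a \<Rightarrow> real) \<Rightarrow> real \<Rightarrow> real \<Rightarrow> nat \<Rightarrow> nat \<Rightarrow> 'a \<Rightarrow> real" where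
  "grid_coeff R \<eta> \<sigma> n i \<omega> = indicator {\<eta><..} (R (grid_point n i) \<omega>) * \<sigma>"

lemma grid_point_nonneg: "0 \<le> grid_point n i" by (simp add: grid_point_def)

lemma grid_point_last: "grid_point n (grid_size n) = real (Suc n)"
  by (simp add: grid_point_def field_simps)

lemma grid_cell_iff:
  "s \<in> {grid_point n i<..grid_point n (Suc i)} \<longleftrightarrow> \<lceil>s * real (Suc n)\<rceil> = int i + 1"
proof -
  have "0 < real (Suc n)" by simp
  then have "s \<in> {grid_point n i<..grid_point n (Suc i)} \<longleftrightarrow> real i < s * real (Suc n) \<and> s * real (Suc n) \<le> real (Suc i)"
    unfolding grid_point_def greaterThanAtMost_iff pos_divide_less_eq[OF \<open>0 < real (Suc n)\<close>]
      pos_le_divide_eq[OF \<open>0 < real (Suc n)\<close>] by simp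
  also have "\<dots> \<longleftrightarrow> \<lceil>s * real (Suc n)\<rceil> = int i + 1"
    unfolding ceiling_eq_iff
    by (simp only: of_int_add of_int_of_nat_eq of_int_1 add_diff_cancel_right' of_nat_Suc add.commute[of 1])
  finally show ?thesis .
qed

lemma simple_process_grid:
  assumes "0 < s" "s \<le> real (Suc n)"
  obtains i where "i < grid_size n" "grid_point n i < s" "s \<le> grid_point n i + mesh n"
    "\<And>\<omega>. simple_process (grid_size n) (grid_point n) \<xi> s \<omega> = \<xi> i \<omega>"
proof -
  define i where "i = nat (\<lceil>s * real (Suc n)\<rceil> - 1)"
  have pos: "0 < s * real (Suc n)" using assms by simp
  then have c: "\<lceil>s * real (Suc n)\<rceil> = int i + 1" unfolding i_def by (simp add: zero_less_ceiling)
  have cell: "s \<in> {grid_point n j<..grid_point n (Suc j)} \<longleftrightarrow> j = i" for j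
    unfolding grid_cell_iff c by auto
  show ?thesis
  proof (rule that[of i])
    have "s * real (Suc n) \<le> real (Suc n) * real (Suc n)" using assms by (intro mult_right_mono) auto
    then have "\<lceil>s * real (Suc n)\<rceil> \<le> int (grid_size n)" unfolding ceiling_le_iff by (simp only: of_nat_mult of_int_mult of_int_of_nat_eq)
    then show i: "i < grid_size n" using c by linarith
    show "grid_point n i < s" using cell[of i] by simp
    have "s \<le> grid_point n (Suc i)" using cell[of i] by simp
    then show "s \<le> grid_point n i + mesh n"
      by (simp add: grid_point_def inverse_eq_divide add_divide_distrib)
    fix \<omega>
    have "simple_process (grid_size n) (grid_point n) \<xi> s \<omega> = (\<Sum>j<grid_size n. if j = i then \<xi> j \<omega> else 0)"
      unfolding simple_process_def by (intro sum.cong) (simp_all only: indicator_def cell, auto)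
    then show "simple_process (grid_size n) (grid_point n) \<xi> s \<omega> = \<xi> i \<omega>"
      using i by (simp add: sum.delta)
  qed
qed

text \<open>The sampled indicator is \<open>1\<close> on the cells that start before \<open>\<tau>\<close>, so the sum telescopes; \<open>u\<close> is the
minimum of \<open>t\<close> and the first grid point not before \<open>\<tau>\<close>, or the last one if there is none.\<close>

lemma simple_integral_grid:
  assumes \<tau>: "0 \<le> \<tau>" "\<And>s. 0 \<le> s \<Longrightarrow> \<eta> < R s \<omega> \<longleftrightarrow> s < \<tau>" and t: "0 \<le> t" "t \<le> real (Suc n)"
  obtains u where "0 \<le> u" "\<bar>u - min t \<tau>\<bar> \<le> mesh n"
    "simple_integral B (grid_size n) (grid_point n) (grid_coeff R \<eta> \<sigma> n) t \<omega> = \<sigma> * (B u \<omega> - B 0 \<omega>)"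
proof -
  define m where "m = real (Suc n)"
  have m: "0 < m" by (simp add: m_def)
  define c where "c = nat \<lceil>\<tau> * m\<rceil>"
  define k where "k = min (grid_size n) c"
  define u where "u = min t (grid_point n k)"
  have less: "grid_point n i < \<tau> \<longleftrightarrow> i < c" for i
  proof -
    have "grid_point n i < \<tau> \<longleftrightarrow> real i < \<tau> * m"
      unfolding grid_point_def m_def[symmetric] by (rule pos_divide_less_eq[OF m])
    also have "\<dots> \<longleftrightarrow> i < c" unfolding c_def by linarith
    finally show ?thesis .
  qed
  have coeff: "grid_coeff R \<eta> \<sigma> n i \<omega> = (if i < c then \<sigma> else 0)" for i
    unfolding grid_coeff_def indicator_def using \<tau>(2)[OF grid_point_nonneg] less by auto
  have "simple_integral B (grid_size n) (grid_point n) (grid_coeff R \<eta> \<sigma> n) t \<omega>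
      = (\<Sum>i<k. \<sigma> * (B (min t (grid_point n (Suc i))) \<omega> - B (min t (grid_point n i)) \<omega>))"
    unfolding simple_integral_def k_def coeff by (intro sum.mono_neutral_cong_right) auto
  also have "\<dots> = \<sigma> * (B u \<omega> - B 0 \<omega>)"
    unfolding u_def sum_distrib_left[symmetric]
    by (subst sum_lessThan_telescope) (use t in \<open>simp add: grid_point_def\<close>)
  finally have eq: "simple_integral B (grid_size n) (grid_point n) (grid_coeff R \<eta> \<sigma> n) t \<omega>
      = \<sigma> * (B u \<omega> - B 0 \<omega>)" .
  have c_bounds: "\<tau> \<le> real c / m" "real c / m \<le> \<tau> + inverse m"
  proof -
    have "0 \<le> \<tau> * m" using \<tau>(1) m by simp
    then have "\<tau> * m \<le> real c" "real c \<le> \<tau> * m + 1" unfolding c_def by linarith+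
    then show "\<tau> \<le> real c / m" "real c / m \<le> \<tau> + inverse m" using m by (auto simp: field_simps)
  qed
  have "\<bar>u - min t \<tau>\<bar> \<le> inverse m"
  proof (cases "c \<le> grid_size n")
    case True
    then have "u = min t (real c / m)" by (simp add: u_def k_def grid_point_def m_def min_absorb2)
    then show ?thesis using c_bounds by linarith
  next
    case False
    then have "u = t" using t grid_point_last[of n] by (simp add: u_def k_def min_absorb1)
    moreover have "real (grid_size n) \<le> real c" using False by (simp only: of_nat_le_iff nat_le_linear not_le less_imp_le)
    then have "real (grid_size n) / m \<le> real c / m" by (rule divide_right_mono[OF _ less_imp_le[OF m]])
    then have "t \<le> \<tau> + inverse m"
      using c_bounds t grid_point_last[of n] unfolding grid_point_def m_def[symmetric] by linarith
    ultimately show ?thesis using m by (simp add: min_def)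
  qed
  then show ?thesis using that[of u] eq t by (auto simp: u_def m_def grid_point_def)
qed

context brownian_motion
begin

abbreviation grid_process :: "(real \<Rightarrow> 'a \<Rightarrow> real) \<Rightarrow> real \<Rightarrow> real \<Rightarrow> nat \<Rightarrow> real \<Rightarrow> 'a \<Rightarrow> real" where
  "grid_process R \<eta> \<sigma> n \<equiv> simple_process (grid_size n) (grid_point n) (grid_coeff R \<eta> \<sigma> n)"

abbreviation grid_integral :: "(real \<Rightarrow> 'a \<Rightarrow> real) \<Rightarrow> real \<Rightarrow> real \<Rightarrow> nat \<Rightarrow> real \<Rightarrow> 'a \<Rightarrow> real" where
  "grid_integral R \<eta> \<sigma> n \<equiv> simple_integral B (grid_size n) (grid_point n) (grid_coeff R \<eta> \<sigma> n)"

lemma grid_simple_data: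
  assumes R: "\<And>t. 0 \<le> t \<Longrightarrow> R t \<in> borel_measurable (F t)"
  shows "simple_data F (grid_size n) (grid_point n) (grid_coeff R \<eta> \<sigma> n)"
  unfolding simple_data_def
proof (intro conjI allI impI)
  fix i
  have [measurable]: "R (grid_point n i) \<in> borel_measurable (F (grid_point n i))"
    by (rule R[OF grid_point_nonneg])
  show "grid_coeff R \<eta> \<sigma> n i \<in> borel_measurable (F (grid_point n i))"
    unfolding grid_coeff_def[abs_def] by measurable
  show "\<exists>C. \<forall>\<omega>\<in>space (F (grid_point n i)). \<bar>grid_coeff R \<eta> \<sigma> n i \<omega>\<bar> \<le> C"
    by (intro exI[of _ "\<bar>\<sigma>\<bar>"]) (auto simp: grid_coeff_def indicator_def)
  show "grid_point n i < grid_point n (Suc i)"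
    unfolding grid_point_def by (rule divide_strict_right_mono) auto
qed (rule grid_point_nonneg)

text \<open>The sampled indicator differs from the true one only between \<open>\<tau>\<close> and the next grid point, and at
time \<open>0\<close>.\<close>

lemma l2_time_grid_error:
  assumes \<tau>: "AE \<omega> in M. 0 \<le> \<tau> \<omega> \<and> (\<forall>s\<ge>0. \<eta> < R s \<omega> \<longleftrightarrow> s < \<tau> \<omega>)"
    and T: "T \<le> real (Suc n)"
  shows "l2_time T (\<lambda>s \<omega>. grid_process R \<eta> \<sigma> n s \<omega>
      - indicator {\<eta><..} (R s \<omega>) * \<sigma>) \<le> ennreal (\<sigma>\<^sup>2 * mesh n)"
proof -
  let ?d = "mesh n"
  let ?e = "\<lambda>s \<omega>. grid_process R \<eta> \<sigma> n s \<omega>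
      - indicator {\<eta><..} (R s \<omega>) * \<sigma>"
  have "(\<integral>\<^sup>+s\<in>{0..T}. ennreal ((?e s \<omega>)\<^sup>2) \<partial>lborel) \<le> ennreal (\<sigma>\<^sup>2 * ?d)"
    if \<omega>: "0 \<le> \<tau> \<omega> \<and> (\<forall>s\<ge>0. \<eta> < R s \<omega> \<longleftrightarrow> s < \<tau> \<omega>)" for \<omega>
  proof -
    have le: "ennreal ((?e s \<omega>)\<^sup>2) * indicator {0..T} s \<le> ennreal (\<sigma>\<^sup>2) * indicator {\<tau> \<omega>..\<tau> \<omega> + ?d} s"
      if "s \<noteq> 0" for s
    proof (cases "s \<in> {0..T}")
      case True
      then have s: "0 < s" "s \<le> real (Suc n)" using that T by auto
      obtain i where i: "grid_point n i < s" "s \<le> grid_point n i + ?d"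
        "\<And>\<omega>. grid_process R \<eta> \<sigma> n s \<omega> = grid_coeff R \<eta> \<sigma> n i \<omega>"
        using simple_process_grid[OF s] by metis
      have "grid_coeff R \<eta> \<sigma> n i \<omega> = (if grid_point n i < \<tau> \<omega> then \<sigma> else 0)"
        using \<omega> grid_point_nonneg[of n i] by (auto simp: grid_coeff_def indicator_def)
      moreover have "indicator {\<eta><..} (R s \<omega>) * \<sigma> = (if s < \<tau> \<omega> then \<sigma> else 0)"
        using \<omega> s by (auto simp: indicator_def)
      ultimately have "?e s \<omega> = (if grid_point n i < \<tau> \<omega> \<and> \<tau> \<omega> \<le> s then \<sigma> else 0)"
        using i by auto
      then show ?thesis using i True by (auto simp: indicator_def)
    qed simp
    have "(\<integral>\<^sup>+s\<in>{0..T}. ennreal ((?e s \<omega>)\<^sup>2) \<partial>lborel)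
        \<le> (\<integral>\<^sup>+s. ennreal (\<sigma>\<^sup>2) * indicator {\<tau> \<omega>..\<tau> \<omega> + ?d} s \<partial>lborel)"
      by (rule nn_integral_mono_AE, rule eventually_mono[OF AE_lborel_singleton[of 0]], rule le)
    also have "\<dots> = ennreal (\<sigma>\<^sup>2 * ?d)"
      by (subst nn_integral_cmult_indicator) (auto simp: ennreal_mult)
    finally show ?thesis .
  qed
  then have "l2_time T ?e \<le> (\<integral>\<^sup>+\<omega>. ennreal (\<sigma>\<^sup>2 * ?d) \<partial>M)"
    unfolding l2_time_def using \<tau> by (intro nn_integral_mono_AE) auto
  also have "\<dots> = ennreal (\<sigma>\<^sup>2 * ?d)" by (simp add: emeasure_space_1)
  finally show ?thesis .
qed

lemma l2_time_grid_tendsto: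
  assumes "AE \<omega> in M. 0 \<le> \<tau> \<omega> \<and> (\<forall>s\<ge>0. \<eta> < R s \<omega> \<longleftrightarrow> s < \<tau> \<omega>)"
  shows "(\<lambda>n. l2_time T (\<lambda>s \<omega>. grid_process R \<eta> \<sigma> n s \<omega>
      - indicator {\<eta><..} (R s \<omega>) * \<sigma>)) \<longlonglongrightarrow> 0"
proof (rule tendsto_sandwich[where f = "\<lambda>_. 0"])
  have "(\<lambda>n. ennreal (\<sigma>\<^sup>2 * mesh n)) \<longlonglongrightarrow> ennreal (\<sigma>\<^sup>2 * 0)"
    by (intro tendsto_intros LIMSEQ_inverse_real_of_nat)
  then show "(\<lambda>n. ennreal (\<sigma>\<^sup>2 * mesh n)) \<longlonglongrightarrow> 0" by simp
  have "\<forall>\<^sub>F n in sequentially. T \<le> real (Suc n)"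
    using eventually_ge_at_top[of "nat \<lceil>T\<rceil>"] by eventually_elim linarith
  then show "\<forall>\<^sub>F n in sequentially. l2_time T (\<lambda>s \<omega>.
      grid_process R \<eta> \<sigma> n s \<omega>
      - indicator {\<eta><..} (R s \<omega>) * \<sigma>) \<le> ennreal (\<sigma>\<^sup>2 * mesh n)"
    by (rule eventually_mono) (rule l2_time_grid_error[OF assms])
qed auto

lemma simple_integral_grid_tendsto:
  assumes \<omega>: "\<omega> \<in> space M" and \<tau>: "0 \<le> \<tau>" "\<And>s. 0 \<le> s \<Longrightarrow> \<eta> < R s \<omega> \<longleftrightarrow> s < \<tau>" and t: "0 \<le> t"
  shows "(\<lambda>n. grid_integral R \<eta> \<sigma> n t \<omega>)
    \<longlonglongrightarrow> \<sigma> * (B (min t \<tau>) \<omega> - B 0 \<omega>)"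
proof -
  let ?S = "\<lambda>n. grid_integral R \<eta> \<sigma> n t \<omega>"
  have "\<exists>u. 0 \<le> u \<and> (t \<le> real (Suc n) \<longrightarrow> \<bar>u - min t \<tau>\<bar> \<le> mesh n \<and> ?S n = \<sigma> * (B u \<omega> - B 0 \<omega>))" for n
  proof (cases "t \<le> real (Suc n)")
    case True
    obtain u where "0 \<le> u" "\<bar>u - min t \<tau>\<bar> \<le> mesh n" "?S n = \<sigma> * (B u \<omega> - B 0 \<omega>)"
      using simple_integral_grid[where R = R and \<eta> = \<eta> and \<omega> = \<omega> and B = B and \<sigma> = \<sigma>, OF \<tau> t True] by blast
    then show ?thesis by blast
  qed auto
  then obtain u where u: "\<And>n. 0 \<le> u n" "\<And>n. t \<le> real (Suc n) \<Longrightarrow> \<bar>u n - min t \<tau>\<bar> \<le> mesh n"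
    "\<And>n. t \<le> real (Suc n) \<Longrightarrow> ?S n = \<sigma> * (B (u n) \<omega> - B 0 \<omega>)" by metis
  have ev: "\<forall>\<^sub>F n in sequentially. t \<le> real (Suc n)"
    using eventually_ge_at_top[of "nat \<lceil>t\<rceil>"] by eventually_elim linarith
  have "\<forall>\<^sub>F n in sequentially. norm (u n - min t \<tau>) \<le> mesh n"
    using ev by eventually_elim (simp only: real_norm_def u(2))
  then have "(\<lambda>n. u n - min t \<tau>) \<longlonglongrightarrow> 0"
    by (rule Lim_null_comparison[OF _ LIMSEQ_inverse_real_of_nat])
  then have "u \<longlonglongrightarrow> min t \<tau>" by (simp add: LIM_zero_iff)
  then have "(\<lambda>n. B (u n) \<omega>) \<longlonglongrightarrow> B (min t \<tau>) \<omega>"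
    by (intro continuous_on_tendsto_compose[OF continuous_B[OF \<omega>]]) (use u(1) t \<tau>(1) in auto)
  then have "(\<lambda>n. \<sigma> * (B (u n) \<omega> - B 0 \<omega>)) \<longlonglongrightarrow> \<sigma> * (B (min t \<tau>) \<omega> - B 0 \<omega>)"
    by (intro tendsto_intros)
  then show ?thesis
    by (rule Lim_transform_eventually) (rule eventually_mono[OF ev], simp only: u(3))
qed

text \<open>At a fixed time both the given version and the stopped Brownian motion are limits of the grid
integrals, in $L^2$ and pathwise respectively.  Rational times and continuity give all times.\<close>

theorem ito_integral_of_stopped_constant_unique:
  fixes R :: "real \<Rightarrow> 'a \<Rightarrow> real"
  assumes I: "is_ito_integral M F B (\<lambda>s \<omega>. indicator {\<eta><..} (R s \<omega>) * \<sigma>) I"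
    and R: "\<And>t. 0 \<le> t \<Longrightarrow> R t \<in> borel_measurable (F t)"
    and \<tau>: "AE \<omega> in M. 0 \<le> \<tau> \<omega> \<and> (\<forall>s\<ge>0. \<eta> < R s \<omega> \<longleftrightarrow> s < \<tau> \<omega>)"
  shows "AE \<omega> in M. \<forall>t\<ge>0. I t \<omega> = \<sigma> * (B (min t (\<tau> \<omega>)) \<omega> - B 0 \<omega>)"
proof -
  note I' = I[unfolded is_ito_integral_def]
  obtain N p \<xi> where \<phi>: "\<And>n. simple_data F (N n) (p n) (\<xi> n)"
    and \<phi>H: "\<And>T. 0 \<le> T \<Longrightarrow> (\<lambda>n. l2_time T (\<lambda>s \<omega>. simple_process (N n) (p n) (\<xi> n) s \<omega>
        - indicator {\<eta><..} (R s \<omega>) * \<sigma>)) \<longlonglongrightarrow> 0"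
    and \<phi>I: "\<And>t. 0 \<le> t \<Longrightarrow> (\<lambda>n. l2_omega (\<lambda>\<omega>. simple_integral B (N n) (p n) (\<xi> n) t \<omega> - I t \<omega>)) \<longlonglongrightarrow> 0"
    using I' unfolding l2_time_def l2_omega_def by blast
  have H: "time_measurable (\<lambda>s \<omega>. indicator {\<eta><..} (R s \<omega>) * \<sigma>)"
    using I' by (intro time_measurableI) blast
  have at: "AE \<omega> in M. \<sigma> * (B (min t (\<tau> \<omega>)) \<omega> - B 0 \<omega>) = I t \<omega>" if t: "0 \<le> t" for t
  proof (rule l2_omega_fatou(2)[OF _ simple_integral_measurable[OF grid_simple_data[OF R] t]])
    show It: "I t \<in> borel_measurable M" using I' t by blast
    show "AE \<omega> in M. (\<lambda>n. grid_integral R \<eta> \<sigma> n t \<omega>)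
      \<longlonglongrightarrow> \<sigma> * (B (min t (\<tau> \<omega>)) \<omega> - B 0 \<omega>)"
      using \<tau> AE_space by eventually_elim (rule simple_integral_grid_tendsto, use t in auto)
    show "(\<lambda>n. l2_omega (\<lambda>\<omega>. grid_integral R \<eta> \<sigma> n t \<omega> - I t \<omega>)) \<longlonglongrightarrow> 0"
      by (rule simple_integrals_share_limit[OF \<phi> grid_simple_data[OF R] H t It \<phi>H[OF t] l2_time_grid_tendsto[OF \<tau>] \<phi>I[OF t]])
  qed auto
  have "AE \<omega> in M. \<forall>q\<in>\<rat> \<inter> {0..}. \<sigma> * (B (min q (\<tau> \<omega>)) \<omega> - B 0 \<omega>) = I q \<omega>"
    by (subst AE_ball_countable) (auto simp: countable_rat intro: at)
  with \<tau> AE_space show ?thesis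
  proof eventually_elim
    case (elim \<omega>)
    have cont_I: "continuous_on {0..} (\<lambda>t. I t \<omega>)" using I' elim by blast
    have cont_B: "continuous_on {0..} (\<lambda>t. \<sigma> * (B (min t (\<tau> \<omega>)) \<omega> - B 0 \<omega>))"
      using elim by (intro continuous_intros continuous_on_compose2[OF continuous_B, of \<omega> "{0..}" "\<lambda>t. min t (\<tau> \<omega>)"]) auto
    show ?case
    proof (intro allI impI)
      fix t :: real assume t: "0 \<le> t"
      have "\<exists>q\<in>\<rat>. t < q \<and> q < t + mesh n" for n by (rule Rats_dense_in_real) simp
      then obtain q where q: "\<And>n. q n \<in> \<rat>" "\<And>n. t < q n" "\<And>n. q n < t + mesh n" by metis
      have "(\<lambda>n. q n - t) \<longlonglongrightarrow> 0"
        by (rule Lim_null_comparison[OF _ LIMSEQ_inverse_real_of_nat])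
          (use q(2,3) in \<open>auto intro!: always_eventually simp: less_imp_le algebra_simps\<close>)
      then have q_lim: "q \<longlonglongrightarrow> t" by (simp add: LIM_zero_iff)
      have q0: "q n \<in> {0..}" for n using q(2)[of n] t by simp
      have "(\<lambda>n. I (q n) \<omega>) \<longlonglongrightarrow> I t \<omega>"
        by (rule continuous_on_tendsto_compose[OF cont_I q_lim]) (use t q0 in auto)
      moreover have "(\<lambda>n. \<sigma> * (B (min (q n) (\<tau> \<omega>)) \<omega> - B 0 \<omega>)) \<longlonglongrightarrow> \<sigma> * (B (min t (\<tau> \<omega>)) \<omega> - B 0 \<omega>)"
        by (rule continuous_on_tendsto_compose[OF cont_B q_lim]) (use t q0 in auto)
      moreover have "\<sigma> * (B (min (q n) (\<tau> \<omega>)) \<omega> - B 0 \<omega>) = I (q n) \<omega>" for n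
        using elim q(1) q0 by blast
      ultimately show "I t \<omega> = \<sigma> * (B (min t (\<tau> \<omega>)) \<omega> - B 0 \<omega>)"
        using LIMSEQ_unique by fastforce
    qed
  qed
qed

text \<open>The grid integrals converge pathwise to the stopped Brownian motion; they are Cauchy in $L^2$ by the isometry, so
by Fatou's lemma the convergence also holds in $L^2$.\<close>

theorem ito_integral_of_stopped_constant:
  fixes R :: "real \<Rightarrow> 'a \<Rightarrow> real"
  assumes R: "\<And>t. 0 \<le> t \<Longrightarrow> R t \<in> borel_measurable (F t)"
    and cont: "\<And>\<omega>. \<omega> \<in> space M \<Longrightarrow> continuous_on {0..} (\<lambda>t. R t \<omega>)"
    and \<tau>: "\<And>\<omega>. \<omega> \<in> space M \<Longrightarrow> 0 \<le> \<tau> \<omega>" "\<And>\<omega> s. \<omega> \<in> space M \<Longrightarrow> 0 \<le> s \<Longrightarrow> \<eta> < R s \<omega> \<longleftrightarrow> s < \<tau> \<omega>"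
  shows "is_ito_integral M F B (\<lambda>s \<omega>. indicator {\<eta><..} (R s \<omega>) * \<sigma>)
    (\<lambda>t \<omega>. \<sigma> * (B (min t (\<tau> \<omega>)) \<omega> - B 0 \<omega>))"
proof -
  let ?H = "\<lambda>s \<omega>. indicator {\<eta><..} (R s \<omega>) * \<sigma>"
  let ?I = "\<lambda>t \<omega>. \<sigma> * (B (min t (\<tau> \<omega>)) \<omega> - B 0 \<omega>)"
  let ?S = "\<lambda>n t. grid_integral R \<eta> \<sigma> n t"
  let ?\<psi> = "\<lambda>n. grid_process R \<eta> \<sigma> n"
  have \<tau>': "AE \<omega> in M. 0 \<le> \<tau> \<omega> \<and> (\<forall>s\<ge>0. \<eta> < R s \<omega> \<longleftrightarrow> s < \<tau> \<omega>)" using \<tau> by auto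
  have data: "simple_data F (grid_size n) (grid_point n) (grid_coeff R \<eta> \<sigma> n)" for n
    by (rule grid_simple_data[OF R])
  have [measurable]: "(\<lambda>x. R (fst x) (snd x)) \<in> borel_measurable (restrict_space borel {0..} \<Otimes>\<^sub>M M)"
    using continuous_process_measurable_nonneg[OF measurable_F_M[OF R] cont] by (simp add: case_prod_beta)
  have H_meas: "(\<lambda>(t, \<omega>). ?H t \<omega>) \<in> borel_measurable (restrict_space borel {0..} \<Otimes>\<^sub>M M)"
    unfolding case_prod_beta by measurable
  note H = time_measurableI[OF H_meas]
  have lim: "(\<lambda>n. ?S n t \<omega>) \<longlonglongrightarrow> ?I t \<omega>" if "\<omega> \<in> space M" "0 \<le> t" for t \<omega>
    by (rule simple_integral_grid_tendsto) (use that \<tau> in auto)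
  have I_meas: "?I t \<in> borel_measurable M" if "0 \<le> t" for t
    by (rule borel_measurable_LIMSEQ_real[OF lim simple_integral_measurable[OF data]]) (use that in auto)
  have L2: "(\<lambda>n. l2_omega (\<lambda>\<omega>. ?S n t \<omega> - ?I t \<omega>)) \<longlonglongrightarrow> 0" if t: "0 \<le> t" for t
  proof (rule tendsto_sandwich[where f = "\<lambda>_. 0"])
    let ?e = "\<lambda>n. l2_time t (\<lambda>s \<omega>. ?\<psi> n s \<omega> - ?H s \<omega>)"
    have e: "?e \<longlonglongrightarrow> 0" by (rule l2_time_grid_tendsto[OF \<tau>'])
    have "l2_omega (\<lambda>\<omega>. ?S n t \<omega> - ?I t \<omega>) \<le> 2 * ?e n" for n
    proof -
      have "l2_omega (\<lambda>\<omega>. ?I t \<omega> - ?S n t \<omega>) \<le> 2 * 0 + 2 * ?e n"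
      proof (rule l2_omega_fatou(1))
        show "?S n t \<in> borel_measurable M" "?S k t \<in> borel_measurable M" for k
          by (rule simple_integral_measurable[OF data t])+
        show "AE \<omega> in M. (\<lambda>k. ?S k t \<omega>) \<longlonglongrightarrow> ?I t \<omega>" using lim t by auto
        show "l2_omega (\<lambda>\<omega>. ?S k t \<omega> - ?S n t \<omega>) \<le> 2 * ?e k + 2 * ?e n" for k
          unfolding ito_isometry_difference[OF data data t]
          by (intro l2_time_triangle simple_process_time_measurable[OF data] H) auto
        show "(\<lambda>k. 2 * ?e k + 2 * ?e n) \<longlonglongrightarrow> 2 * 0 + 2 * ?e n"
          by (intro tendsto_add ennreal_tendsto_cmult e tendsto_const) auto
      qed
      then show ?thesis by (simp add: l2_omega_def power2_commute)
    qed
    then show "\<forall>\<^sub>F n in sequentially. l2_omega (\<lambda>\<omega>. ?S n t \<omega> - ?I t \<omega>) \<le> 2 * ?e n" by simp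
    have "(\<lambda>n. 2 * ?e n) \<longlonglongrightarrow> 2 * 0" by (intro ennreal_tendsto_cmult e) auto
    then show "(\<lambda>n. 2 * ?e n) \<longlonglongrightarrow> 0" by simp
  qed auto
  show ?thesis
    unfolding is_ito_integral_def
  proof (intro conjI allI impI ballI)
    show "(\<lambda>(t, \<omega>). ?H t \<omega>) \<in> borel_measurable (restrict_space borel {0..} \<Otimes>\<^sub>M M)" by (rule H_meas)
    show "?H t \<in> borel_measurable (F t)" if "0 \<le> t" for t
    proof -
      have [measurable]: "R t \<in> borel_measurable (F t)" by (rule R[OF that])
      show ?thesis by measurable
    qed
    show "(\<integral>\<^sup>+\<omega>. (\<integral>\<^sup>+s\<in>{0..T}. ennreal ((?H s \<omega>)\<^sup>2) \<partial>lborel) \<partial>M) < \<infinity>" if "0 \<le> T" for T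
    proof -
      have "(\<integral>\<^sup>+\<omega>. (\<integral>\<^sup>+s\<in>{0..T}. ennreal ((?H s \<omega>)\<^sup>2) \<partial>lborel) \<partial>M)
          \<le> (\<integral>\<^sup>+\<omega>. (\<integral>\<^sup>+s. ennreal (\<sigma>\<^sup>2) * indicator {0..T} s \<partial>lborel) \<partial>M)"
        by (intro nn_integral_mono mult_right_mono) (auto simp: indicator_def)
      also have "\<dots> = ennreal (\<sigma>\<^sup>2 * T)"
        using that by (simp add: nn_integral_cmult_indicator emeasure_space_1 ennreal_mult)
      finally show ?thesis by (simp add: le_less_trans)
    qed
    show "?I t \<in> borel_measurable M" if "0 \<le> t" for t by (rule I_meas[OF that])
    show "continuous_on {0..} (\<lambda>t. ?I t \<omega>)" if "\<omega> \<in> space M" for \<omega>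
      using that \<tau> by (intro continuous_intros continuous_on_compose2[OF continuous_B, of \<omega> "{0..}" "\<lambda>t. min t (\<tau> \<omega>)"]) auto
    show "\<exists>N p \<xi>. (\<forall>n. simple_data F (N n) (p n) (\<xi> n)) \<and>
        (\<forall>T\<ge>0. (\<lambda>n. \<integral>\<^sup>+\<omega>. (\<integral>\<^sup>+s\<in>{0..T}.
            ennreal ((simple_process (N n) (p n) (\<xi> n) s \<omega> - ?H s \<omega>)\<^sup>2) \<partial>lborel) \<partial>M) \<longlonglongrightarrow> 0) \<and>
        (\<forall>t\<ge>0. (\<lambda>n. \<integral>\<^sup>+\<omega>. ennreal ((simple_integral B (N n) (p n) (\<xi> n) t \<omega> - ?I t \<omega>)\<^sup>2) \<partial>M) \<longlonglongrightarrow> 0)"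
      by (intro exI[of _ grid_size] exI[of _ grid_point] exI[of _ "grid_coeff R \<eta> \<sigma>"] conjI allI impI
          data l2_time_grid_tendsto[OF \<tau>', unfolded l2_time_def] L2[unfolded l2_omega_def])
  qed
qed

end

section \<open>Strong solutions for an abstract one-sided Lipschitz drift\<close>

locale stopped_diffusion = brownian_motion M F B + one_sided_drift v \<eta> g h
  for M :: "'a measure" and F :: "real \<Rightarrow> 'a measure" and B :: "real \<Rightarrow> 'a \<Rightarrow> real"
    and v \<eta> :: real and g h :: "real \<Rightarrow> real" +
  fixes \<sigma> r \<theta> :: real
  assumes \<sigma>_pos: "0 < \<sigma>" and r_gt: "\<eta> < r"
begin

abbreviation solution :: "(real \<Rightarrow> 'a \<Rightarrow> real) \<Rightarrow> (real \<Rightarrow> 'a \<Rightarrow> real) \<Rightarrow> bool" where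
  "solution \<equiv> strong_solution M F B \<sigma> \<eta> (\<lambda>t \<omega> y. - v * g y) (\<lambda>t \<omega> x y. v * h y / x) r \<theta>"

definition noise :: "'a \<Rightarrow> real \<Rightarrow> real" where
  "noise \<omega> t = \<theta> + \<sigma> * B t \<omega>"

lemma noise_continuous: "\<omega> \<in> space M \<Longrightarrow> continuous_on {0..} (noise \<omega>)"
  unfolding noise_def by (intro continuous_intros continuous_B)

lemma noise_adapted:
  assumes "0 \<le> s" "s \<le> t"
  shows "(\<lambda>\<omega>. noise \<omega> s) \<in> borel_measurable (F t)"
proof -
  have [measurable]: "B s \<in> borel_measurable (F t)" by (rule B_measurable_F[OF assms])
  show ?thesis unfolding noise_def by measurable
qed

lemma solutionD:
  assumes "solution R \<Theta>"
  shows solution_adapted: "\<forall>t\<ge>0. R t \<in> borel_measurable (F t) \<and> \<Theta> t \<in> borel_measurable (F t)" (is ?adapted)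
    and solution_continuous: "\<forall>\<omega>\<in>space M. continuous_on {0..} (\<lambda>t. R t \<omega>) \<and> continuous_on {0..} (\<lambda>t. \<Theta> t \<omega>)"
      (is ?continuous)
    and solution_start: "AE \<omega> in M. R 0 \<omega> = r \<and> \<Theta> 0 \<omega> = \<theta>" (is ?start)
    and solution_radius_eq: "AE \<omega> in M. \<forall>t\<ge>0. R t \<omega> = R 0 \<omega>
      + (LINT s:{0..t}|lborel. indicator {\<eta><..} (R s \<omega>) * (- v * g (\<Theta> s \<omega>)))" (is ?radius)
    and solution_angle_eq: "\<exists>I. is_ito_integral M F B (\<lambda>s \<omega>. indicator {\<eta><..} (R s \<omega>) * \<sigma>) I \<and>
      (AE \<omega> in M. \<forall>t\<ge>0. \<Theta> t \<omega> = \<Theta> 0 \<omega>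
        + (LINT s:{0..t}|lborel. indicator {\<eta><..} (R s \<omega>) * (v * h (\<Theta> s \<omega>) / R s \<omega>)) + I t \<omega>)"
      (is ?angle)
proof -
  note sol = assms[unfolded strong_solution_def]
  note c2 = sol[THEN conjunct2] note c3 = c2[THEN conjunct2]
  note c5 = c3[THEN conjunct2, THEN conjunct2]
  show ?adapted ?continuous ?start ?radius ?angle
    by (rule sol[THEN conjunct1] c2[THEN conjunct1] c3[THEN conjunct1] c5[THEN conjunct1] c5[THEN conjunct2])+
qed

lemma solution_radius_hits:
  assumes "solution R \<Theta>"
  shows "AE \<omega> in M. \<exists>\<tau>\<ge>0. \<tau> \<le> sqrt 2 * (r - \<eta>) / v \<and> (\<forall>s\<ge>0. \<eta> < R s \<omega> \<longleftrightarrow> s < \<tau>) \<and> (\<forall>s\<ge>\<tau>. R s \<omega> = \<eta>)"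
proof -
  from solution_start[OF assms] solution_radius_eq[OF assms] AE_space show ?thesis
  proof eventually_elim
    case (elim \<omega>)
    have cont: "continuous_on {0..} (\<lambda>t. R t \<omega>)" "continuous_on {0..} (\<lambda>t. \<Theta> t \<omega>)"
      using solution_continuous[OF assms] elim(3) by blast+
    have int: "((\<lambda>s. indicator {\<eta><..} (R s \<omega>) * (- v * g (\<Theta> s \<omega>))) has_integral (R t \<omega> - r)) {0..t}"
      if "0 \<le> t" for t
    proof -
      have "R t \<omega> - r = (LINT s:{0..t}|lborel. indicator {\<eta><..} (R s \<omega>) * (- v * g (\<Theta> s \<omega>)))"
        using elim(2)[rule_format, OF that] elim(1) by linarith
      then show ?thesis using stopped_drift_LINT(1)[OF cont, of t] by simp
    qed
    show ?case
    proof (rule radius_reaches_level[OF cont(1) r_gt int])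
      fix \<tau> assume "0 \<le> \<tau>" "\<tau> \<le> sqrt 2 * (r - \<eta>) / v"
        "\<And>s. 0 \<le> s \<Longrightarrow> \<eta> < R s \<omega> \<longleftrightarrow> s < \<tau>" "\<And>s. \<tau> \<le> s \<Longrightarrow> R s \<omega> = \<eta>"
      then show ?case by (intro exI[of _ \<tau>] conjI allI impI)
    qed
  qed
qed

text \<open>By uniqueness of the stochastic integral, the martingale part is $\sigma(B_{t\wedge\tau} - B_0)$, so the
path solves the deterministic problem driven by \<open>noise \<omega>\<close>.\<close>

lemma solution_stopped_path:
  assumes "solution R \<Theta>"
  shows "AE \<omega> in M. \<exists>\<tau>. stopped_path r (noise \<omega>) \<tau> (\<lambda>t. R t \<omega>) (\<lambda>t. \<Theta> t \<omega>)"
proof -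
  obtain I where I: "is_ito_integral M F B (\<lambda>s \<omega>. indicator {\<eta><..} (R s \<omega>) * \<sigma>) I"
    and eq\<Theta>: "AE \<omega> in M. \<forall>t\<ge>0. \<Theta> t \<omega> = \<Theta> 0 \<omega>
      + (LINT s:{0..t}|lborel. indicator {\<eta><..} (R s \<omega>) * (v * h (\<Theta> s \<omega>) / R s \<omega>)) + I t \<omega>"
    using solution_angle_eq[OF assms] by blast
  have R_meas: "R t \<in> borel_measurable (F t)" if "0 \<le> t" for t
    using solution_adapted[OF assms] that by blast
  define P where "P \<omega> \<tau> \<longleftrightarrow> 0 \<le> \<tau> \<and> (\<forall>s\<ge>0. \<eta> < R s \<omega> \<longleftrightarrow> s < \<tau>) \<and> (\<forall>s\<ge>\<tau>. R s \<omega> = \<eta>)" for \<omega> \<tau>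
  \<comment> \<open>a pathwise choice; on the exceptional null set its value is arbitrary\<close>
  define \<tau> where "\<tau> \<omega> = (SOME \<tau>. P \<omega> \<tau>)" for \<omega>
  have \<tau>: "AE \<omega> in M. P \<omega> (\<tau> \<omega>)"
    using solution_radius_hits[OF assms]
  proof eventually_elim
    case (elim \<omega>)
    then have "\<exists>\<tau>. P \<omega> \<tau>" unfolding P_def by blast
    then show ?case unfolding \<tau>_def by (rule someI_ex)
  qed
  have "AE \<omega> in M. 0 \<le> \<tau> \<omega> \<and> (\<forall>s\<ge>0. \<eta> < R s \<omega> \<longleftrightarrow> s < \<tau> \<omega>)"
    using \<tau> by eventually_elim (simp add: P_def)
  from ito_integral_of_stopped_constant_unique[OF I R_meas this]
  have I_eq: "AE \<omega> in M. \<forall>t\<ge>0. I t \<omega> = \<sigma> * (B (min t (\<tau> \<omega>)) \<omega> - B 0 \<omega>)" .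
  from solution_start[OF assms] start_B solution_radius_eq[OF assms] eq\<Theta> \<tau> I_eq AE_space
  show ?thesis
  proof eventually_elim
    case (elim \<omega>)
    let ?X = "\<lambda>t. LINT s:{0..t}|lborel. indicator {\<eta><..} (R s \<omega>) * (v * h (\<Theta> s \<omega>) / R s \<omega>)"
    have cR: "continuous_on {0..} (\<lambda>t. R t \<omega>)" and c\<Theta>: "continuous_on {0..} (\<lambda>t. \<Theta> t \<omega>)"
      using solution_continuous[OF assms] elim(7) by blast+
    have \<tau>_props: "0 \<le> \<tau> \<omega>" "\<And>s. 0 \<le> s \<Longrightarrow> \<eta> < R s \<omega> \<longleftrightarrow> s < \<tau> \<omega>" "\<And>s. \<tau> \<omega> \<le> s \<Longrightarrow> R s \<omega> = \<eta>"
      using elim(5) unfolding P_def by blast+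
    note LINT = stopped_drift_LINT[OF cR c\<Theta>]
    have \<Theta>_eq: "\<Theta> t \<omega> = noise \<omega> (min t (\<tau> \<omega>)) + ?X t" if "0 \<le> t" for t
    proof -
      have "\<Theta> t \<omega> = \<Theta> 0 \<omega> + ?X t + I t \<omega>" "I t \<omega> = \<sigma> * (B (min t (\<tau> \<omega>)) \<omega> - B 0 \<omega>)"
        using elim(4,6) that by blast+
      then show ?thesis using elim(1,2) by (simp add: noise_def)
    qed
    have X_stop: "?X t = ?X (\<tau> \<omega>)" if "\<tau> \<omega> \<le> t" for t
    proof -
      have "((\<lambda>s. indicator {\<eta><..} (R s \<omega>) * (v * h (\<Theta> s \<omega>) / R s \<omega>)) has_integral ?X (\<tau> \<omega>)) {0..t}"
      proof (rule has_integral_stopped)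
        show "((\<lambda>s. indicator {\<eta><..} (R s \<omega>) * (v * h (\<Theta> s \<omega>) / R s \<omega>)) has_integral ?X (\<tau> \<omega>)) {0..min t (\<tau> \<omega>)}"
          using LINT(2)[of "\<tau> \<omega>"] that by (simp add: min_absorb2)
      qed (use that \<tau>_props in simp_all)
      then show ?thesis by (rule has_integral_unique[OF LINT(2)])
    qed
    have "stopped_path r (noise \<omega>) (\<tau> \<omega>) (\<lambda>t. R t \<omega>) (\<lambda>t. \<Theta> t \<omega>)"
      unfolding stopped_path_def
    proof (intro conjI allI impI exI[of _ ?X])
      show "perturbed_solution r (noise \<omega>) (\<tau> \<omega>) 0 (\<lambda>t. R t \<omega>) ?X (\<lambda>t. R t \<omega>) (\<lambda>t. \<Theta> t \<omega>)"
        unfolding perturbed_solution_def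
      proof (intro ballI conjI)
        fix t assume t: "t \<in> {0..\<tau> \<omega>}"
        \<comment> \<open>up to \<open>\<tau>\<close> the indicator is \<open>1\<close> except at the single time \<open>\<tau>\<close>\<close>
        have spike: "(k has_integral i) {0..t}"
          if "((\<lambda>s. indicator {\<eta><..} (R s \<omega>) * k' s) has_integral i) {0..t}"
            "\<And>s. \<eta> < R s \<omega> \<Longrightarrow> k s = k' s" for k k' :: "real \<Rightarrow> real" and i
          by (rule has_integral_spike_finite[of "{\<tau> \<omega>}", OF _ _ that(1)]) (use that(2) \<tau>_props(2) t in auto)
        have "((\<lambda>s. indicator {\<eta><..} (R s \<omega>) * (- v * g (\<Theta> s \<omega>))) has_integral R t \<omega> - r) {0..t}"
        proof -
          have "R t \<omega> - r = (LINT s:{0..t}|lborel. indicator {\<eta><..} (R s \<omega>) * (- v * g (\<Theta> s \<omega>)))"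
            using elim(3)[rule_format, of t] elim(1) t by simp
          then show ?thesis using LINT(1)[of t] by simp
        qed
        then show "((\<lambda>s. - v * g (\<Theta> s \<omega>)) has_integral R t \<omega> - r) {0..t}" by (rule spike) simp
        show "((\<lambda>s. v * h (\<Theta> s \<omega>) / max (R s \<omega>) \<eta>) has_integral ?X t) {0..t}"
          by (rule spike[OF LINT(2)]) (simp add: max_absorb1)
        show "\<bar>R t \<omega> - R t \<omega>\<bar> \<le> 0" by simp
        show "\<bar>\<Theta> t \<omega> - (noise \<omega> t + ?X t)\<bar> \<le> 0" using \<Theta>_eq[of t] t by (simp add: min_absorb1)
      qed
      show "\<Theta> t \<omega> = \<Theta> (\<tau> \<omega>) \<omega>" if "\<tau> \<omega> \<le> t" for t
        using \<Theta>_eq[of t] \<Theta>_eq[of "\<tau> \<omega>"] X_stop[OF that] that \<tau>_props(1) by (simp add: min_absorb2)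
    qed (use \<tau>_props in auto)
    then show ?case by blast
  qed
qed

theorem solution_unique:
  assumes "solution R \<Theta>" "solution R' \<Theta>'"
  shows "indistinguishable M R R'" "indistinguishable M \<Theta> \<Theta>'"
proof -
  have "AE \<omega> in M. \<forall>t\<ge>0. R t \<omega> = R' t \<omega> \<and> \<Theta> t \<omega> = \<Theta>' t \<omega>"
    using solution_stopped_path[OF assms(1)] solution_stopped_path[OF assms(2)]
    by eventually_elim (use stopped_path_unique in blast)
  then show "indistinguishable M R R'" "indistinguishable M \<Theta> \<Theta>'"
    unfolding indistinguishable_def by (auto elim: eventually_mono)
qed

theorem solution_hitting_time:
  assumes "solution R \<Theta>"
  shows "AE \<omega> in M. hitting_time \<eta> R \<omega> \<le> ennreal (sqrt 2 * (r - \<eta>) / v)"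
  using solution_radius_hits[OF assms]
proof eventually_elim
  case (elim \<omega>)
  then obtain \<tau> where \<tau>: "0 \<le> \<tau>" "\<tau> \<le> sqrt 2 * (r - \<eta>) / v" "R \<tau> \<omega> = \<eta>" by blast
  have "hitting_time \<eta> R \<omega> \<le> ennreal \<tau>"
    unfolding hitting_time_def by (rule Inf_lower) (use \<tau> in auto)
  also have "\<dots> \<le> ennreal (sqrt 2 * (r - \<eta>) / v)" using \<tau> by (intro ennreal_leI)
  finally show ?case .
qed

text \<open>The stopped process is the composition of \<open>Y\<close>, jointly measurable on $[0, t]$ with respect to \<open>F t\<close>, with
the \<open>F t\<close>-measurable time $t \wedge \tau$.\<close>

lemma stopped_process_adapted:
  fixes Y :: "real \<Rightarrow> 'a \<Rightarrow> real"
  assumes Y: "\<And>s. 0 \<le> s \<Longrightarrow> Y s \<in> borel_measurable (F s)"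
    and cont: "\<And>\<omega>. \<omega> \<in> space M \<Longrightarrow> continuous_on {0..} (\<lambda>s. Y s \<omega>)"
    and \<tau>: "\<And>\<omega>. \<omega> \<in> space M \<Longrightarrow> 0 \<le> \<tau> \<omega>" "\<And>s. 0 \<le> s \<Longrightarrow> {\<omega> \<in> space M. \<tau> \<omega> \<le> s} \<in> sets (F s)"
    and t: "0 \<le> t"
  shows "(\<lambda>\<omega>. Y (min t (\<tau> \<omega>)) \<omega>) \<in> borel_measurable (F t)"
proof -
  have "(\<lambda>\<omega>. min t (\<tau> \<omega>)) \<in> borel_measurable (F t)"
    unfolding borel_measurable_iff_le
  proof (intro allI)
    fix a
    consider "a < 0" | "0 \<le> a" "a < t" | "t \<le> a" by linarith
    then show "{\<omega> \<in> space (F t). min t (\<tau> \<omega>) \<le> a} \<in> sets (F t)"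
    proof cases
      case 1
      have empty: "{\<omega> \<in> space (F t). min t (\<tau> \<omega>) \<le> a} = {}"
        using 1 t \<tau>(1) by (force simp: space_F_eq)
      show ?thesis unfolding empty by simp
    next
      case 2
      then have "{\<omega> \<in> space (F t). min t (\<tau> \<omega>) \<le> a} = {\<omega> \<in> space M. \<tau> \<omega> \<le> a}"
        by (auto simp: space_F_eq)
      then show ?thesis using \<tau>(2)[of a] sets_F_mono[of a t] 2 by auto
    next
      case 3
      have all: "{\<omega> \<in> space (F t). min t (\<tau> \<omega>) \<le> a} = space (F t)" using 3 by auto
      show ?thesis unfolding all by simp
    qed
  qed
  then have pair: "(\<lambda>\<omega>. (min t (\<tau> \<omega>), \<omega>)) \<in> F t \<rightarrow>\<^sub>M borel \<Otimes>\<^sub>M F t"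
    by (rule measurable_Pair) simp
  have "(\<lambda>(s, \<omega>). Y (min t (max 0 s)) \<omega>) \<in> borel_measurable (borel \<Otimes>\<^sub>M F t)"
  proof (rule continuous_process_jointly_measurable[where X = "\<lambda>s. Y (min t s)"])
    show "Y (min t s) \<in> borel_measurable (F t)" if "0 \<le> s" for s
      by (rule measurable_F_mono[OF Y]) (use that t in auto)
    show "continuous_on {0..} (\<lambda>s. Y (min t s) \<omega>)" if "\<omega> \<in> space (F t)" for \<omega>
      using that t by (intro continuous_on_compose2[OF cont, of \<omega> "{0..}" "\<lambda>s. min t s"])
        (auto simp: space_F_eq intro!: continuous_intros)
  qed
  from measurable_compose[OF pair this]
  have "(\<lambda>\<omega>. Y (min t (max 0 (min t (\<tau> \<omega>)))) \<omega>) \<in> borel_measurable (F t)" by simp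
  then show ?thesis
    by (rule measurable_cong[THEN iffD1, rotated]) (use t \<tau>(1) in \<open>auto simp: space_F_eq max_absorb2\<close>)
qed

text \<open>The solution is the limit of the Euler scheme driven by \<open>noise \<omega>\<close>, stopped when its radius reaches \<open>\<eta>\<close>.
The Lipschitz drift \<open>X\<close> keeps the angle away from the discontinuities of \<open>h\<close> for almost every time.\<close>

theorem solution_exists: "\<exists>R \<Theta>. solution R \<Theta>"
proof -
  define \<rho> where "\<rho> t \<omega> = limit_radius r (noise \<omega>) t" for t \<omega>
  define X where "X t \<omega> = limit_drift r (noise \<omega>) t" for t \<omega>
  define y where "y t \<omega> = noise \<omega> t + X t \<omega>" for t \<omega>
  have "\<exists>\<tau>. \<omega> \<in> space M \<longrightarrow> 0 \<le> \<tau> \<and> \<rho> \<tau> \<omega> = \<eta> \<and> (\<forall>s\<ge>0. \<eta> < \<rho> s \<omega> \<longleftrightarrow> s < \<tau>)" for \<omega>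
    unfolding \<rho>_def using limit_radius_hits[OF noise_continuous r_gt] by metis
  then obtain \<tau> where \<tau>: "\<And>\<omega>. \<omega> \<in> space M \<Longrightarrow> 0 \<le> \<tau> \<omega>" "\<And>\<omega>. \<omega> \<in> space M \<Longrightarrow> \<rho> (\<tau> \<omega>) \<omega> = \<eta>"
    "\<And>\<omega> s. \<omega> \<in> space M \<Longrightarrow> 0 \<le> s \<Longrightarrow> \<eta> < \<rho> s \<omega> \<longleftrightarrow> s < \<tau> \<omega>" by metis
  define R where "R t \<omega> = \<rho> (min t (\<tau> \<omega>)) \<omega>" for t \<omega>
  define \<Theta> where "\<Theta> t \<omega> = y (min t (\<tau> \<omega>)) \<omega>" for t \<omega>
  have meas: "\<rho> t \<in> borel_measurable (F t)" "X t \<in> borel_measurable (F t)" if "0 \<le> t" for t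
    unfolding \<rho>_def X_def using that
    by (auto intro!: limit_measurable noise_adapted noise_continuous simp: space_F_eq)
  have y_meas: "y t \<in> borel_measurable (F t)" if "0 \<le> t" for t
    unfolding y_def by (rule borel_measurable_add[OF noise_adapted[OF that order_refl] meas(2)[OF that]])
  have cont: "continuous_on {0..} (\<lambda>t. \<rho> t \<omega>)" "continuous_on {0..} (\<lambda>t. y t \<omega>)" if "\<omega> \<in> space M" for \<omega>
    unfolding \<rho>_def y_def X_def using noise_continuous[OF that]
    by (auto intro!: continuous_intros limit_continuous)
  have \<tau>_stop: "{\<omega> \<in> space M. \<tau> \<omega> \<le> s} \<in> sets (F s)" if "0 \<le> s" for s
  proof -
    have [measurable]: "\<rho> s \<in> borel_measurable (F s)" by (rule meas(1)[OF that])
    have "\<tau> \<omega> \<le> s \<longleftrightarrow> \<not> \<eta> < \<rho> s \<omega>" if "\<omega> \<in> space M" for \<omega>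
      using \<tau>(3)[OF that \<open>0 \<le> s\<close>] by (simp add: not_less)
    then have "{\<omega> \<in> space M. \<tau> \<omega> \<le> s} = {\<omega> \<in> space (F s). \<not> \<eta> < \<rho> s \<omega>}"
      by (auto simp: space_F_eq)
    also have "\<dots> \<in> sets (F s)" by measurable
    finally show ?thesis .
  qed
  have R_meas: "R t \<in> borel_measurable (F t)" and \<Theta>_meas: "\<Theta> t \<in> borel_measurable (F t)" if "0 \<le> t" for t
    unfolding R_def \<Theta>_def
    using stopped_process_adapted[OF meas(1) cont(1) \<tau>(1) \<tau>_stop that]
      stopped_process_adapted[OF y_meas cont(2) \<tau>(1) \<tau>_stop that] by auto
  have min_cont: "continuous_on {0..} (\<lambda>t. f (min t (\<tau> \<omega>)))" if "continuous_on {0..} f" "\<omega> \<in> space M"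
    for f :: "real \<Rightarrow> real" and \<omega>
    using \<tau>(1)[OF that(2)] by (intro continuous_on_compose2[OF that(1)]) (auto intro!: continuous_intros)
  have R_cont: "continuous_on {0..} (\<lambda>t. R t \<omega>)" and \<Theta>_cont: "continuous_on {0..} (\<lambda>t. \<Theta> t \<omega>)"
    if "\<omega> \<in> space M" for \<omega>
    unfolding R_def \<Theta>_def using min_cont[OF cont(1) that] min_cont[OF cont(2) that] that by auto
  have R_gt: "\<eta> < R s \<omega> \<longleftrightarrow> s < \<tau> \<omega>" if "\<omega> \<in> space M" "0 \<le> s" for \<omega> s
    unfolding R_def using \<tau>[OF that(1)] that by (cases "s < \<tau> \<omega>") (auto simp: min_def)
  have ito: "is_ito_integral M F B (\<lambda>s \<omega>. indicator {\<eta><..} (R s \<omega>) * \<sigma>)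
      (\<lambda>t \<omega>. \<sigma> * (B (min t (\<tau> \<omega>)) \<omega> - B 0 \<omega>))"
    by (rule ito_integral_of_stopped_constant[OF R_meas R_cont \<tau>(1) R_gt])
  have start: "R 0 \<omega> = r" "\<Theta> 0 \<omega> = \<theta> + \<sigma> * B 0 \<omega>" if "\<omega> \<in> space M" for \<omega>
    using \<tau>(1)[OF that] limit_at_0[of r "noise \<omega>"]
    by (simp_all add: R_def \<Theta>_def \<rho>_def y_def X_def noise_def[of \<omega> 0])
  note LINT = stopped_drift_LINT[OF R_cont \<Theta>_cont]
  have eqR: "R t \<omega> = R 0 \<omega> + (LINT s:{0..t}|lborel. indicator {\<eta><..} (R s \<omega>) * (- v * g (\<Theta> s \<omega>)))"
    if \<omega>: "\<omega> \<in> space M" and t: "0 \<le> t" for \<omega> t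
  proof -
    have "((\<lambda>s. indicator {\<eta><..} (R s \<omega>) * (- v * g (\<Theta> s \<omega>))) has_integral
        (\<rho> (min t (\<tau> \<omega>)) \<omega> - r)) {0..t}"
    proof (rule has_integral_stopped)
      show "((\<lambda>s. - v * g (y s \<omega>)) has_integral (\<rho> (min t (\<tau> \<omega>)) \<omega> - r)) {0..min t (\<tau> \<omega>)}"
        unfolding \<rho>_def y_def X_def
        by (rule limit_radius_has_integral[OF noise_continuous[OF \<omega>]]) (use t \<tau>(1)[OF \<omega>] in simp)
    qed (use R_gt[OF \<omega>] \<tau>(1)[OF \<omega>] t in \<open>auto simp: \<Theta>_def indicator_def min_absorb1\<close>)
    from has_integral_unique[OF this LINT(1)[OF \<omega> \<omega>]] show ?thesis
      using start[OF \<omega>] by (simp add: R_def[of t])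
  qed
  have "AE \<omega> in M. negligible {s \<in> {0..}. \<sigma> * B s \<omega> + (\<theta> + X s \<omega>) \<in> {x. \<not> isCont h x}}"
  proof (rule lipschitz_perturbation_avoids_countable_set[where K = "v / \<eta>", OF \<sigma>_pos _ h_discontinuities_countable])
    show "0 \<le> v / \<eta>" using v_pos \<eta>_pos by simp
    show "(\<lambda>\<omega>. \<theta> + X t \<omega>) \<in> borel_measurable (F t)" if "0 \<le> t" for t
      using meas(2)[OF that] by simp
    show "\<bar>(\<theta> + X t \<omega>) - (\<theta> + X s \<omega>)\<bar> \<le> v / \<eta> * (t - s)" if "\<omega> \<in> space M" "0 \<le> s" "s \<le> t" for \<omega> s t
      using limit_drift_lipschitz[OF noise_continuous[OF that(1)] that(2,3), of r] by (simp add: X_def)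
  qed
  then have eq\<Theta>: "AE \<omega> in M. \<forall>t\<ge>0. \<Theta> t \<omega> = \<Theta> 0 \<omega>
      + (LINT s:{0..t}|lborel. indicator {\<eta><..} (R s \<omega>) * (v * h (\<Theta> s \<omega>) / R s \<omega>))
      + \<sigma> * (B (min t (\<tau> \<omega>)) \<omega> - B 0 \<omega>)"
    using AE_space
  proof eventually_elim
    case (elim \<omega>)
    then have \<omega>: "\<omega> \<in> space M" by simp
    show ?case
    proof (intro allI impI)
      fix t :: real assume t: "0 \<le> t"
      have u: "0 \<le> min t (\<tau> \<omega>)" using t \<tau>(1)[OF \<omega>] by simp
      have "((\<lambda>s. indicator {\<eta><..} (R s \<omega>) * (v * h (\<Theta> s \<omega>) / R s \<omega>)) has_integral X (min t (\<tau> \<omega>)) \<omega>) {0..t}"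
      proof (rule has_integral_stopped)
        show "((\<lambda>s. v * h (y s \<omega>) / max (\<rho> s \<omega>) \<eta>) has_integral X (min t (\<tau> \<omega>)) \<omega>) {0..min t (\<tau> \<omega>)}"
          unfolding \<rho>_def y_def X_def
        proof (rule limit_drift_has_integral[OF noise_continuous[OF \<omega>] u])
          show "negligible {s \<in> {0..min t (\<tau> \<omega>)}. \<not> isCont h (noise \<omega> s + limit_drift r (noise \<omega>) s)}"
            by (rule negligible_subset[OF elim(1)]) (auto simp: noise_def X_def add_ac)
        qed
        show "indicator {\<eta><..} (R s \<omega>) * (v * h (\<Theta> s \<omega>) / R s \<omega>) = v * h (y s \<omega>) / max (\<rho> s \<omega>) \<eta>"
          if "0 \<le> s" "s < \<tau> \<omega>" for s
          using R_gt[OF \<omega> that(1)] \<tau>(3)[OF \<omega> that(1)] that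
          by (simp add: R_def \<Theta>_def min_absorb1 max_absorb1)
      qed (use R_gt[OF \<omega>] \<tau>(1)[OF \<omega>] t in \<open>auto simp: indicator_def\<close>)
      from has_integral_unique[OF this LINT(2)[OF \<omega> \<omega>]] start[OF \<omega>]
      show "\<Theta> t \<omega> = \<Theta> 0 \<omega>
          + (LINT s:{0..t}|lborel. indicator {\<eta><..} (R s \<omega>) * (v * h (\<Theta> s \<omega>) / R s \<omega>))
          + \<sigma> * (B (min t (\<tau> \<omega>)) \<omega> - B 0 \<omega>)"
        by (simp add: \<Theta>_def[of t] y_def noise_def algebra_simps)
    qed
  qed
  have "solution R \<Theta>"
    unfolding strong_solution_def
  proof (intro conjI allI impI ballI exI[of _ "\<lambda>t \<omega>. \<sigma> * (B (min t (\<tau> \<omega>)) \<omega> - B 0 \<omega>)"])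
    show "AE \<omega> in M. R 0 \<omega> = r \<and> \<Theta> 0 \<omega> = \<theta>"
      using start_B AE_space by eventually_elim (simp add: start)
    show "AE \<omega> in M. \<forall>t\<ge>0.
        set_integrable lborel {0..t} (\<lambda>s. indicator {\<eta><..} (R s \<omega>) * (- v * g (\<Theta> s \<omega>))) \<and>
        set_integrable lborel {0..t} (\<lambda>s. indicator {\<eta><..} (R s \<omega>) * (v * h (\<Theta> s \<omega>) / R s \<omega>))"
      by (intro AE_I2 allI impI conjI stopped_drift_set_integrable R_cont \<Theta>_cont)
    show "AE \<omega> in M. \<forall>t\<ge>0. R t \<omega> = R 0 \<omega>
        + (LINT s:{0..t}|lborel. indicator {\<eta><..} (R s \<omega>) * (- v * g (\<Theta> s \<omega>)))"
      by (intro AE_I2 allI impI eqR)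
  qed (fact R_meas \<Theta>_meas R_cont \<Theta>_cont ito eq\<Theta>)+
  then show ?thesis by blast
qed

end

section \<open>The feedback strategy\<close>

lemma rates_one_sided_drift:
  assumes "0 < v" "0 < \<eta>"
  shows "one_sided_drift v \<eta> radial_rate angular_rate"
proof
  fix x y :: real
  show "\<bar>radial_rate x - radial_rate y\<bar> \<le> \<bar>x - y\<bar>"
    using rates_increment[of x y] rates_increment[of y x] by (cases "x \<le> y") auto
  show "x \<le> y \<Longrightarrow> angular_rate y - angular_rate x \<le> y - x"
    using rates_increment[of x y] by simp
qed (fact assms radial_rate_ge radial_rate_le angular_rate_bound)+

lemma astar_measurable: "astar \<in> borel \<rightarrow>\<^sub>M count_space {1, - 1}"
proof -
  have "rep (- 3 * pi / 4) \<in> borel_measurable borel"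
    unfolding rep_def[abs_def] rmod_conv_frac' frac_def by measurable
  then have S: "rep (- 3 * pi / 4) -` {..<pi / 4} \<in> sets borel"
    by (rule measurable_sets_borel) simp
  have "(\<lambda>\<theta>. if \<theta> \<in> rep (- 3 * pi / 4) -` {..<pi / 4} then - 1 else 1 :: int) \<in> borel \<rightarrow>\<^sub>M count_space {1, - 1}"
    by (rule measurable_If_set) (simp_all only: space_borel Int_UNIV_right S, simp_all)
  then show ?thesis by (simp add: astar_def[abs_def])
qed

theorem theorem6p2:
  fixes M :: "'a measure" and F :: "real \<Rightarrow> 'a measure" and B :: "real \<Rightarrow> 'a \<Rightarrow> real"
    and v \<sigma> \<eta> r \<theta> :: real
  assumes "brownian_motion M F B"
    and "v > 0" and "\<sigma> > 0" and "\<eta> > 0" and "r > \<eta>"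
  defines "solves \<equiv> strong_solution M F B \<sigma> \<eta>
      (\<lambda>t \<omega> y. mu1_star v y) (\<lambda>t \<omega> x y. mu2_star v x y) r \<theta>"
  shows "(\<exists>R \<Theta>. solves R \<Theta>) \<and>
    (\<forall>R \<Theta> R' \<Theta>'. solves R \<Theta> \<longrightarrow> solves R' \<Theta>' \<longrightarrow>
       indistinguishable M R R' \<and> indistinguishable M \<Theta> \<Theta>') \<and>
    (\<forall>R \<Theta>. solves R \<Theta> \<longrightarrow>
       (AE \<omega> in M. hitting_time \<eta> R \<omega> \<le> ennreal (sqrt 2 * (r - \<eta>) / v)) \<and>
       (\<lambda>t \<omega>. astar (\<Theta> t \<omega>)) \<in> admissible M F B v \<sigma> \<eta> r \<theta>)"
proof -
  interpret brownian_motion M F B by fact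
  interpret one_sided_drift v \<eta> radial_rate angular_rate
    by (rule rates_one_sided_drift) fact+
  interpret stopped_diffusion M F B v \<eta> radial_rate angular_rate \<sigma> r \<theta>
    by unfold_locales fact+
  have solves: "solves = solution" unfolding solves_def mu1_star_eq mu2_star_eq ..
  have hit: "AE \<omega> in M. hitting_time \<eta> R \<omega> \<le> ennreal (sqrt 2 * (r - \<eta>) / v)" if "solves R \<Theta>" for R \<Theta>
    using that unfolding solves by (rule solution_hitting_time)
  have admissible: "(\<lambda>t \<omega>. astar (\<Theta> t \<omega>)) \<in> admissible M F B v \<sigma> \<eta> r \<theta>" if sol: "solves R \<Theta>" for R \<Theta>
    unfolding admissible_def mem_Collect_eq
  proof (intro conjI allI impI)
    note sol' = sol[unfolded solves_def strong_solution_def]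
    have \<Theta>: "\<And>t. 0 \<le> t \<Longrightarrow> \<Theta> t \<in> borel_measurable (F t)"
      "\<And>\<omega>. \<omega> \<in> space M \<Longrightarrow> continuous_on {0..} (\<lambda>t. \<Theta> t \<omega>)" using sol' by blast+
    show "(\<lambda>(t, \<omega>). astar (\<Theta> t \<omega>)) \<in> restrict_space borel {0..} \<Otimes>\<^sub>M M \<rightarrow>\<^sub>M count_space {1, - 1}"
      using measurable_compose[OF continuous_process_measurable_nonneg[OF measurable_F_M[OF \<Theta>(1)] \<Theta>(2)] astar_measurable]
      by (simp add: case_prod_beta)
    show "(\<lambda>\<omega>. astar (\<Theta> t \<omega>)) \<in> F t \<rightarrow>\<^sub>M count_space {1, - 1}" if "0 \<le> t" for t
      by (rule measurable_compose[OF \<Theta>(1)[OF that] astar_measurable])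
    have "strong_solution M F B \<sigma> \<eta> (\<lambda>t \<omega> y. mu1 v y (astar (\<Theta> t \<omega>)))
        (\<lambda>t \<omega> x y. mu2 v x y (astar (\<Theta> t \<omega>))) r \<theta> R \<Theta>"
      using sol' unfolding strong_solution_def mu1_star_def mu2_star_def .
    moreover have "(\<integral>\<^sup>+\<omega>. hitting_time \<eta> R \<omega> \<partial>M) < \<infinity>"
    proof -
      have "(\<integral>\<^sup>+\<omega>. hitting_time \<eta> R \<omega> \<partial>M) \<le> (\<integral>\<^sup>+\<omega>. ennreal (sqrt 2 * (r - \<eta>) / v) \<partial>M)"
        by (rule nn_integral_mono_AE[OF hit[OF sol]])
      also have "\<dots> < \<infinity>" by (simp add: emeasure_space_1)
      finally show ?thesis .
    qed
    ultimately show "\<exists>R \<Theta>'. strong_solution M F B \<sigma> \<eta> (\<lambda>t \<omega> y. mu1 v y (astar (\<Theta> t \<omega>)))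
        (\<lambda>t \<omega> x y. mu2 v x y (astar (\<Theta> t \<omega>))) r \<theta> R \<Theta>' \<and> (\<integral>\<^sup>+\<omega>. hitting_time \<eta> R \<omega> \<partial>M) < \<infinity>"
      by (intro exI conjI)
  qed
  show ?thesis
    using solution_exists solution_unique hit admissible unfolding solves by blast
qed

end
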